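(* Let $d\ge 2$ and consider the two-type competition model with conversion on $\mathbb{Z}^d$. For every $\rho>0$ there exists $\lambda'=\lambda'(\rho,d)<1$ such that if $\lambda>\lambda'$ (with $\lambda>0$), then in the model with parameters $\lambda$ and $\rho$, type 1 dies out almost surely.
   Context: The two-type competition model with conversion on an infinite connected graph $G$ with parameters $\lambda,\rho>0$ is defined as follows. Each site (vertex) is at each time vacant, occupied by type 1, or occupied by type 2. At time $0$ a single distinguished site (the origin, when $G=\mathbb{Z}^d$ with nearest-neighbour edges) is occupied by type 1 and all other sites are vacant. A site occupied by type 1 attempts to occupy each neighbouring site at rate $1$ (through each edge, after an independent exponential time of rate $1$); the attempt succeeds only if the neighbouring site is vacant. To each site $x$ is assigned a conversion time $\mathcal{I}_x$, where $\{\mathcal{I}_x\}_x$ are i.i.d. exponential random variables of rate $\rho$, independent of everything else; once $x$ is occupied by type 1, after a further time $\mathcal{I}_x$ it converts to type 2 (if it is not already type 2). A site occupied by type 2 spreads type 2 through each incident edge at rate $\lambda$ to neighbouring sites that are vacant or occupied by type 1. A site occupied by type 2 stays type 2 forever. Equivalently, it is the continuous-time Markov process in which a vacant site becomes type 1 at rate (number of type 1 neighbours), a vacant site becomes type 2 at rate $\lambda\cdot$(number of type 2 neighbours), and a type 1 site becomes type 2 at rate $\rho+\lambda\cdot$(number of type 2 neighbours). Type 1 survives if the set of sites occupied by type 1 is non-empty at all times; otherwise type 1 dies out. *)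

theory Defs
  imports "HOL-Probability.Probability"
begin

section \<open>Two-type competition with conversion on a graph\<close>

text \<open>
  The graph is given by its adjacency relation \<open>adj\<close>, and \<open>start\<close> is the site that is initially of
  type 1.  The model is built from independent exponential clocks.  \<open>Spread1 y x\<close> is the time that
  \<open>y\<close> needs, after becoming type 1, for its attempt to occupy \<open>x\<close>; \<open>Spread2 y x\<close> is the time that
  \<open>y\<close> needs, after becoming type 2, to spread type 2 to \<open>x\<close>.  One clock for each ordered pair and
  type suffices: after the first attempt of type 1 the site \<open>x\<close> is not vacant, and after the first
  attempt of type 2 it is of type 2 for ever, so later attempts have no effect.  Clocks of
  non-adjacent pairs are never consulted.
\<close>

datatype 'v clock = Spread1 'v 'v | Spread2 'v 'v | Conversion 'v

primrec clock_rate :: "real \<Rightarrow> real \<Rightarrow> 'v clock \<Rightarrow> real" where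
  "clock_rate lam rho (Spread1 y x) = 1"
| "clock_rate lam rho (Spread2 y x) = lam"
| "clock_rate lam rho (Conversion x) = rho"

definition clock_space :: "real \<Rightarrow> real \<Rightarrow> ('v clock \<Rightarrow> real) measure" where
  "clock_space lam rho =
     (\<Pi>\<^sub>M c\<in>UNIV. density lborel (exponential_density (clock_rate lam rho c)))"

text \<open>
  Below, \<open>T1 x\<close> is the time at which \<open>x\<close> becomes type 1 and \<open>T2 x\<close> the time at which it becomes
  type 2, with value \<open>\<infinity>\<close> if this never happens.  Thus \<open>y\<close> is of type 1 exactly during
  \<open>[T1 y, T2 y)\<close>, and its attempt at \<open>x\<close> takes place only if the clock rings within that period.
\<close>

definition first_attempt1 ::
    "('v \<Rightarrow> 'v \<Rightarrow> bool) \<Rightarrow> 'v \<Rightarrow> ('v clock \<Rightarrow> real) \<Rightarrow> ('v \<Rightarrow> ennreal) \<Rightarrow> ('v \<Rightarrow> ennreal) \<Rightarrow> 'v \<Rightarrow> ennreal"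
  where
  "first_attempt1 adj start \<omega> T1 T2 x =
     (if x = start then 0
      else (INF y\<in>{y. adj y x \<and> T1 y + ennreal (\<omega> (Spread1 y x)) < T2 y}.
              T1 y + ennreal (\<omega> (Spread1 y x))))"

definition first_attempt2 ::
    "('v \<Rightarrow> 'v \<Rightarrow> bool) \<Rightarrow> ('v clock \<Rightarrow> real) \<Rightarrow> ('v \<Rightarrow> ennreal) \<Rightarrow> 'v \<Rightarrow> ennreal" where
  "first_attempt2 adj \<omega> T2 x = (INF y\<in>{y. adj y x}. T2 y + ennreal (\<omega> (Spread2 y x)))"

text \<open>
  A type 1 attempt succeeds iff the site is still vacant, that is, iff type 2 has not come earlier.
\<close>

definition is_evolution ::
    "('v \<Rightarrow> 'v \<Rightarrow> bool) \<Rightarrow> 'v \<Rightarrow> ('v clock \<Rightarrow> real) \<Rightarrow> ('v \<Rightarrow> ennreal) \<Rightarrow> ('v \<Rightarrow> ennreal) \<Rightarrow> bool" where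
  "is_evolution adj start \<omega> T1 T2 \<longleftrightarrow>
     (\<forall>x. T1 x = (if first_attempt1 adj start \<omega> T1 T2 x < first_attempt2 adj \<omega> T2 x
                  then first_attempt1 adj start \<omega> T1 T2 x else \<infinity>) \<and>
          T2 x = min (first_attempt2 adj \<omega> T2 x) (T1 x + ennreal (\<omega> (Conversion x))))"

text \<open>
  On a graph of bounded degree the clocks almost surely admit exactly one evolution: what happens at
  a site up to time \<open>t\<close> is determined by what happens at it and its neighbours up to time \<open>t\<close>, a
  positive clock being used up at least at every second step of this recursion, and almost surely no
  infinite chain of such steps fits into a finite time.
\<close>

definition evolution ::
    "('v \<Rightarrow> 'v \<Rightarrow> bool) \<Rightarrow> 'v \<Rightarrow> ('v clock \<Rightarrow> real) \<Rightarrow> ('v \<Rightarrow> ennreal) \<times> ('v \<Rightarrow> ennreal)" where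
  "evolution adj start \<omega> = (THE T. is_evolution adj start \<omega> (fst T) (snd T))"

datatype site_state = Vacant | Type1 | Type2

definition state_at ::
    "('v \<Rightarrow> 'v \<Rightarrow> bool) \<Rightarrow> 'v \<Rightarrow> ('v clock \<Rightarrow> real) \<Rightarrow> real \<Rightarrow> 'v \<Rightarrow> site_state" where
  "state_at adj start \<omega> t x =
     (if snd (evolution adj start \<omega>) x \<le> ennreal t then Type2
      else if fst (evolution adj start \<omega>) x \<le> ennreal t then Type1
      else Vacant)"

definition type1_survives ::
    "('v \<Rightarrow> 'v \<Rightarrow> bool) \<Rightarrow> 'v \<Rightarrow> ('v clock \<Rightarrow> real) \<Rightarrow> bool" where
  "type1_survives adj start \<omega> \<longleftrightarrow> (\<forall>t\<ge>0. {x. state_at adj start \<omega> t x = Type1} \<noteq> {})"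

abbreviation type1_dies_out ::
    "('v \<Rightarrow> 'v \<Rightarrow> bool) \<Rightarrow> 'v \<Rightarrow> ('v clock \<Rightarrow> real) \<Rightarrow> bool" where
  "type1_dies_out adj start \<omega> \<equiv> \<not> type1_survives adj start \<omega>"

definition lattice_adj :: "int ^ 'd \<Rightarrow> int ^ 'd \<Rightarrow> bool" where
  "lattice_adj x y \<longleftrightarrow> (\<Sum>i\<in>UNIV. \<bar>x $ i - y $ i\<bar>) = 1"

end

theory Submission
  imports Defs
begin

text \<open>
  If type 1 reaches \<open>x\<close>, it does so along a path from the origin each of whose sites passes the
  type on before its own conversion time, and not later than type 2 could arrive from the
  origin. So the passage time of that path is at most \<open>I\<^sub>0 + D\<^sub>2(0,x)\<close>, where \<open>D\<^sub>1\<close> and \<open>D\<^sub>2\<close>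
  are the first passage metrics of the two independent families of spreading clocks and \<open>I\<^sub>0\<close> is
  the conversion time of the origin. For \<open>lam = 1\<close> they have the same law, so by a weak law of
  large numbers \<open>D\<^sub>2(0,x) \<le> D\<^sub>1(0,x) + \<epsilon> |x|\<close> for all \<open>x\<close> on a large sphere, with high
  probability; this persists for \<open>lam\<close> close to 1 and for larger \<open>lam\<close>. Hence the path is almost
  a geodesic of \<open>D\<^sub>1\<close>.

  In most blocks of a fixed large side an almost geodesic coincides with the unique geodesic
  between the points where it enters and leaves. The conversion times are independent of that
  geodesic, and it has many slow steps, so it is exponentially unlikely that no site on it
  converts in time. A Peierls argument over chains of separated blocks excludes such paths at
  large distances.

  That the evolution exists and is unique follows from the same Peierls bound: sites with an
  incident clock shorter than \<open>\<delta>\<close> do not percolate, so tracing back the state of a site uses up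
  any finite time after finitely many steps.
\<close>

section \<open>Lattice chains, the Peierls bound and independence\<close>

text \<open>The lineage of type 1 is selected with knowledge of all clocks, so its conversion times
  cannot be treated as fresh. The way out is to look at paths only: \<open>crossing\<close> asks
  whether some near-minimal path through a block is unconverted. Unless two paths nearly tie there
  is just one candidate, determined by the \<open>Spread1\<close> clocks alone. The order of choices
  matters: first the tolerated probability of a crossing, against the number of chains; then the
  block side \<open>k\<close>; last the tie tolerance \<eta>, against the huge number of paths in a
  block of side \<open>k\<close>. The resulting excess rate \<epsilon> does not depend on the
  radius. No shape theorem is used: only the difference of the two metrics is controlled, and only
  in probability, which suffices because a single good sphere stops type 1. All metric estimates are
  made at \<open>lam = 1\<close>. Rescaling the \<open>Spread2\<close> clocks couples every
  \<open>lam\<close> with that case, and since passage times are at most linear in the radius, a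
  factor \<open>1 / lam'\<close> slightly above 1 costs only a fraction of the excess. So one
  \<open>lam'\<close> below 1 serves all larger rates.\<close>

definition l1 :: "int ^ 'd::finite \<Rightarrow> nat" where
  "l1 v = nat (\<Sum>i\<in>UNIV. \<bar>v $ i\<bar>)"

lemma int_l1: "int (l1 v) = (\<Sum>i\<in>UNIV. \<bar>v $ i\<bar>)"
  unfolding l1_def by (simp add: sum_nonneg)

lemma l1_triangle: "l1 (u - w) \<le> l1 (u - v) + l1 (v - w)"
proof -
  have "int (l1 (u - w)) \<le> int (l1 (u - v)) + int (l1 (v - w))"
    unfolding int_l1 sum.distrib[symmetric] by (intro sum_mono) auto
  then show ?thesis by linarith
qed

lemma l1_commute: "l1 (u - v) = l1 (v - u)"
  unfolding l1_def by (simp add: abs_minus_commute)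

lemma l1_eq_0_iff [simp]: "l1 v = 0 \<longleftrightarrow> v = 0"
proof -
  have "l1 v = 0 \<longleftrightarrow> int (l1 v) = 0" by simp
  also have "\<dots> \<longleftrightarrow> v = 0" unfolding int_l1 by (subst sum_nonneg_eq_0_iff) (auto simp: vec_eq_iff)
  finally show ?thesis .
qed

lemma l1_0 [simp]: "l1 0 = 0"
  by simp

lemma lattice_adj_iff: "lattice_adj x y \<longleftrightarrow> l1 (x - y) = 1"
proof -
  have "lattice_adj x y \<longleftrightarrow> int (l1 (x - y)) = 1"
    unfolding lattice_adj_def int_l1 by simp
  then show ?thesis by simp
qed

lemma abs_nth_le_l1: "\<bar>v $ i\<bar> \<le> int (l1 v)"
  unfolding int_l1 by (rule member_le_sum) auto

lemma l1_le_card: assumes "\<And>i. \<bar>(v :: int ^ 'd::finite) $ i\<bar> \<le> int r" shows "l1 v \<le> CARD('d) * r"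
proof -
  have "int (l1 v) \<le> (\<Sum>i\<in>(UNIV::'d set). int r)"
    unfolding int_l1 using assms by (intro sum_mono) auto
  then have "int (l1 v) \<le> int (CARD('d) * r)" by simp
  then show ?thesis by linarith
qed

lemma finite_l1_ball: "finite {v :: int ^ 'd::finite. l1 (v - u) \<le> r}"
proof (rule finite_subset)
  show "{v. l1 (v - u) \<le> r} \<subseteq> (\<lambda>f. \<chi> i. f i) ` (\<Pi>\<^sub>E i\<in>UNIV. {u $ i - int r .. u $ i + int r})"
  proof
    fix v assume "v \<in> {v. l1 (v - u) \<le> r}"
    then have "\<bar>v $ i - u $ i\<bar> \<le> int r" for i
      using abs_nth_le_l1[of "v - u" i] by simp
    then have "v $ i \<in> {u $ i - int r .. u $ i + int r}" for i
      by (metis abs_le_iff atLeastAtMost_iff diff_le_eq add.commute minus_diff_eq diff_add_cancel le_diff_eq)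
    then show "v \<in> (\<lambda>f. \<chi> i. f i) ` (\<Pi>\<^sub>E i\<in>UNIV. {u $ i - int r .. u $ i + int r})"
      by (intro image_eqI[of _ _ "\<lambda>i. v $ i"]) (auto simp: vec_eq_iff)
  qed
  show "finite ((\<lambda>f. \<chi> i. f i) ` (\<Pi>\<^sub>E i\<in>(UNIV::'d set). {u $ i - int r .. u $ i + int r}))"
    by (intro finite_imageI finite_PiE) auto
qed

text \<open>Each new centre is the point after the last visit to the open ball of radius
  \<open>b\<close> around the previous one. Last exit rather than first exit keeps the whole rest of
  the path at distance at least \<open>b\<close>, so all centres, not only consecutive ones, are
  pairwise separated. One step leaves the ball by at most \<open>a\<close>, hence the jump bound
  \<open>b + a\<close> and room for \<open>N\<close> jumps.\<close>

lemma last_exit_chain: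
  fixes v :: "nat \<Rightarrow> int ^ 'd::finite"
  assumes step: "\<And>i. i < n \<Longrightarrow> l1 (v (Suc i) - v i) \<le> a" and b: "b > 0"
    and "m \<le> n" and "l1 (v n - v m) \<ge> N * (b + a)"
  shows "\<exists>f. f 0 = m \<and> (\<forall>j\<le>N. f j \<le> n) \<and>
    (\<forall>j<N. f j < f (Suc j) \<and> l1 (v (f (Suc j)) - v (f j)) \<le> b + a \<and>
      (\<forall>i. f (Suc j) \<le> i \<and> i \<le> n \<longrightarrow> b \<le> l1 (v i - v (f j))))"
  using assms(3,4)
proof (induction N arbitrary: m)
  case 0
  then show ?case by (intro exI[of _ "\<lambda>_. m"]) auto
next
  case (Suc N)
  define A where "A = {i. m \<le> i \<and> i \<le> n \<and> l1 (v i - v m) < b}"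
  define l where "l = Max A"
  have A: "finite A" "A \<noteq> {}" using Suc.prems b by (auto simp: A_def)
  have lA: "l \<in> A" unfolding l_def using A by (rule Max_in)
  have "n \<notin> A" using Suc.prems by (auto simp: A_def)
  with lA have ln: "l < n" "m \<le> l" "l1 (v l - v m) < b" by (auto simp: A_def intro: le_neq_implies_less)
  have out: "b \<le> l1 (v i - v m)" if "Suc l \<le> i" "i \<le> n" for i
  proof (rule ccontr)
    assume "\<not> ?thesis"
    then have "i \<in> A" using that ln by (auto simp: A_def)
    then have "i \<le> l" unfolding l_def using A by simp
    with that show False by simp
  qed
  have s: "l1 (v (Suc l) - v m) \<le> b + a"
    using l1_triangle[of "v (Suc l)" "v m" "v l"] step[of l] ln by simp
  have "l1 (v n - v (Suc l)) \<ge> N * (b + a)"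
    using l1_triangle[of "v n" "v m" "v (Suc l)"] s Suc.prems by simp
  from Suc.IH[OF _ this] ln obtain f where f: "f 0 = Suc l" "\<forall>j\<le>N. f j \<le> n"
    "\<forall>j<N. f j < f (Suc j) \<and> l1 (v (f (Suc j)) - v (f j)) \<le> b + a \<and>
      (\<forall>i. f (Suc j) \<le> i \<and> i \<le> n \<longrightarrow> b \<le> l1 (v i - v (f j)))" by auto
  show ?case
  proof (intro exI[of _ "case_nat m f"] conjI allI impI)
    fix j assume "j \<le> Suc N"
    then show "case_nat m f j \<le> n" using f Suc.prems by (cases j) auto
  next
    fix j assume j: "j < Suc N"
    show "case_nat m f j < case_nat m f (Suc j)" using f ln j by (cases j) auto
    show "l1 (v (case_nat m f (Suc j)) - v (case_nat m f j)) \<le> b + a"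
      using f s j by (cases j) auto
    fix i assume "case_nat m f (Suc j) \<le> i \<and> i \<le> n"
    then show "b \<le> l1 (v i - v (case_nat m f j))" using f j out by (cases j) auto
  qed simp
qed

section \<open>Counting chains of sites; the Peierls bound\<close>

definition chains :: "int ^ 'd::finite \<Rightarrow> nat \<Rightarrow> nat \<Rightarrow> (int ^ 'd) list set" where
  "chains c r N = {zs. length zs = Suc N \<and> zs ! 0 = c \<and> (\<forall>j<N. l1 (zs ! Suc j - zs ! j) \<le> r)}"

lemma chains_card: "finite (chains c r N) \<and> card (chains (c :: int ^ 'd::finite) r N) \<le> card {v :: int ^ 'd. l1 v
  \<le> r} ^ N"
proof (induction N)
  case 0
  have "chains c r 0 = {[c]}" by (auto simp: chains_def length_Suc_conv)
  then show ?case by simp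
next
  case (Suc N)
  let ?B = "{v :: int ^ 'd. l1 v \<le> r}"
  have fB: "finite ?B" using finite_l1_ball[of 0 r] by simp
  have sub: "chains c r (Suc N) \<subseteq> (\<lambda>(zs, w). zs @ [zs ! N + w]) ` (chains c r N \<times> ?B)"
  proof
    fix zs assume zs: "zs \<in> chains c r (Suc N)"
    then have len: "length zs = Suc (Suc N)" by (simp add: chains_def)
    have "zs = take (Suc N) zs @ [zs ! Suc N]"
      using len by (metis take_Suc_conv_app_nth lessI take_all order_refl)
    moreover have "take (Suc N) zs \<in> chains c r N" using zs by (auto simp: chains_def)
    ultimately show "zs \<in> (\<lambda>(zs, w). zs @ [zs ! N + w]) ` (chains c r N \<times> ?B)"
      using zs by (intro image_eqI[of _ _ "(take (Suc N) zs, zs ! Suc N - zs ! N)"]) (auto simp: chains_def)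
  qed
  have fin: "finite ((\<lambda>(zs, w). zs @ [zs ! N + w]) ` (chains c r N \<times> ?B))"
    using Suc fB by auto
  have "card (chains c r (Suc N)) \<le> card (chains c r N \<times> ?B)"
    using Suc fB by (intro order_trans[OF card_mono[OF fin sub] card_image_le]) auto
  also have "\<dots> \<le> card ?B ^ Suc N" using Suc by (simp add: card_cartesian_product)
  finally show ?case using finite_subset[OF sub fin] by simp
qed

text \<open>If half of \<open>N\<close> events occur, then all events with index in some
  \<open>J\<close> of at least \<open>N / 2\<close> elements do. There are at most
  \<open>2 ^ N\<close> such sets, each contributing at most \<open>(q\<^sup>2) ^ card J\<close>,
  hence at most \<open>q ^ N\<close>; stating the hypothesis with \<open>q\<^sup>2\<close> avoids
  square roots. With \<open>card L\<close> at most \<open>C ^ N\<close>, the choice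
  \<open>q = 1 / (4 * C)\<close> made in the applications turns the bound into
  \<open>(1/2) ^ N\<close>.\<close>

lemma (in prob_space) peierls_bound:
  fixes E :: "'l \<Rightarrow> nat \<Rightarrow> 'a set" and q :: real
  assumes L: "finite L" and meas: "\<And>l j. l \<in> L \<Longrightarrow> j < N \<Longrightarrow> E l j \<in> events"
    and bound: "\<And>l J. l \<in> L \<Longrightarrow> J \<subseteq> {..<N} \<Longrightarrow> J \<noteq> {} \<Longrightarrow> prob (\<Inter>j\<in>J. E l j) \<le> (q\<^sup>2) ^ card J"
    and q: "0 \<le> q" "q \<le> 1" and N: "N > 0"
  shows "{\<omega>\<in>space M. \<exists>l\<in>L. N \<le> 2 * card {j. j < N \<and> \<omega> \<in> E l j}} \<in> events"
    and "prob {\<omega>\<in>space M. \<exists>l\<in>L. N \<le> 2 * card {j. j < N \<and> \<omega> \<in> E l j}} \<le> card L * (2 * q) ^ N"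
proof -
  define \<J> where "\<J> = {J. J \<subseteq> {..<N} \<and> N \<le> 2 * card J}"
  have f\<J>: "finite \<J>" unfolding \<J>_def by simp
  have ne: "J \<noteq> {}" if "J \<in> \<J>" for J using that N by (auto simp: \<J>_def)
  have fJ: "finite J" if "J \<in> \<J>" for J using that by (auto simp: \<J>_def intro: finite_subset)
  have card\<J>: "card \<J> \<le> 2 ^ N"
    using card_mono[of "Pow {..<N}" \<J>] by (auto simp: \<J>_def card_Pow)
  have eq: "{\<omega>\<in>space M. \<exists>l\<in>L. N \<le> 2 * card {j. j < N \<and> \<omega> \<in> E l j}} =
      (\<Union>(l, J)\<in>L \<times> \<J>. \<Inter>j\<in>J. E l j)" (is "?A = ?B")
  proof
    show "?A \<subseteq> ?B"
    proof
      fix \<omega> assume "\<omega> \<in> ?A"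
      then obtain l where l: "l \<in> L" "N \<le> 2 * card {j. j < N \<and> \<omega> \<in> E l j}" by auto
      then have "{j. j < N \<and> \<omega> \<in> E l j} \<in> \<J>" by (auto simp: \<J>_def)
      with l show "\<omega> \<in> ?B" by (intro UN_I[of "(l, {j. j < N \<and> \<omega> \<in> E l j})"]) auto
    qed
    show "?B \<subseteq> ?A"
    proof
      fix \<omega> assume "\<omega> \<in> ?B"
      then obtain l J where l: "l \<in> L" "J \<in> \<J>" "\<forall>j\<in>J. \<omega> \<in> E l j" by auto
      from ne[OF l(2)] obtain j where "j \<in> J" by auto
      then have "E l j \<in> events" "\<omega> \<in> E l j" using l meas[of l j] by (auto simp: \<J>_def)
      then have "\<omega> \<in> space M" using sets.sets_into_space by blast
      moreover have "card J \<le> card {j. j < N \<and> \<omega> \<in> E l j}"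
        using l(2,3) by (intro card_mono) (auto simp: \<J>_def)
      then have "N \<le> 2 * card {j. j < N \<and> \<omega> \<in> E l j}"
        using l(2) by (simp add: \<J>_def)
      ultimately show "\<omega> \<in> ?A" using l(1) by blast
    qed
  qed
  have ev: "(\<Inter>j\<in>J. E l j) \<in> events" if "l \<in> L" "J \<in> \<J>" for l J
  proof (rule sets.finite_INT[OF fJ[OF that(2)] ne[OF that(2)]])
    fix j assume "j \<in> J"
    then have "j < N" using that by (auto simp: \<J>_def)
    then show "E l j \<in> events" using meas that by simp
  qed
  show "?A \<in> events" unfolding eq
    by (rule sets.finite_UN) (use ev L f\<J> in \<open>simp_all add: case_prod_beta mem_Times_iff\<close>)
  have "prob (\<Union>(l, J)\<in>L \<times> \<J>. \<Inter>j\<in>J. E l j) \<le> (\<Sum>(l, J)\<in>L \<times> \<J>. prob (\<Inter>j\<in>J. E l j))"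
    unfolding case_prod_beta
      by (rule finite_measure_subadditive_finite) (use ev L f\<J> in \<open>simp_all add: image_subset_iff mem_Times_iff\<close>)
  also have "\<dots> \<le> (\<Sum>x\<in>L \<times> \<J>. q ^ N)"
  proof (rule sum_mono, clarify)
    fix l J assume l: "l \<in> L" "J \<in> \<J>"
    have "prob (\<Inter>j\<in>J. E l j) \<le> (q\<^sup>2) ^ card J" using l ne bound by (auto simp: \<J>_def)
    also have "\<dots> = q ^ (2 * card J)" by (simp add: power_mult)
    also have "\<dots> \<le> q ^ N" using l q by (intro power_decreasing) (auto simp: \<J>_def)
    finally show "prob (\<Inter>j\<in>J. E l j) \<le> q ^ N" .
  qed
  also have "\<dots> = card L * (card \<J> * q ^ N)" by (simp add: card_cartesian_product)
  also have "\<dots> \<le> card L * (2 ^ N * q ^ N)"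
  proof -
    have "real (card \<J>) \<le> real (2 ^ N)" using card\<J> by (rule of_nat_mono)
    then show ?thesis using q by (intro mult_left_mono mult_right_mono) auto
  qed
  also have "\<dots> = card L * (2 * q) ^ N" by (simp only: power_mult_distrib)
  finally show "prob ?A \<le> card L * (2 * q) ^ N" unfolding eq .
qed

section \<open>Independence of functions that read disjoint sets of coordinates\<close>

lemma indep_vars_disjoint_support:
  fixes M :: "'i \<Rightarrow> 'a measure" and K :: "'j \<Rightarrow> 'i set"
  assumes prob: "\<And>i. prob_space (M i)"
    and meas: "\<And>j. j \<in> J \<Longrightarrow> f j \<in> measurable (PiM UNIV M) (N j)"
    and dep: "\<And>j \<omega> \<omega>'. j \<in> J \<Longrightarrow> (\<And>i. i \<in> K j \<Longrightarrow> \<omega> i = \<omega>' i) \<Longrightarrow> f j \<omega> = f j \<omega>'"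
    and disj: "disjoint_family_on K J"
  shows "prob_space.indep_vars (PiM UNIV M) N f J"
proof -
  interpret P: prob_space "PiM UNIV M" by (intro prob_space_PiM prob)
  have comp: "distr (PiM UNIV M) (M i) (\<lambda>\<omega>. \<omega> i) = M i" for i
    by (rule distr_PiM_component) (auto intro: prob)
  have "P.indep_vars M (\<lambda>i \<omega>. \<omega> i) UNIV"
    by (subst P.indep_vars_iff_distr_eq_PiM') (auto simp: comp restrict_UNIV distr_id)
  then have ind: "P.indep_vars (\<lambda>j. PiM (K j) M) (\<lambda>j \<omega>. restrict (\<lambda>i. \<omega> i) (K j)) J"
    using P.indep_vars_restrict[OF _ _ disj, of M "\<lambda>i \<omega>. \<omega> i" UNIV] by simp
  define d where "d i = (SOME x. x \<in> space (M i))" for i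
  have d: "d i \<in> space (M i)" for i
    unfolding d_def using prob_space.not_empty[OF prob] by (rule some_in_eq[THEN iffD2])
  \<comment> \<open>Coordinates outside \<open>K j\<close> are filled with a fixed point of the
    factor. By \<open>dep\<close> this leaves \<open>f j\<close> unchanged, which exhibits
    \<open>f j\<close> as a measurable function of the restriction to \<open>K j\<close>;
    restrictions to disjoint index sets are independent.\<close>
  define extend where "extend j \<tau> i = (if i \<in> K j then \<tau> i else d i)" for j and \<tau> :: "'i \<Rightarrow> 'a" and i
  have extend: "extend j \<in> measurable (PiM (K j) M) (PiM UNIV M)" for j
  proof (rule measurable_PiM_single')
    fix i show "(\<lambda>\<tau>. extend j \<tau> i) \<in> measurable (PiM (K j) M) (M i)"
      by (cases "i \<in> K j") (auto simp: extend_def d)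
  qed (auto simp: extend_def d space_PiM PiE_def extensional_def Pi_iff)
  have "P.indep_vars N (\<lambda>j \<omega>. f j (extend j (restrict (\<lambda>i. \<omega> i) (K j)))) J"
    by (rule P.indep_vars_compose2[OF ind]) (rule measurable_compose[OF extend meas])
  moreover have "(\<lambda>\<omega>. f j (extend j (restrict (\<lambda>i. \<omega> i) (K j)))) = f j" if "j \<in> J" for j
    by (rule ext, rule dep[OF that]) (simp add: extend_def)
  then have "P.indep_vars N (\<lambda>j \<omega>. f j (extend j (restrict (\<lambda>i. \<omega> i) (K j)))) J \<longleftrightarrow> P.indep_vars N f J"
    by (intro P.indep_vars_cong refl)
  ultimately show ?thesis by blast
qed

lemma prob_INT_disjoint_support:
  fixes M :: "'i \<Rightarrow> 'a measure" and K :: "'j \<Rightarrow> 'i set"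
  assumes prob: "\<And>i. prob_space (M i)"
    and J: "finite J" "J \<noteq> {}"
    and ev: "\<And>j. j \<in> J \<Longrightarrow> E j \<in> sets (PiM UNIV M)"
    and dep: "\<And>j \<omega> \<omega>'. j \<in> J \<Longrightarrow> (\<And>i. i \<in> K j \<Longrightarrow> \<omega> i = \<omega>' i) \<Longrightarrow> \<omega> \<in> E j \<longleftrightarrow> \<omega>' \<in> E j"
    and disj: "disjoint_family_on K J"
  shows "measure (PiM UNIV M) (\<Inter>j\<in>J. E j) = (\<Prod>j\<in>J. measure (PiM UNIV M) (E j))"
proof -
  interpret P: prob_space "PiM UNIV M" by (intro prob_space_PiM prob)
  have "P.indep_vars (\<lambda>_. count_space UNIV) (\<lambda>j \<omega>. \<omega> \<in> E j) J"
  proof (rule indep_vars_disjoint_support[OF prob _ _ disj])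
    fix j assume "j \<in> J"
    then show "(\<lambda>\<omega>. \<omega> \<in> E j) \<in> PiM UNIV M \<rightarrow>\<^sub>M count_space UNIV" using ev by simp
  qed (rule dep)
  from P.indep_varsD_finite[OF this J(2,1), of "\<lambda>_. {True}"]
  have "measure (PiM UNIV M) (\<Inter>j\<in>J. (\<lambda>\<omega>. \<omega> \<in> E j) -` {True} \<inter> space (PiM UNIV M)) =
    (\<Prod>j\<in>J. measure (PiM UNIV M) ((\<lambda>\<omega>. \<omega> \<in> E j) -` {True} \<inter> space (PiM UNIV M)))" by simp
  moreover have "(\<lambda>\<omega>. \<omega> \<in> E j) -` {True} \<inter> space (PiM UNIV M) = E j" if "j \<in> J" for j
    using sets.sets_into_space[OF ev[OF that]] by auto
  ultimately show ?thesis by simp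
qed

section \<open>Existence and uniqueness of the evolution\<close>

lemma finite_nbrs: "finite {y. lattice_adj y (x :: int ^ 'd::finite)}"
  by (rule finite_subset[OF _ finite_l1_ball[of x 1]]) (auto simp: lattice_adj_iff)

text \<open>
  What happens at \<open>x\<close> up to time \<open>t\<close> is determined by what happens within distance 2 up to time
  \<open>t - min_clock \<omega> x\<close>.  Distance 1 is not enough: whether an attempt of \<open>y\<close> at time \<open>t\<close> takes
  place depends on \<open>T2 y\<close> up to the same time \<open>t\<close>, which has to be traced back once more.
\<close>

definition near_clocks :: "int ^ 'd::finite \<Rightarrow> (int ^ 'd) clock set" where
  "near_clocks x = (\<Union>z\<in>{z. l1 (z - x) \<le> 1}. insert (Conversion z)
     (\<Union>y\<in>{y. lattice_adj y z}. {Spread1 y z, Spread2 y z}))"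

definition min_clock :: "((int ^ 'd::finite) clock \<Rightarrow> real) \<Rightarrow> int ^ 'd \<Rightarrow> real" where
  "min_clock \<omega> x = Min (\<omega> ` near_clocks x)"

lemma finite_near_clocks: "finite (near_clocks x)"
  unfolding near_clocks_def using finite_l1_ball[of x 1] by (auto intro: finite_nbrs)

lemma min_clock_le: "c \<in> near_clocks x \<Longrightarrow> min_clock \<omega> x \<le> \<omega> c"
  unfolding min_clock_def using finite_near_clocks by (intro Min_le) auto

lemma min_clock_attained: "\<exists>c\<in>near_clocks x. min_clock \<omega> x = \<omega> c"
proof -
  have "Conversion x \<in> near_clocks x" by (auto simp: near_clocks_def intro!: exI[of _ x])
  then have "Min (\<omega> ` near_clocks x) \<in> \<omega> ` near_clocks x"
    using finite_near_clocks by (intro Min_in) auto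
  then show ?thesis unfolding min_clock_def by auto
qed

definition locally_finite_clocks :: "((int ^ 'd::finite) clock \<Rightarrow> real) \<Rightarrow> bool" where
  "locally_finite_clocks \<omega> \<longleftrightarrow> (\<forall>c. 0 < \<omega> c) \<and>
     (\<forall>v t. (\<forall>i. l1 (v (Suc i) - v i) \<le> 2) \<longrightarrow> (\<exists>n. t < (\<Sum>i<n. min_clock \<omega> (v i))))"

text \<open>A failing instance has a failing predecessor at a nearby site with less time left, so
  dependent choice yields an infinite trace of failures. The sum of \<open>min_clock\<close> along
  it exceeds \<open>t\<close>, so the time left drops below 0, against \<open>base\<close>. The
  induction runs over real time, where decrease alone would not force termination.\<close>

lemma locally_finite_induct:
  assumes lf: "locally_finite_clocks \<omega>"
    and base: "\<And>x t. t \<le> 0 \<Longrightarrow> P x t"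
    and step: "\<And>x t. (\<And>y. l1 (y - x) \<le> 2 \<Longrightarrow> P y (t - min_clock \<omega> x)) \<Longrightarrow> P x t"
  shows "P x t"
proof (rule ccontr)
  assume "\<not> P x t"
  define Q where "Q i z \<longleftrightarrow> (\<not> P (fst z) (snd z)) \<and> (i = (0::nat) \<longrightarrow> z = (x, t))" for i z
  define R where "R i z z' \<longleftrightarrow> l1 (fst z' - fst z) \<le> 2 \<and> snd z' = snd z - min_clock \<omega> (fst z)" for i :: nat and z z'
  have "\<exists>f. \<forall>i. Q i (f i) \<and> R i (f i) (f (Suc i))"
  proof (rule dependent_nat_choice)
    show "\<exists>z. Q 0 z" using \<open>\<not> P x t\<close> by (auto simp: Q_def)
    fix z i assume "Q i z"
    then obtain y where "l1 (y - fst z) \<le> 2" "\<not> P y (snd z - min_clock \<omega> (fst z))"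
      using step[of "fst z" "snd z"] by (auto simp: Q_def)
    then show "\<exists>z'. Q (Suc i) z' \<and> R i z z'"
      by (intro exI[of _ "(y, snd z - min_clock \<omega> (fst z))"]) (auto simp: Q_def R_def)
  qed
  then obtain f where f: "\<And>i. Q i (f i)" "\<And>i. R i (f i) (f (Suc i))" by blast
  have t: "snd (f n) = t - (\<Sum>i<n. min_clock \<omega> (fst (f i)))" for n
  proof (induction n)
    case 0 then show ?case using f(1)[of 0] by (simp add: Q_def)
  next
    case (Suc n) then show ?case using f(2)[of n] by (simp add: R_def)
  qed
  have "\<forall>i. l1 (fst (f (Suc i)) - fst (f i)) \<le> 2" using f(2) by (simp add: R_def)
  then obtain n where "t < (\<Sum>i<n. min_clock \<omega> (fst (f i)))"
    using lf[unfolded locally_finite_clocks_def, THEN conjunct2, rule_format, of "\<lambda>i. fst (f i)" t] by auto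
  then have "snd (f n) \<le> 0" using t by simp
  then show False using base[of "snd (f n)" "fst (f n)"] f(1)[of n] by (auto simp: Q_def)
qed

text \<open>The type 1 times are computed from the already updated type 2 times \<open>N2\<close>.
  Whether an attempt at time \<open>t\<close> takes place depends on the type 2 times up to
  \<open>t\<close> itself; with the old ones, known only up to
  \<open>t - min_clock \<omega> x\<close>, the comparison would not be settled. The fixed points are
  the evolutions all the same.\<close>

definition one_step :: "((int ^ 'd::finite) clock \<Rightarrow> real) \<Rightarrow> (int ^ 'd \<Rightarrow> ennreal) \<times> (int ^ 'd \<Rightarrow> ennreal)
    \<Rightarrow> (int ^ 'd \<Rightarrow> ennreal) \<times> (int ^ 'd \<Rightarrow> ennreal)" where
  "one_step \<omega> T = (let N2 = (\<lambda>x. min (first_attempt2 lattice_adj \<omega> (snd T) x) (fst T x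
    + ennreal (\<omega> (Conversion x)))) in
     (\<lambda>x. if first_attempt1 lattice_adj 0 \<omega> (fst T) N2 x < first_attempt2 lattice_adj \<omega> (snd T) x
          then first_attempt1 lattice_adj 0 \<omega> (fst T) N2 x else \<infinity>, N2))"

lemma is_evolution_iff_one_step:
  "is_evolution lattice_adj 0 \<omega> (fst T) (snd T) \<longleftrightarrow> one_step \<omega> T = T"
proof
  assume e: "is_evolution lattice_adj 0 \<omega> (fst T) (snd T)"
  then have "snd T = (\<lambda>x. min (first_attempt2 lattice_adj \<omega> (snd T) x) (fst T x + ennreal (\<omega> (Conversion x))))"
    unfolding is_evolution_def by blast
  then have 2: "(\<lambda>x. min (first_attempt2 lattice_adj \<omega> (snd T) x) (fst T x + ennreal (\<omega> (Conversion x)))) = snd T"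
    by simp
  have "fst (one_step \<omega> T) = fst T"
    unfolding one_step_def Let_def 2 using e unfolding is_evolution_def by (intro ext) simp
  moreover have "snd (one_step \<omega> T) = snd T"
    unfolding one_step_def Let_def using 2 by simp
  ultimately show "one_step \<omega> T = T" by (simp add: prod_eq_iff)
next
  assume "one_step \<omega> T = T"
  then have e: "fst (one_step \<omega> T) = fst T" "snd (one_step \<omega> T) = snd T" by (simp_all only:)
  from e(2) have 2: "(\<lambda>x. min (first_attempt2 lattice_adj \<omega> (snd T) x) (fst T x + ennreal (\<omega> (Conversion x))))
    = snd T"
    unfolding one_step_def Let_def snd_conv .
  from e(1) have 1: "(\<lambda>x. if first_attempt1 lattice_adj 0 \<omega> (fst T) (snd T) x < first_attempt2 lattice_adj \<omega> (snd T) x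
          then first_attempt1 lattice_adj 0 \<omega> (fst T) (snd T) x else \<infinity>) = fst T"
    unfolding one_step_def Let_def 2 fst_conv .
  show "is_evolution lattice_adj 0 \<omega> (fst T) (snd T)"
    unfolding is_evolution_def using fun_cong[OF 1, symmetric] fun_cong[OF 2, symmetric] by blast
qed

section \<open>Equality of arrival times up to time \<open>t\<close>\<close>

definition agree :: "ennreal \<Rightarrow> ennreal \<Rightarrow> real \<Rightarrow> bool" where
  "agree a b t \<longleftrightarrow> min a (ennreal t) = min b (ennreal t)"

lemma agree_iff: "agree a b t \<longleftrightarrow> a = b \<or> (ennreal t \<le> a \<and> ennreal t \<le> b)"
  unfolding agree_def min_def by (auto split: if_splits)

lemma agree_trans: "agree a b t \<Longrightarrow> agree b c t \<Longrightarrow> agree a c t"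
  by (simp add: agree_def)

lemma agree_sym: "agree a b t \<Longrightarrow> agree b a t"
  by (simp add: agree_def)

lemma agree_all: "(\<And>t. agree a b t) \<Longrightarrow> a = b"
proof -
  assume *: "\<And>t. agree a b t"
  have "a = \<infinity> \<or> (\<exists>r\<ge>0. a = ennreal r)" "b = \<infinity> \<or> (\<exists>r\<ge>0. b = ennreal r)"
    by (metis ennreal_cases infinity_ennreal_def)+
  then show "a = b"
  proof (elim disjE exE conjE)
    fix r assume r: "a = \<infinity>" "0 \<le> r" "b = ennreal r"
    have "\<not> ennreal (r + 1) \<le> b" using r by (simp add: ennreal_le_iff)
    then show "a = b" using *[of "r + 1"] unfolding agree_iff by blast
  next
    fix r assume r: "b = \<infinity>" "0 \<le> r" "a = ennreal r"
    have "\<not> ennreal (r + 1) \<le> a" using r by (simp add: ennreal_le_iff)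
    then show "a = b" using *[of "r + 1"] unfolding agree_iff by blast
  next
    fix r s assume r: "0 \<le> r" "a = ennreal r" "0 \<le> s" "b = ennreal s"
    have "\<not> ennreal (r + 1) \<le> a" using r by (simp add: ennreal_le_iff)
    then show "a = b" using *[of "r + 1"] unfolding agree_iff by blast
  qed simp
qed

text \<open>The only operation that gains time: a clock of length at least \<open>m\<close> extends
  agreement from \<open>t - m\<close> to \<open>t\<close>. The others merely preserve it.\<close>

lemma agree_add: assumes "agree a b (t - m)" "m \<le> s" "0 \<le> m" shows "agree (a + ennreal s) (b + ennreal s) t"
proof (cases "a = b")
  case False
  then have *: "ennreal (t - m) \<le> a" "ennreal (t - m) \<le> b" using assms by (auto simp: agree_iff)
  \<comment> \<open>\<open>ennreal\<close> maps negative reals to 0, hence the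
    \<open>max 0\<close>.\<close>
  have "ennreal t \<le> ennreal (max 0 (t - m) + s)" using assms by (intro ennreal_leI) auto
  also have "\<dots> = ennreal (t - m) + ennreal s"
    using assms by (cases "t - m \<ge> 0") (simp_all add: ennreal_plus ennreal_neg)
  finally have "ennreal t \<le> ennreal (t - m) + ennreal s" .
  then show ?thesis unfolding agree_iff using * by (meson add_right_mono order_trans)
qed (simp add: agree_def)

lemma agree_min: "agree a b t \<Longrightarrow> agree a' b' t \<Longrightarrow> agree (min a a') (min b b') t"
  unfolding agree_def by (metis min.assoc min.commute)

lemma agree_INF: assumes "\<And>y. y \<in> A \<Longrightarrow> agree (f y) (g y) t" shows "agree (INF y\<in>A. f y) (INF y\<in>A. g y) t"
proof (cases "A = {}")
  case False
  have "min (INF y\<in>A. h y) (ennreal t) = (INF y\<in>A. min (h y) (ennreal t))" for h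
    using INF_inf_const2[OF False, of h "ennreal t"] by (simp add: inf_min)
  then show ?thesis unfolding agree_def using assms by (simp add: agree_def cong: INF_cong)
qed (simp add: agree_def)

text \<open>If \<open>a\<close> lies below \<open>t\<close>, agreement up to \<open>t\<close> is
  enough to decide \<open>a < b\<close>; otherwise both outcomes are at least
  \<open>t\<close>.\<close>

lemma agree_if_less: assumes "agree a a' t" "agree b b' t"
  shows "agree (if a < b then a else \<infinity>) (if a' < b' then a' else \<infinity>) t"
proof -
  consider "a = a'" "b = b'" | "a = a'" "a < ennreal t" "ennreal t \<le> b" "ennreal t \<le> b'"
    | "ennreal t \<le> a" "ennreal t \<le> a'"
    using assms unfolding agree_iff by (metis not_le)
  then show ?thesis
  proof cases
    case 3
    then show ?thesis unfolding agree_iff by simp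
  qed (auto simp: agree_iff)
qed

text \<open>The index set of the infimum depends on the evolution, which rules out a termwise
  comparison. Moving the condition into the term, with the neutral value \<infinity>, leaves a fixed
  index set to which \<open>agree_INF\<close> applies.\<close>

lemma first_attempt1_alt: "first_attempt1 adj p \<omega> T1 T2 x = (if x = p then 0 else
   (INF y\<in>{y. adj y x}. if T1 y + ennreal (\<omega> (Spread1 y x)) < T2 y then T1 y + ennreal (\<omega> (Spread1 y x)) else \<infinity>))"
proof -
  have "(INF y\<in>{y. adj y x \<and> T1 y + ennreal (\<omega> (Spread1 y x)) < T2 y}. T1 y + ennreal (\<omega> (Spread1 y x)))
    = (INF y\<in>{y. adj y x}. if T1 y + ennreal (\<omega> (Spread1 y x)) < T2 y then T1 y + ennreal (\<omega> (Spread1 y x)) else \<infinity>)"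
    (is "?a = ?b")
  proof (rule antisym)
    show "?a \<le> ?b" by (intro INF_greatest) (auto intro: INF_lower)
    show "?b \<le> ?a"
    proof (rule INF_greatest)
      fix y assume "y \<in> {y. adj y x \<and> T1 y + ennreal (\<omega> (Spread1 y x)) < T2 y}"
      then show "?b \<le> T1 y + ennreal (\<omega> (Spread1 y x))" by (intro INF_lower2[of y]) simp_all
    qed
  qed
  then show ?thesis unfolding first_attempt1_def by simp
qed

text \<open>The updated type 2 times are known up to \<open>t\<close> on the unit ball around
  \<open>x\<close>, from data at distance at most 2; the type 1 attempts at \<open>x\<close> are
  compared with exactly these. This accounts for the radius 2 and for \<open>near_clocks\<close>
  containing more than the clocks that end at \<open>x\<close>.\<close>

lemma one_step_agree:
  assumes pos: "\<And>c. 0 < \<omega> c"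
    and ag: "\<And>y. l1 (y - x) \<le> 2 \<Longrightarrow> agree (fst T y) (fst U y) (t - min_clock \<omega> x)
      \<and> agree (snd T y) (snd U y) (t - min_clock \<omega> x)"
  shows "agree (fst (one_step \<omega> T) x) (fst (one_step \<omega> U) x) t
    \<and> agree (snd (one_step \<omega> T) x) (snd (one_step \<omega> U) x) t"
proof -
  have m: "0 \<le> min_clock \<omega> x" using min_clock_attained[of x \<omega>] pos by (metis less_imp_le)
  have near: "l1 (y - x) \<le> 2" if "lattice_adj y z" "l1 (z - x) \<le> 1" for y z
    using l1_triangle[of y x z] that by (simp add: lattice_adj_iff)
  have c1: "min_clock \<omega> x \<le> \<omega> (Spread1 y z)" "min_clock \<omega> x \<le> \<omega> (Spread2 y z)" if "lattice_adj y z" "l1 (z - x)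
    \<le> 1" for y z
    using that by (intro min_clock_le; auto simp: near_clocks_def)+
  have c2: "min_clock \<omega> x \<le> \<omega> (Conversion z)" if "l1 (z - x) \<le> 1" for z
    using that by (intro min_clock_le) (auto simp: near_clocks_def)
  let ?N = "\<lambda>T x. min (first_attempt2 lattice_adj \<omega> (snd T) x) (fst T x + ennreal (\<omega> (Conversion x)))"
  have f2: "agree (first_attempt2 lattice_adj \<omega> (snd T) z) (first_attempt2 lattice_adj \<omega> (snd U) z) t"
    if "l1 (z - x) \<le> 1" for z
    unfolding first_attempt2_def
  proof (rule agree_INF)
    fix y assume "y \<in> {y. lattice_adj y z}"
    then show "agree (snd T y + ennreal (\<omega> (Spread2 y z))) (snd U y + ennreal (\<omega> (Spread2 y z))) t"
      using ag near c1 m that by (intro agree_add[of _ _ _ "min_clock \<omega> x"]) auto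
  qed
  have N2: "agree (?N T z) (?N U z) t" if "l1 (z - x) \<le> 1" for z
    using that ag c2 m f2 by (intro agree_min agree_add[of _ _ _ "min_clock \<omega> x"]) auto
  have f1: "agree (first_attempt1 lattice_adj 0 \<omega> (fst T) (?N T) x) (first_attempt1 lattice_adj 0 \<omega> (fst U) (?N U) x) t"
  proof (cases "x = 0")
    case False
    have "agree (INF y\<in>{y. lattice_adj y x}. if fst T y + ennreal (\<omega> (Spread1 y x)) < ?N T y then fst T y
      + ennreal (\<omega> (Spread1 y x)) else \<infinity>)
       (INF y\<in>{y. lattice_adj y x}. if fst U y + ennreal (\<omega> (Spread1 y x)) < ?N U y then fst U y
         + ennreal (\<omega> (Spread1 y x)) else \<infinity>) t"
    proof (intro agree_INF agree_if_less N2)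
      fix y assume y: "y \<in> {y. lattice_adj y x}"
      then show "l1 (y - x) \<le> 1" by (simp add: lattice_adj_iff)
      show "agree (fst T y + ennreal (\<omega> (Spread1 y x))) (fst U y + ennreal (\<omega> (Spread1 y x))) t"
        using y ag near c1[of y x] m by (intro agree_add[of _ _ _ "min_clock \<omega> x"]) auto
    qed
    then show ?thesis using False unfolding first_attempt1_alt by simp
  qed (simp add: first_attempt1_def agree_def)
  show ?thesis
    unfolding one_step_def Let_def fst_conv snd_conv
    using N2[of x] agree_if_less[OF f1 f2[of x]] by simp
qed

text \<open>Either some settled value lies below its horizon, and then the sequence is eventually
  constant, or every settled value lies beyond its horizon and the limit is \<infinity>.\<close>

lemma agree_limit:
  assumes "\<And>t. \<exists>n. \<forall>m\<ge>n. agree (a m) (a n) t"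
  shows "\<exists>L. \<forall>t. \<exists>n. \<forall>m\<ge>n. agree (a m) L t"
proof (cases "\<exists>t n. (\<forall>m\<ge>n. agree (a m) (a n) t) \<and> a n < ennreal t")
  case True
  then obtain t n where "\<forall>m\<ge>n. agree (a m) (a n) t" "a n < ennreal t" by blast
  then have *: "a m = a n" if "m \<ge> n" for m using that unfolding agree_iff by (meson leD)
  have "agree (a m) (a n) t" if "m \<ge> n" for m t unfolding agree_def *[OF that] ..
  then have "\<forall>t. \<forall>m\<ge>n. agree (a m) (a n) t" by iprover
  then have *: "\<forall>t. \<exists>n'. \<forall>m\<ge>n'. agree (a m) (a n) t" by iprover
  show ?thesis by (rule exI[where x = "a n"]) (rule *)
next
  case False
  have "\<exists>n. \<forall>m\<ge>n. agree (a m) \<infinity> t" for t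
  proof -
    from assms[of t] obtain n where n: "\<forall>m\<ge>n. agree (a m) (a n) t" ..
    have a: "ennreal t \<le> a n"
    proof (rule ccontr)
      assume "\<not> ?thesis"
      with n have "(\<forall>m\<ge>n. agree (a m) (a n) t) \<and> a n < ennreal t" by simp
      with False show False by iprover
    qed
    have "agree (a n) \<infinity> t" unfolding agree_iff using a by simp
    then have "\<forall>m\<ge>n. agree (a m) \<infinity> t" using n by (metis agree_trans)
    then show ?thesis ..
  qed
  then have *: "\<forall>t. \<exists>n. \<forall>m\<ge>n. agree (a m) \<infinity> t" ..
  show ?thesis by (rule exI[where x = \<infinity>]) (rule *)
qed

text \<open>A contraction argument without a uniform rate: at each site and up to each time the
  iterates of \<open>one_step\<close> settle after finitely many rounds, and the limit is a fixed
  point. By the same induction in time two fixed points agree up to every time, so the definite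
  description in \<open>evolution\<close> is justified.\<close>

lemma evolution_exists:
  assumes lf: "locally_finite_clocks \<omega>"
  shows "is_evolution lattice_adj 0 \<omega> (fst (evolution lattice_adj 0 \<omega>)) (snd (evolution lattice_adj 0 \<omega>))"
proof -
  have pos: "\<And>c. 0 < \<omega> c" using lf unfolding locally_finite_clocks_def by blast
  have zero: "agree a b t" if "t \<le> 0" for a b t using that by (simp add: agree_iff ennreal_neg)
  \<comment> \<open>The starting point is arbitrary: \<open>one_step\<close> is not monotone, and
    convergence comes from the induction in time.\<close>
  define s where "s n = (one_step \<omega> ^^ n) (\<lambda>_. 0, \<lambda>_. 0)" for n
  have s_Suc: "s (Suc n) = one_step \<omega> (s n)" for n by (simp add: s_def)
  define P where "P x t \<longleftrightarrow> (\<exists>n. \<forall>m\<ge>n. agree (fst (s m) x) (fst (s n) x) t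
    \<and> agree (snd (s m) x) (snd (s n) x) t)" for x t
  have P: "P x t" for x t
  proof (rule locally_finite_induct[OF lf])
    fix x and t :: real assume "t \<le> 0" then show "P x t" unfolding P_def using zero by blast
  next
    fix x t assume IH: "\<And>y. l1 (y - x) \<le> 2 \<Longrightarrow> P y (t - min_clock \<omega> x)"
    then have "\<forall>y\<in>{y. l1 (y - x) \<le> 2}. \<exists>n. \<forall>m\<ge>n. agree (fst (s m) y) (fst (s n) y) (t - min_clock \<omega> x)
      \<and> agree (snd (s m) y) (snd (s n) y) (t - min_clock \<omega> x)"
      by (simp add: P_def)
    from bchoice[OF this] obtain n where n: "\<And>y m. l1 (y - x) \<le> 2 \<Longrightarrow> n y \<le> m \<Longrightarrow>
      agree (fst (s m) y) (fst (s (n y)) y) (t - min_clock \<omega> x)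
        \<and> agree (snd (s m) y) (snd (s (n y)) y) (t - min_clock \<omega> x)"
      by auto
    define k where "k = Max (n ` {y. l1 (y - x) \<le> 2})"
    have k: "n y \<le> k" if "l1 (y - x) \<le> 2" for y
      unfolding k_def using that finite_l1_ball[of x 2] by (intro Max_ge) auto
    show "P x t" unfolding P_def
    proof (intro exI[of _ "Suc k"] allI impI)
      fix m assume "Suc k \<le> m"
      then obtain m' where m': "m = Suc m'" "k \<le> m'" by (cases m) auto
      show "agree (fst (s m) x) (fst (s (Suc k)) x) t \<and> agree (snd (s m) x) (snd (s (Suc k)) x) t"
        unfolding m' s_Suc
      proof (rule one_step_agree[OF pos])
        fix y assume y: "l1 (y - x) \<le> 2"
        show "agree (fst (s m') y) (fst (s k) y) (t - min_clock \<omega> x)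
          \<and> agree (snd (s m') y) (snd (s k) y) (t - min_clock \<omega> x)"
          using n[OF y, of m'] n[OF y, of k] k[OF y] m' by (auto intro: agree_trans agree_sym)
      qed
    qed
  qed
  have "\<exists>L. \<forall>t. \<exists>n. \<forall>m\<ge>n. agree (fst (s m) x) L t" for x
    by (rule agree_limit) (use P[of x] in \<open>unfold P_def, blast\<close>)
  moreover have "\<exists>L. \<forall>t. \<exists>n. \<forall>m\<ge>n. agree (snd (s m) x) L t" for x
    by (rule agree_limit) (use P[of x] in \<open>unfold P_def, blast\<close>)
  ultimately obtain L1 L2
    where L: "\<And>x t. \<exists>n. \<forall>m\<ge>n. agree (fst (s m) x) (L1 x) t" "\<And>x t. \<exists>n. \<forall>m\<ge>n. agree (snd (s m) x) (L2 x) t"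
    by metis
  have L: "\<exists>n. \<forall>m\<ge>n. agree (fst (s m) x) (L1 x) t \<and> agree (snd (s m) x) (L2 x) t" for x t
    using L(1)[of x t] L(2)[of x t] by (metis le_trans nat_le_linear)
  have fixp: "one_step \<omega> (L1, L2) = (L1, L2)"
  proof -
    have "agree (fst (one_step \<omega> (L1, L2)) x) (L1 x) t \<and> agree (snd (one_step \<omega> (L1, L2)) x) (L2 x) t" for x t
    proof -
      have "\<forall>y. \<exists>n. \<forall>m\<ge>n. agree (fst (s m) y) (L1 y) (t - min_clock \<omega> x)
        \<and> agree (snd (s m) y) (L2 y) (t - min_clock \<omega> x)"
        using L by blast
      then obtain n where n: "\<And>y m. n y \<le> m \<Longrightarrow> agree (fst (s m) y) (L1 y) (t - min_clock \<omega> x)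
        \<and> agree (snd (s m) y) (L2 y) (t - min_clock \<omega> x)"
        by metis
      obtain n' where n': "\<And>m. n' \<le> m \<Longrightarrow> agree (fst (s m) x) (L1 x) t \<and> agree (snd (s m) x) (L2 x) t"
        using L by blast
      define k where "k = Max (insert n' (n ` {y. l1 (y - x) \<le> 2}))"
      have k: "n y \<le> k" if "l1 (y - x) \<le> 2" for y
        unfolding k_def using that finite_l1_ball[of x 2] by (intro Max_ge) auto
      have k': "n' \<le> k" unfolding k_def using finite_l1_ball[of x 2] by (intro Max_ge) auto
      have "agree (fst (one_step \<omega> (L1, L2)) x) (fst (one_step \<omega> (s k)) x) t
        \<and> agree (snd (one_step \<omega> (L1, L2)) x) (snd (one_step \<omega> (s k)) x) t"
      proof (rule one_step_agree[OF pos])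
        fix y assume "l1 (y - x) \<le> 2"
        then show "agree (fst (L1, L2) y) (fst (s k) y) (t - min_clock \<omega> x)
          \<and> agree (snd (L1, L2) y) (snd (s k) y) (t - min_clock \<omega> x)"
          using n[OF k] agree_sym by simp
      qed
      moreover have "agree (fst (s (Suc k)) x) (L1 x) t \<and> agree (snd (s (Suc k)) x) (L2 x) t"
        using n'[of "Suc k"] k' by simp
      ultimately show ?thesis unfolding s_Suc by (blast intro: agree_trans)
    qed
    then show ?thesis by (intro prod_eqI ext; auto intro: agree_all)
  qed
  have uniq: "T = U" if "one_step \<omega> T = T" "one_step \<omega> U = U" for T U
  proof -
    have "agree (fst T x) (fst U x) t \<and> agree (snd T x) (snd U x) t" for x t
    proof (rule locally_finite_induct[OF lf])
      fix x and t :: real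
      assume "\<And>y. l1 (y - x) \<le> 2 \<Longrightarrow> agree (fst T y) (fst U y) (t - min_clock \<omega> x)
        \<and> agree (snd T y) (snd U y) (t - min_clock \<omega> x)"
      from one_step_agree[of \<omega>, OF pos this]
      show "agree (fst T x) (fst U x) t \<and> agree (snd T x) (snd U x) t" by (simp add: that)
    qed (simp add: zero)
    then show ?thesis by (intro prod_eqI ext; auto intro: agree_all)
  qed
  have "\<exists>!T. is_evolution lattice_adj 0 \<omega> (fst T) (snd T)"
    unfolding is_evolution_iff_one_step using fixp uniq by blast
  then show ?thesis unfolding evolution_def by (rule theI')
qed

section \<open>The clocks as a probability space\<close>

instance clock :: (countable) countable
  by countable_datatype

primrec clock_target :: "'v clock \<Rightarrow> 'v" where
  "clock_target (Spread1 y x) = x" | "clock_target (Spread2 y x) = x" | "clock_target (Conversion x) = x"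

lemma card_l1_ball: "card {v :: int ^ 'd::finite. l1 (v - u) \<le> r} = card {v :: int ^ 'd. l1 v \<le> r}"
proof (rule bij_betw_same_card)
  show "bij_betw (\<lambda>v. v - u) {v. l1 (v - u) \<le> r} {v. l1 v \<le> r}"
    by (rule bij_betwI[of _ _ _ "\<lambda>v. v + u"]) auto
qed

text \<open>By the triangle inequality, sites at distance at least 3 have disjoint sets of near
  clocks.\<close>

lemma near_clocks_target: "c \<in> near_clocks x \<Longrightarrow> l1 (clock_target c - x) \<le> 1"
  unfolding near_clocks_def by auto

lemma card_near_clocks_le:
  fixes x :: "int ^ 'd::finite"
  defines "b \<equiv> card {v :: int ^ 'd. l1 v \<le> 1}"
  shows "card (near_clocks x) \<le> b * (1 + b * 2)"
proof -
  have nb: "card (insert (Conversion z) (\<Union>y\<in>{y. lattice_adj y z}. {Spread1 y z, Spread2 y z}))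
    \<le> 1 + b * 2" for z :: "int ^ 'd"
  proof -
    have "card (\<Union>y\<in>{y. lattice_adj y z}. {Spread1 y z, Spread2 y z})
      \<le> (\<Sum>y\<in>{y. lattice_adj y z}. card {Spread1 y z, Spread2 y z})"
      by (rule card_UN_le[OF finite_nbrs])
    also have "\<dots> \<le> (\<Sum>y\<in>{y. lattice_adj y z}. 2)" by (intro sum_mono) simp
    also have "\<dots> \<le> card {y. l1 (y - z) \<le> 1} * 2"
      using finite_l1_ball[of z 1] by (auto intro!: card_mono simp: lattice_adj_iff)
    finally have "card (\<Union>y\<in>{y. lattice_adj y z}. {Spread1 y z, Spread2 y z}) \<le> b * 2"
      by (simp add: card_l1_ball b_def)
    then show ?thesis
      using card_insert_le_m1[of "Suc (b * 2)" "\<Union>y\<in>{y. lattice_adj y z}. {Spread1 y z, Spread2 y z}" "Conversion z"] by simp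
  qed
  have "card (near_clocks x) \<le> (\<Sum>z\<in>{z. l1 (z - x)
    \<le> 1}. card (insert (Conversion z) (\<Union>y\<in>{y. lattice_adj y z}. {Spread1 y z, Spread2 y z})))"
    unfolding near_clocks_def by (rule card_UN_le[OF finite_l1_ball])
  also have "\<dots> \<le> (\<Sum>z\<in>{z. l1 (z - x) \<le> 1}. 1 + b * 2)" by (intro sum_mono nb)
  also have "\<dots> = b * (1 + b * 2)" by (simp add: card_l1_ball b_def)
  finally show ?thesis .
qed

lemma measurable_pred_real_le [measurable (raw)]:
  fixes f g :: "'a \<Rightarrow> real"
  shows "f \<in> borel_measurable M \<Longrightarrow> g \<in> borel_measurable M \<Longrightarrow> Measurable.pred M (\<lambda>x. f x \<le> g x)"
  unfolding pred_def by (rule borel_measurable_le)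

locale clocks =
  fixes lam rho :: real and M :: "((int ^ 'd::finite) clock \<Rightarrow> real) measure"
  assumes lam: "0 < lam" and rho: "0 < rho" and M_eq: "M = clock_space lam rho"
begin

abbreviation clock_law :: "(int ^ 'd) clock \<Rightarrow> real measure" where
  "clock_law c \<equiv> density lborel (exponential_density (clock_rate lam rho c))"

lemma rate_pos: "0 < clock_rate lam rho c"
  using lam rho by (cases c) auto

lemma prob_space_law: "prob_space (clock_law c)"
  by (rule prob_space_exponential_density[OF rate_pos])

lemma M_PiM: "M = PiM UNIV clock_law"
  unfolding M_eq clock_space_def ..

sublocale prob_space M
  unfolding M_PiM by (intro prob_space_PiM prob_space_law)

lemma space_M [simp]: "space M = UNIV"
  unfolding M_PiM by (simp add: space_PiM PiE_def)

lemma events_Collect: "Measurable.pred M P \<Longrightarrow> {\<omega>. P \<omega>} \<in> events"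
  unfolding pred_def by simp

lemma measurable_clock [measurable]: "(\<lambda>\<omega>. \<omega> c) \<in> borel_measurable M"
proof -
  have "(\<lambda>\<omega>. \<omega> c) \<in> measurable M (clock_law c)" unfolding M_PiM by (rule measurable_component_singleton) simp
  then show ?thesis by simp
qed

lemma distributed_clock: "distributed M lborel (\<lambda>\<omega>. \<omega> c) (exponential_density (clock_rate lam rho c))"
proof -
  have "distr M (clock_law c) (\<lambda>\<omega>. \<omega> c) = clock_law c"
    unfolding M_PiM by (rule distr_PiM_component) (auto intro: prob_space_law)
  moreover have "distr M (clock_law c) (\<lambda>\<omega>. \<omega> c) = distr M lborel (\<lambda>\<omega>. \<omega> c)"
    by (intro distr_cong) auto
  ultimately show ?thesis unfolding distributed_def by auto
qed

lemma prob_clock_le: "0 \<le> a \<Longrightarrow> prob {\<omega>. \<omega> c \<le> a} = 1 - exp (- a * clock_rate lam rho c)"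
  using exponential_distributedD_le[OF distributed_clock _ rate_pos, of a c] by simp

lemma prob_clock_gt: "0 \<le> a \<Longrightarrow> prob {\<omega>. a < \<omega> c} = exp (- a * clock_rate lam rho c)"
  using exponential_distributedD_gt[OF distributed_clock _ rate_pos, of a c] by simp

lemma prob_clock_less_le: assumes "0 \<le> a" shows "prob {\<omega>. \<omega> c < a} \<le> a * clock_rate lam rho c"
proof -
  have "{\<omega>\<in>space M. \<omega> c \<le> a} \<in> events" by measurable
  then have "prob {\<omega>. \<omega> c < a} \<le> prob {\<omega>. \<omega> c \<le> a}" by (intro finite_measure_mono) auto
  also have "\<dots> \<le> a * clock_rate lam rho c"
    unfolding prob_clock_le[OF assms] using exp_ge_add_one_self[of "- a * clock_rate lam rho c"] by simp
  finally show ?thesis .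
qed

lemma AE_clocks_pos: "AE \<omega> in M. \<forall>c. 0 < \<omega> c"
proof -
  have "AE \<omega> in M. 0 < \<omega> c" for c
  proof -
    have "prob {\<omega>. 0 < \<omega> c} = 1" using prob_clock_gt[of 0 c] by simp
    then show ?thesis using AE_prob_1 by force
  qed
  then show ?thesis by (simp add: AE_all_countable)
qed

lemma prob_INT_indep:
  assumes "finite J" "J \<noteq> {}" "\<And>j. j \<in> J \<Longrightarrow> E j \<in> events"
    and "\<And>j \<omega> \<omega>'. j \<in> J \<Longrightarrow> (\<And>i. i \<in> K j \<Longrightarrow> \<omega> i = \<omega>' i) \<Longrightarrow> \<omega> \<in> E j \<longleftrightarrow> \<omega>' \<in> E j"
    and "disjoint_family_on K J"
  shows "prob (\<Inter>j\<in>J. E j) = (\<Prod>j\<in>J. prob (E j))"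
proof -
  have "measure (PiM UNIV clock_law) (\<Inter>j\<in>J. E j) = (\<Prod>j\<in>J. measure (PiM UNIV clock_law) (E j))"
  proof (rule prob_INT_disjoint_support[where K = K])
    fix j assume "j \<in> J" then show "E j \<in> sets (PiM UNIV clock_law)" using assms(3) by (simp only: M_PiM)
  next
    fix j and \<omega> \<omega>' :: "(int ^ 'd) clock \<Rightarrow> real" assume "j \<in> J" "\<And>i. i \<in> K j \<Longrightarrow> \<omega> i = \<omega>' i"
    then show "\<omega> \<in> E j \<longleftrightarrow> \<omega>' \<in> E j" by (rule assms(4))
  qed (fact prob_space_law assms)+
  then show ?thesis by (simp only: M_PiM)
qed

section \<open>Sites with a fast clock do not percolate\<close>

definition fast :: "real \<Rightarrow> int ^ 'd \<Rightarrow> ((int ^ 'd) clock \<Rightarrow> real) set" where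
  "fast \<delta> x = {\<omega>. \<exists>c\<in>near_clocks x. \<omega> c < \<delta>}"

lemma fast_measurable [measurable]: "fast \<delta> x \<in> events"
proof -
  have "fast \<delta> x = (\<Union>c\<in>near_clocks x. {\<omega>\<in>space M. \<omega> c < \<delta>})" by (auto simp: fast_def)
  also have "\<dots> \<in> events" by (intro sets.finite_UN finite_near_clocks) measurable
  finally show ?thesis .
qed

lemma prob_fast_le:
  assumes "0 \<le> \<delta>"
  shows "prob (fast \<delta> x) \<le> card (near_clocks x) * (\<delta> * (1 + lam + rho))"
proof -
  have "fast \<delta> x = (\<Union>c\<in>near_clocks x. {\<omega>\<in>space M. \<omega> c < \<delta>})" by (auto simp: fast_def)
  moreover have "{\<omega>\<in>space M. \<omega> c < \<delta>} \<in> events" for c by measurable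
  then have "prob (\<Union>c\<in>near_clocks x. {\<omega>\<in>space M. \<omega> c < \<delta>}) \<le> (\<Sum>c\<in>near_clocks x. prob {\<omega>\<in>space M. \<omega> c < \<delta>})"
    by (intro finite_measure_subadditive_finite finite_near_clocks) blast
  ultimately have "prob (fast \<delta> x) \<le> (\<Sum>c\<in>near_clocks x. prob {\<omega>\<in>space M. \<omega> c < \<delta>})" by simp
  also have "\<dots> \<le> (\<Sum>c\<in>near_clocks x. \<delta> * (1 + lam + rho))"
  proof (intro sum_mono)
    fix c :: "(int ^ 'd) clock"
    have "prob {\<omega>\<in>space M. \<omega> c < \<delta>} \<le> \<delta> * clock_rate lam rho c" using prob_clock_less_le[OF assms] by simp
    also have "\<dots> \<le> \<delta> * (1 + lam + rho)" using assms lam rho by (intro mult_left_mono) (cases c; simp)+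
    finally show "prob {\<omega>\<in>space M. \<omega> c < \<delta>} \<le> \<delta> * (1 + lam + rho)" .
  qed
  finally show ?thesis by simp
qed

text \<open>A member of \<open>chains c r N\<close> has \<open>N + 1\<close> entries; events are
  attached to the first \<open>N\<close> only, so separation is asked for these.\<close>

definition separated :: "nat \<Rightarrow> nat \<Rightarrow> (int ^ 'd) list \<Rightarrow> bool" where
  "separated b N zs \<longleftrightarrow> (\<forall>i j. i < j \<and> j < N \<longrightarrow> b \<le> l1 (zs ! i - zs ! j))"

text \<open>The numbers belong together: traces have steps of length at most 2, separation 3 makes
  the near clocks of different centres disjoint, and \<open>last_exit_chain\<close> then jumps by at
  most 3 + 2 = 5. There are at most \<open>C ^ N\<close> such chains, and \<delta> is so small that
  the Peierls bound beats this number.\<close>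

lemma AE_no_fast_chain:
  "\<exists>\<delta>>0. AE \<omega> in M. \<forall>x. \<exists>N>0. \<forall>zs\<in>chains x 5 N. separated 3 N zs \<longrightarrow> (\<exists>j<N. \<omega> \<notin> fast \<delta> (zs ! j))"
proof -
  define C where "C = card {v :: int ^ 'd. l1 v \<le> 5}"
  define b where "b = card {v :: int ^ 'd. l1 v \<le> 1}"
  have C: "0 < C" unfolding C_def using finite_l1_ball[of "0 :: int ^ 'd" 5]
    by (auto simp: card_gt_0_iff intro: exI[of _ 0])
  have b: "0 < b" unfolding b_def using finite_l1_ball[of "0 :: int ^ 'd" 1]
    by (auto simp: card_gt_0_iff intro: exI[of _ 0])
  define q :: real where "q = 1 / (4 * C)"
  have q: "0 < q" "q \<le> 1" using C by (auto simp: q_def)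
  define B where "B = real (b * (1 + b * 2))"
  have B: "0 < B" unfolding B_def of_nat_0_less_iff using b by simp
  define \<delta> where "\<delta> = q\<^sup>2 / (B * (1 + lam + rho))"
  have \<delta>: "0 < \<delta>" unfolding \<delta>_def using q B lam rho by simp
  have pf: "prob (fast \<delta> x) \<le> q\<^sup>2" for x
  proof -
    have "prob (fast \<delta> x) \<le> card (near_clocks x) * (\<delta> * (1 + lam + rho))" using \<delta> by (intro prob_fast_le) auto
    also have "\<dots> \<le> B * (\<delta> * (1 + lam + rho))"
      using card_near_clocks_le[of x] \<delta> lam rho unfolding b_def B_def by (intro mult_right_mono of_nat_mono) auto
    also have "\<dots> = q\<^sup>2" unfolding \<delta>_def using B lam rho by simp
    finally show ?thesis .
  qed
  \<comment> \<open>Emptying the event on chains that are not separated makes the product bound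
    valid for all chains.\<close>
  define E where "E N zs j = (if separated 3 N zs then fast \<delta> (zs ! j) else {})" for N zs and j :: nat
  define bad where "bad x N = {\<omega>\<in>space M. \<exists>zs\<in>chains x 5 N. N \<le> 2 * card {j. j < N \<and> \<omega> \<in> E N zs j}}" for x N
  have ev: "E N zs j \<in> events" for N zs j by (simp add: E_def)
  have bd: "prob (\<Inter>j\<in>J. E N zs j) \<le> (q\<^sup>2) ^ card J" if "J \<subseteq> {..<N}" "J \<noteq> {}" for N zs J
  proof (cases "separated 3 N zs")
    case True
    have fin: "finite J" using that(1) by (rule finite_subset) simp
    have "prob (\<Inter>j\<in>J. fast \<delta> (zs ! j)) = (\<Prod>j\<in>J. prob (fast \<delta> (zs ! j)))"
    proof (rule prob_INT_indep[where K = "\<lambda>j. near_clocks (zs ! j)"])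
      show "disjoint_family_on (\<lambda>j. near_clocks (zs ! j)) J"
        unfolding disjoint_family_on_def
      proof (intro ballI impI)
        fix i j assume ij: "i \<in> J" "j \<in> J" "i \<noteq> j"
        have sep: "3 \<le> l1 (zs ! i - zs ! j)"
          using True ij that(1) l1_commute[of "zs ! i"] unfolding separated_def
          by (metis lessThan_iff nat_neq_iff subsetD)
        show "near_clocks (zs ! i) \<inter> near_clocks (zs ! j) = {}"
        proof (rule ccontr)
          assume "\<not> ?thesis"
          then obtain c where c: "c \<in> near_clocks (zs ! i)" "c \<in> near_clocks (zs ! j)" by blast
          show False using l1_triangle[of "zs ! i" "zs ! j" "clock_target c"]
            near_clocks_target[OF c(1)] near_clocks_target[OF c(2)] sep l1_commute[of "zs ! i" "clock_target c"]
              by simp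
        qed
      qed
      fix j and \<omega> \<omega>' :: "(int ^ 'd) clock \<Rightarrow> real" assume *: "\<And>c. c \<in> near_clocks (zs ! j) \<Longrightarrow> (\<omega> c :: real) = \<omega>' c"
      show "\<omega> \<in> fast \<delta> (zs ! j) \<longleftrightarrow> \<omega>' \<in> fast \<delta> (zs ! j)" unfolding fast_def using * by simp
    qed (use that fin in auto)
    also have "\<dots> \<le> (\<Prod>j\<in>J. q\<^sup>2)" using pf by (intro prod_mono) auto
    finally show ?thesis using True by (simp add: E_def)
  next
    case False
    then have "(\<Inter>j\<in>J. E N zs j) = {}" using that(2) by (auto simp: E_def)
    then show ?thesis by simp
  qed
  have bad: "bad x N \<in> events" "prob (bad x N) \<le> (1/2) ^ N" if "0 < N" for x N
  proof -
    have fin: "finite (chains x 5 N)" using chains_card by blast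
    note pe = peierls_bound[OF fin, where q = q and E = "E N" and N = N, OF ev bd _ _ that]
    show "bad x N \<in> events" unfolding bad_def using q by (intro pe(1)) auto
    have "prob (bad x N) \<le> card (chains x 5 N) * (2 * q) ^ N" unfolding bad_def using q by (intro pe(2)) auto
    also have "\<dots> \<le> real (C ^ N) * (2 * q) ^ N"
      using chains_card[of x 5 N] q unfolding C_def by (intro mult_right_mono of_nat_mono) auto
    also have "\<dots> = (real C * (2 * q)) ^ N" by (simp add: power_mult_distrib)
    also have "real C * (2 * q) = 1/2" using C by (simp add: q_def)
    finally show "prob (bad x N) \<le> (1/2) ^ N" .
  qed
  have null: "AE \<omega> in M. \<exists>N>0. \<omega> \<notin> bad x N" for x
  proof -
    \<comment> \<open>Failure for every \<open>N\<close> at once has probability at most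
      \<open>(1/2) ^ N\<close> for each \<open>N\<close>, hence 0.\<close>
    define A where "A = (\<Inter>N\<in>{0<..}. bad x N)"
    have A: "A \<in> events" unfolding A_def using bad(1) by (intro sets.countable_INT') auto
    have "prob A \<le> (1/2) ^ Suc n" for n
    proof -
      have "A \<subseteq> bad x (Suc n)" unfolding A_def by blast
      then have "prob A \<le> prob (bad x (Suc n))" using bad(1)[of "Suc n" x] by (intro finite_measure_mono) simp_all
      also have "\<dots> \<le> (1/2) ^ Suc n" using bad(2)[of "Suc n" x] by simp
      finally show ?thesis .
    qed
    then have "prob A \<le> 0"
      by (intro LIMSEQ_le_const[OF LIMSEQ_Suc[OF LIMSEQ_power_zero[of "1/2 :: real"]]]) auto
    then have "prob A = 0" by (simp add: measure_le_0_iff)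
    then have "AE \<omega> in M. \<omega> \<notin> A" using A by (simp add: prob_eq_0)
    then show ?thesis by (rule AE_mp) (auto simp: A_def)
  qed
  have AE_good: "AE \<omega> in M. \<forall>x. \<exists>N>0. \<omega> \<notin> bad x N"
    unfolding AE_all_countable by (intro allI null)
  have good: "\<exists>N>0. \<forall>zs\<in>chains x 5 N. separated 3 N zs \<longrightarrow> (\<exists>j<N. \<omega> \<notin> fast \<delta> (zs ! j))"
    if "\<forall>x. \<exists>N>0. \<omega> \<notin> bad x N" for \<omega> x
  proof -
    from that have "\<exists>N>0. \<omega> \<notin> bad x N" ..
    then obtain N where N: "0 < N" "\<omega> \<notin> bad x N" by (elim exE conjE)
    show "\<exists>N>0. \<forall>zs\<in>chains x 5 N. separated 3 N zs \<longrightarrow> (\<exists>j<N. \<omega> \<notin> fast \<delta> (zs ! j))"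
    proof (rule exI[of _ N], intro conjI N(1) ballI impI)
      fix zs assume zs: "zs \<in> chains x 5 N" "separated 3 N zs"
      show "\<exists>j<N. \<omega> \<notin> fast \<delta> (zs ! j)"
      proof (rule ccontr)
        assume "\<not> ?thesis"
        then have "{j. j < N \<and> \<omega> \<in> E N zs j} = {..<N}" using zs by (auto simp: E_def)
        then have "N \<le> 2 * card {j. j < N \<and> \<omega> \<in> E N zs j}" by simp
        then have "\<omega> \<in> bad x N" unfolding bad_def space_M using zs(1) by blast
        with N show False by simp
      qed
    qed
  qed
  from AE_good have "AE \<omega> in M. \<forall>x. \<exists>N>0. \<forall>zs\<in>chains x 5 N. separated 3 N zs \<longrightarrow> (\<exists>j<N. \<omega> \<notin> fast \<delta> (zs ! j))"
    by eventually_elim (rule allI, rule good)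
  with \<delta> show ?thesis by blast
qed

text \<open>If the sum of minimal clocks along a trace stayed bounded, these clocks would tend to 0
  and all sites of the trace would eventually be fast. Getting far away would then produce a
  separated chain of fast sites, so the trace stays in a ball. But on a finite ball the minimal
  clocks are bounded away from 0.\<close>

lemma AE_locally_finite_clocks: "AE \<omega> in M. locally_finite_clocks \<omega>"
proof -
  obtain \<delta> where \<delta>: "0 < \<delta>" and
    AE: "AE \<omega> in M. \<forall>x. \<exists>N>0. \<forall>zs\<in>chains x 5 N. separated 3 N zs \<longrightarrow> (\<exists>j<N. \<omega> \<notin> fast \<delta> (zs ! j))"
    using AE_no_fast_chain by blast
  have det: "locally_finite_clocks \<omega>"
    if pos: "\<forall>c. 0 < \<omega> c" and
      chain: "\<forall>x. \<exists>N>0. \<forall>zs\<in>chains x 5 N. separated 3 N zs \<longrightarrow> (\<exists>j<N. \<omega> \<notin> fast \<delta> (zs ! j))" for \<omega>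
    unfolding locally_finite_clocks_def
  proof (intro conjI pos allI impI)
    fix v :: "nat \<Rightarrow> int ^ 'd" and t :: real
    assume v: "\<forall>i. l1 (v (Suc i) - v i) \<le> 2"
    have mpos: "0 < min_clock \<omega> x" for x using min_clock_attained[of x \<omega>] pos by metis
    show "\<exists>n. t < (\<Sum>i<n. min_clock \<omega> (v i))"
    proof (rule ccontr)
      assume "\<not> ?thesis"
      then have bounded: "(\<Sum>i<n. min_clock \<omega> (v i)) \<le> t" for n by (simp add: not_less)
      have "summable (\<lambda>i. min_clock \<omega> (v i))"
        using mpos bounded[of "Suc _"] unfolding lessThan_Suc_atMost
        by (intro bounded_imp_summable[where B = t]) (auto intro: less_imp_le)
      then have lim: "(\<lambda>i. min_clock \<omega> (v i)) \<longlonglongrightarrow> 0" by (rule summable_LIMSEQ_zero)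
      then have "eventually (\<lambda>i. min_clock \<omega> (v i) < \<delta>) sequentially" using \<delta> by (rule order_tendstoD)
      then obtain m where m: "\<And>i. m \<le> i \<Longrightarrow> min_clock \<omega> (v i) < \<delta>" unfolding eventually_sequentially by blast
      have fast: "\<omega> \<in> fast \<delta> (v i)" if "m \<le> i" for i
        using m[OF that] min_clock_attained[of "v i" \<omega>] unfolding fast_def by auto
      obtain N where N: "0 < N" "\<forall>zs\<in>chains (v m) 5 N. separated 3 N zs \<longrightarrow> (\<exists>j<N. \<omega> \<notin> fast \<delta> (zs ! j))"
        using chain by blast
      have near: "l1 (v n - v m) < N * 5" if "m \<le> n" for n
      proof (rule ccontr)
        assume "\<not> ?thesis"
        then have far: "N * (3 + 2) \<le> l1 (v n - v m)" by simp
        have st: "\<And>i. i < n \<Longrightarrow> l1 (v (Suc i) - v i) \<le> 2" using v by simp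
        from last_exit_chain[of n v 2 3, OF st _ that far] obtain f where f: "f 0 = m" "\<forall>j\<le>N. f j \<le> n"
          "\<And>j. j < N \<Longrightarrow> f j < f (Suc j) \<and> l1 (v (f (Suc j)) - v (f j)) \<le> 5 \<and>
            (\<forall>i. f (Suc j) \<le> i \<and> i \<le> n \<longrightarrow> 3 \<le> l1 (v i - v (f j)))" by auto
        have mono: "f i \<le> f j" if "i \<le> j" "j \<le> N" for i j
          using that
        proof (induction j rule: dec_induct)
          case (step n)
          then have "f n < f (Suc n)" using f(3)[of n] by simp
          with step show ?case by simp
        qed simp
        define zs where "zs = map (\<lambda>j. v (f j)) [0..<Suc N]"
        have nth: "zs ! j = v (f j)" if "j \<le> N" for j using that unfolding zs_def
          by (subst nth_map) (auto simp del: upt_Suc)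
        have "zs \<in> chains (v m) 5 N"
          unfolding chains_def using f(1,3) by (auto simp: nth) (simp add: zs_def)
        moreover have "separated 3 N zs" unfolding separated_def
        proof (intro allI impI)
          fix i j assume ij: "i < j \<and> j < N"
          then have "f (Suc i) \<le> f j" by (intro mono) auto
          then have "3 \<le> l1 (v (f j) - v (f i))" using f(2) f(3)[of i] ij by auto
          then show "3 \<le> l1 (zs ! i - zs ! j)" using ij by (simp add: nth l1_commute)
        qed
        ultimately obtain j where "j < N" "\<omega> \<notin> fast \<delta> (zs ! j)" using N(2) by blast
        moreover have "m \<le> f j" using mono[of 0 j] f(1) \<open>j < N\<close> by simp
        ultimately show False using fast by (simp add: nth)
      qed
      define B where "B = {x. l1 (x - v m) \<le> N * 5}"
      have B: "finite B" "B \<noteq> {}" unfolding B_def using finite_l1_ball by (auto intro!: exI[of _ "v m"])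
      define \<epsilon> where "\<epsilon> = Min (min_clock \<omega> ` B)"
      have "0 < \<epsilon>" unfolding \<epsilon>_def using B mpos by (subst Min_gr_iff) auto
      with lim have "eventually (\<lambda>i. min_clock \<omega> (v i) < \<epsilon>) sequentially" by (rule order_tendstoD)
      then obtain m' where m': "\<And>i. m' \<le> i \<Longrightarrow> min_clock \<omega> (v i) < \<epsilon>" unfolding eventually_sequentially by blast
      have "v (max m m') \<in> B" using near[of "max m m'"] unfolding B_def by simp
      then have "\<epsilon> \<le> min_clock \<omega> (v (max m m'))" unfolding \<epsilon>_def using B by (intro Min_le) auto
      with m'[of "max m m'"] show False by simp
    qed
  qed
  show ?thesis using AE AE_clocks_pos by eventually_elim (rule det)
qed

end

section \<open>Lineages of type 1\<close>

definition lpaths :: "int ^ 'd::finite \<Rightarrow> int ^ 'd \<Rightarrow> (int ^ 'd) list set" where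
  "lpaths x y = {xs. xs \<noteq> [] \<and> hd xs = x \<and> last xs = y \<and> successively lattice_adj xs}"

fun path_sum :: "('v \<Rightarrow> 'v \<Rightarrow> real) \<Rightarrow> 'v list \<Rightarrow> real" where
  "path_sum t (x # y # xs) = t x y + path_sum t (y # xs)"
| "path_sum t xs = 0"

definition fpp :: "(int ^ 'd::finite \<Rightarrow> int ^ 'd \<Rightarrow> real) \<Rightarrow> int ^ 'd \<Rightarrow> int ^ 'd \<Rightarrow> real" where
  "fpp t x y = (INF xs\<in>lpaths x y. path_sum t xs)"

lemma path_sum_nonneg: "(\<And>x y. 0 \<le> t x y) \<Longrightarrow> 0 \<le> path_sum t xs"
  by (induction t xs rule: path_sum.induct) auto

lemma path_sum_join:
  "xs \<noteq> [] \<Longrightarrow> ys \<noteq> [] \<Longrightarrow> last xs = hd ys \<Longrightarrow> path_sum t (xs @ tl ys) = path_sum t xs + path_sum t ys"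
proof (induction xs rule: induct_list012)
  case (2 x)
  then show ?case by (cases ys) auto
qed auto

lemma path_sum_conv_nth: "path_sum t xs = (\<Sum>i<length xs - 1. t (xs ! i) (xs ! Suc i))"
proof (induction t xs rule: path_sum.induct)
  case (1 t x y xs)
  then show ?case by (simp add: sum.lessThan_Suc_shift del: sum.lessThan_Suc)
qed auto

lemma path_sum_cong: "(\<And>i. Suc i < length xs \<Longrightarrow> t (xs ! i) (xs ! Suc i) = t' (xs ! i) (xs ! Suc i))
  \<Longrightarrow> path_sum t xs = path_sum t' xs"
  unfolding path_sum_conv_nth by (intro sum.cong) auto

lemma lpaths_join: "xs \<in> lpaths x y \<Longrightarrow> ys \<in> lpaths y z \<Longrightarrow> xs @ tl ys \<in> lpaths x z"
proof -
  assume xs: "xs \<in> lpaths x y" and ys: "ys \<in> lpaths y z"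
  then obtain zs where zs: "ys = y # zs" by (cases ys) (auto simp: lpaths_def)
  show ?thesis using xs ys unfolding zs lpaths_def
    by (cases zs) (auto simp: successively_append_iff last_append)
qed

lemma exists_closer:
  assumes "x \<noteq> (y :: int ^ 'd::finite)"
  shows "\<exists>z. lattice_adj x z \<and> Suc (l1 (z - y)) = l1 (x - y)"
proof -
  from assms obtain i where i: "x $ i \<noteq> y $ i" by (auto simp: vec_eq_iff)
  define s where "s = sgn (y $ i - x $ i)"
  define z where "z = (\<chi> j. if j = i then x $ i + s else x $ j)"
  have "(\<Sum>j\<in>UNIV. \<bar>x $ j - z $ j\<bar>) = (\<Sum>j\<in>UNIV. if j = i then 1 else 0)"
    using i by (intro sum.cong) (auto simp: z_def s_def sgn_if)
  then have 1: "lattice_adj x z" by (simp add: lattice_adj_def)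
  have "(\<Sum>j\<in>UNIV. \<bar>x $ j - y $ j\<bar>) = (\<Sum>j\<in>UNIV. \<bar>z $ j - y $ j\<bar> + (if j = i then 1 else 0))"
    using i by (intro sum.cong) (auto simp: z_def s_def sgn_if)
  then have "int (l1 (x - y)) = int (l1 (z - y)) + 1"
    unfolding int_l1 by (simp add: sum.distrib)
  with 1 show ?thesis by (intro exI[of _ z]) auto
qed

lemma exists_straight_path:
  fixes x y :: "int ^ 'd::finite"
  shows "\<exists>xs. xs \<in> lpaths x y \<and> distinct xs \<and> length xs = Suc (l1 (x - y)) \<and> (\<forall>z\<in>set xs. l1 (z - y) \<le> l1 (x - y))"
proof (induction "l1 (x - y)" arbitrary: x)
  case 0
  then show ?case by (intro exI[of _ "[x]"]) (auto simp: lpaths_def)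
next
  case (Suc n)
  then have "x \<noteq> y" by auto
  from exists_closer[OF this] obtain z where z: "lattice_adj x z" "Suc (l1 (z - y)) = l1 (x - y)" by blast
  with Suc.hyps(1)[of z] Suc.hyps(2) obtain xs where xs: "xs \<in> lpaths z y" "distinct xs" "length xs
    = Suc (l1 (z - y))"
    "\<forall>w\<in>set xs. l1 (w - y) \<le> l1 (z - y)" by auto
  have "x \<notin> set xs" using xs(4) z(2) by auto
  then show ?case using xs z
    by (intro exI[of _ "x # xs"]) (auto simp: lpaths_def successively_Cons le_Suc_eq)
qed

lemma lpaths_nonempty: "lpaths x y \<noteq> {}"
  using exists_straight_path by blast

lemma bdd_below_path_sum: "(\<And>x y. 0 \<le> t x y) \<Longrightarrow> bdd_below (path_sum t ` A)"
  by (rule bdd_belowI[of _ 0]) (auto intro: path_sum_nonneg)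

lemma fpp_le: "(\<And>x y. 0 \<le> t x y) \<Longrightarrow> xs \<in> lpaths x y \<Longrightarrow> fpp t x y \<le> path_sum t xs"
  unfolding fpp_def by (intro cINF_lower bdd_below_path_sum)

lemma fpp_greatest: "(\<And>xs. xs \<in> lpaths x y \<Longrightarrow> c \<le> path_sum t xs) \<Longrightarrow> c \<le> fpp t x y"
  unfolding fpp_def using lpaths_nonempty by (intro cINF_greatest)

lemma fpp_nonneg: "(\<And>x y. 0 \<le> t x y) \<Longrightarrow> 0 \<le> fpp t x y"
  by (intro fpp_greatest path_sum_nonneg)

lemma fpp_triangle: assumes t: "\<And>x y. 0 \<le> t x y" shows "fpp t x z \<le> fpp t x y + fpp t y z"
proof -
  have "fpp t x z - fpp t y z \<le> fpp t x y"
  proof (rule fpp_greatest)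
    fix xs assume xs: "xs \<in> lpaths x y"
    have "fpp t x z - path_sum t xs \<le> fpp t y z"
    proof (rule fpp_greatest)
      fix ys assume ys: "ys \<in> lpaths y z"
      have "fpp t x z \<le> path_sum t (xs @ tl ys)" using t lpaths_join[OF xs ys] by (rule fpp_le)
      also have "\<dots> = path_sum t xs + path_sum t ys"
        using xs ys by (intro path_sum_join) (auto simp: lpaths_def)
      finally show "fpp t x z - path_sum t xs \<le> path_sum t ys" by simp
    qed
    then show "fpp t x z - fpp t y z \<le> path_sum t xs" by simp
  qed
  then show ?thesis by simp
qed

text \<open>Negative clocks have probability 0; clamping makes passage times nonnegative everywhere.\<close>

definition tau1 :: "('v clock \<Rightarrow> real) \<Rightarrow> 'v \<Rightarrow> 'v \<Rightarrow> real" where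
  "tau1 \<omega> y x = max 0 (\<omega> (Spread1 y x))"

definition tau2 :: "('v clock \<Rightarrow> real) \<Rightarrow> 'v \<Rightarrow> 'v \<Rightarrow> real" where
  "tau2 \<omega> y x = max 0 (\<omega> (Spread2 y x))"

lemma tau_nonneg [simp]: "0 \<le> tau1 \<omega> x y" "0 \<le> tau2 \<omega> x y"
  by (simp_all add: tau1_def tau2_def)

text \<open>A necessary condition on lineages that reads only clocks whose source lies on the path.
  The last site is exempt, having passed nothing on, so the exit site of a block imposes no
  condition.\<close>

definition unconverted :: "('v clock \<Rightarrow> real) \<Rightarrow> 'v list \<Rightarrow> bool" where
  "unconverted \<omega> xs \<longleftrightarrow> (\<forall>i. Suc i < length xs \<longrightarrow> tau1 \<omega> (xs ! i) (xs ! Suc i) < \<omega> (Conversion (xs ! i)))"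

section \<open>Lineages in a given evolution\<close>

context
  fixes \<omega> :: "(int ^ 'd::finite) clock \<Rightarrow> real" and T1 T2 :: "int ^ 'd \<Rightarrow> ennreal"
  assumes lf: "locally_finite_clocks \<omega>" and ev: "is_evolution lattice_adj 0 \<omega> T1 T2"
begin

lemma clocks_pos: "0 < \<omega> c"
  using lf unfolding locally_finite_clocks_def by blast

lemma T1_eq: "T1 x = (if first_attempt1 lattice_adj 0 \<omega> T1 T2 x < first_attempt2 lattice_adj \<omega> T2 x
    then first_attempt1 lattice_adj 0 \<omega> T1 T2 x else \<infinity>)"
  using ev unfolding is_evolution_def by blast

lemma T2_eq: "T2 x = min (first_attempt2 lattice_adj \<omega> T2 x) (T1 x + ennreal (\<omega> (Conversion x)))"
  using ev unfolding is_evolution_def by blast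

lemma T1_finite: "T1 x < \<infinity> \<Longrightarrow> T1 x = first_attempt1 lattice_adj 0 \<omega> T1 T2 x \<and> T1 x < first_attempt2 lattice_adj \<omega> T2 x"
  using T1_eq[of x] by (auto split: if_splits)

lemma T1_less_T2: assumes "T1 x < \<infinity>" shows "T1 x < T2 x"
proof -
  have "T1 x < T1 x + ennreal (\<omega> (Conversion x))"
    using assms clocks_pos[of "Conversion x"]
      by (cases "T1 x") (auto simp: ennreal_plus[symmetric] ennreal_less_iff simp del: ennreal_plus)
  then show ?thesis using T1_finite[OF assms] unfolding T2_eq[of x] min_less_iff_conj by blast
qed

lemma T2_finite: "T1 x < \<infinity> \<Longrightarrow> T2 x < \<infinity>"
  using T2_eq[of x]
    by (metis ennreal_add_eq_top ennreal_neq_top infinity_ennreal_def less_top min.cobounded2 neq_top_trans)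

lemma T2_step: "lattice_adj y x \<Longrightarrow> T2 x \<le> T2 y + ennreal (tau2 \<omega> y x)"
proof -
  assume "lattice_adj y x"
  then have "first_attempt2 lattice_adj \<omega> T2 x \<le> T2 y + ennreal (\<omega> (Spread2 y x))"
    unfolding first_attempt2_def by (intro INF_lower) simp
  moreover have "tau2 \<omega> y x = \<omega> (Spread2 y x)"
    using clocks_pos[of "Spread2 y x"] by (simp add: tau2_def)
  moreover have "T2 x \<le> first_attempt2 lattice_adj \<omega> T2 x" by (subst T2_eq) simp
  ultimately show ?thesis by simp
qed

lemma T2_path: "xs \<in> lpaths x y \<Longrightarrow> T2 y \<le> T2 x + ennreal (path_sum (tau2 \<omega>) xs)"
proof (induction xs arbitrary: x)
  case Nil then show ?case by (simp add: lpaths_def)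
next
  case (Cons a xs)
  then have a: "a = x" by (simp add: lpaths_def)
  show ?case
  proof (cases xs)
    case Nil
    then have "x = y" using Cons.prems by (auto simp: lpaths_def)
    then show ?thesis by simp
  next
    case (Cons b ys)
    then have b: "xs \<in> lpaths b y" "lattice_adj x b" using Cons.prems a by (auto simp: lpaths_def)
    have "T2 y \<le> T2 b + ennreal (path_sum (tau2 \<omega>) xs)" by (rule Cons.IH[OF b(1)])
    also have "\<dots> \<le> (T2 x + ennreal (tau2 \<omega> x b)) + ennreal (path_sum (tau2 \<omega>) xs)"
      by (intro add_right_mono T2_step b)
    also have "\<dots> = T2 x + ennreal (path_sum (tau2 \<omega>) (a # xs))"
      using Cons a path_sum_nonneg[of "tau2 \<omega>"] by (simp add: ennreal_plus add.assoc)
    finally show ?thesis .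
  qed
qed

text \<open>Finitely many neighbours compete, so the infimum is attained at some \<open>y\<close>.
  Its attempt takes place before \<open>T2 y\<close>, which is at most \<open>T1 y\<close> plus the
  conversion time of \<open>y\<close>; cancelling the finite \<open>T1 y\<close> compares the two
  clocks.\<close>

lemma T1_parent:
  assumes "T1 x < \<infinity>" "x \<noteq> 0"
  shows "\<exists>y. lattice_adj y x \<and> T1 x = T1 y + ennreal (\<omega> (Spread1 y x)) \<and> T1 y < \<infinity>
    \<and> \<omega> (Spread1 y x) < \<omega> (Conversion y)"
proof -
  let ?A = "{y. lattice_adj y x \<and> T1 y + ennreal (\<omega> (Spread1 y x)) < T2 y}"
  let ?f = "\<lambda>y. T1 y + ennreal (\<omega> (Spread1 y x))"
  have eq: "T1 x = (INF y\<in>?A. ?f y)" using T1_finite[OF assms(1)] assms(2) by (simp add: first_attempt1_def)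
  have fin: "finite ?A" using finite_nbrs[of x] by (rule rev_finite_subset) auto
  have ne: "?A \<noteq> {}"
  proof
    assume "?A = {}"
    then have "T1 x = \<infinity>" using eq by (simp only:) simp
    with assms show False by simp
  qed
  have "Min (?f ` ?A) = Inf (?f ` ?A)" using fin ne by (intro Min_Inf) auto
  moreover have "Min (?f ` ?A) \<in> ?f ` ?A" using fin ne by (intro Min_in) auto
  ultimately obtain y where y: "y \<in> ?A" "T1 x = ?f y" using eq by auto
  have 1: "T1 y < \<infinity>" using y(2) assms(1)
    by (metis add_top ennreal_add_eq_top infinity_ennreal_def less_top top.not_eq_extremum)
  have "?f y < T1 y + ennreal (\<omega> (Conversion y))" using y(1) T2_eq[of y] by auto
  then have "\<omega> (Spread1 y x) < \<omega> (Conversion y)"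
    using 1 clocks_pos by (metis add_left_mono ennreal_leI linorder_not_le)
  then show ?thesis using y 1 by auto
qed

text \<open>Iterate \<open>T1_parent\<close>. The tracing ends by
  \<open>locally_finite_induct\<close>, and since \<open>T1\<close> increases strictly along the
  lineage, the path is self-avoiding.\<close>

lemma T1_lineage:
  assumes "T1 x \<le> ennreal t"
  shows "\<exists>xs. xs \<in> lpaths 0 x \<and> distinct xs \<and> unconverted \<omega> xs \<and> T1 x = ennreal (path_sum (tau1 \<omega>) xs) \<and>
    (\<forall>z\<in>set xs. T1 z \<le> T1 x)"
proof -
  let ?lineage = "\<lambda>x. \<exists>xs. xs \<in> lpaths 0 x \<and> distinct xs \<and> unconverted \<omega> xs \<and>
    T1 x = ennreal (path_sum (tau1 \<omega>) xs) \<and> (\<forall>z\<in>set xs. T1 z \<le> T1 x)"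
  have nonpos: "?lineage x" if "x = 0" "T1 x < \<infinity>" for x
    using that T1_finite[of x] by (intro exI[of _ "[0]"]) (auto simp: lpaths_def unconverted_def first_attempt1_def)
  have "T1 x \<le> ennreal t \<longrightarrow> ?lineage x"
  proof (rule locally_finite_induct[OF lf, where P = "\<lambda>x t. T1 x \<le> ennreal t \<longrightarrow> ?lineage x"])
    fix x and t :: real assume t: "t \<le> 0"
    show "T1 x \<le> ennreal t \<longrightarrow> ?lineage x"
    proof
      assume "T1 x \<le> ennreal t"
      then have T: "T1 x = 0" using t by (simp add: ennreal_neg)
      have "x = 0"
      proof (rule ccontr)
        assume "x \<noteq> 0"
        then obtain y where "T1 x = T1 y + ennreal (\<omega> (Spread1 y x))" using T1_parent[of x] T by auto
        with T clocks_pos[of "Spread1 y x"] show False by simp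
      qed
      then show "?lineage x" using nonpos T by simp
    qed
  next
    fix x t
    assume IH: "\<And>y. l1 (y - x) \<le> 2 \<Longrightarrow> T1 y \<le> ennreal (t - min_clock \<omega> x) \<longrightarrow> ?lineage y"
    show "T1 x \<le> ennreal t \<longrightarrow> ?lineage x"
    proof
      assume T: "T1 x \<le> ennreal t"
      then have fin: "T1 x < \<infinity>" using le_less_trans ennreal_less_top by (metis infinity_ennreal_def)
      show "?lineage x"
      proof (cases "x = 0")
        case False
        then obtain y where y: "lattice_adj y x" "T1 x = T1 y + ennreal (\<omega> (Spread1 y x))" "T1 y < \<infinity>"
          "\<omega> (Spread1 y x) < \<omega> (Conversion y)" using T1_parent[OF fin] by blast
        let ?s = "\<omega> (Spread1 y x)"
        have s: "0 < ?s" by (rule clocks_pos)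
        obtain r where r: "0 \<le> r" "T1 y = ennreal r" using y(3) by (cases "T1 y") auto
        have t: "r + ?s \<le> t"
        proof -
          have "ennreal (r + ?s) \<le> ennreal t" using T y(2) r s by (simp add: ennreal_plus)
          then show ?thesis using r s
            by (cases "0
              \<le> t") (auto simp: ennreal_neg ennreal_eq_0_iff ennreal_plus[symmetric] simp del: ennreal_plus)
        qed
        have "min_clock \<omega> x \<le> ?s" using y(1)
          by (intro min_clock_le) (auto simp: near_clocks_def intro!: exI[of _ x] exI[of _ y])
        then have "T1 y \<le> ennreal (t - min_clock \<omega> x)" using t r by (simp add: ennreal_leI)
        with IH[of y] y(1) obtain xs where xs: "xs \<in> lpaths 0 y" "distinct xs" "unconverted \<omega> xs"
          "T1 y = ennreal (path_sum (tau1 \<omega>) xs)" "\<forall>z\<in>set xs. T1 z \<le> T1 y" by (auto simp: lattice_adj_iff)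
        have less: "T1 y < T1 x" unfolding y(2) r(2) using r s
          by (simp add: ennreal_plus[symmetric] ennreal_less_iff del: ennreal_plus)
        have xs': "xs \<noteq> []" "last xs = y" using xs(1) by (auto simp: lpaths_def)
        have tau: "tau1 \<omega> y x = ?s" using s by (simp add: tau1_def)
        show ?thesis
        proof (intro exI[of _ "xs @ [x]"] conjI)
          have "[y, x] \<in> lpaths y x" using y(1) by (simp add: lpaths_def)
          from lpaths_join[OF xs(1) this] show "xs @ [x] \<in> lpaths 0 x" by simp
          show "distinct (xs @ [x])" using xs(2,5) less by auto
          show "unconverted \<omega> (xs @ [x])"
            unfolding unconverted_def
          proof (intro allI impI)
            fix i assume i: "Suc i < length (xs @ [x])"
            show "tau1 \<omega> ((xs @ [x]) ! i) ((xs @ [x]) ! Suc i) < \<omega> (Conversion ((xs @ [x]) ! i))"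
            proof (cases "Suc i < length xs")
              case True
              then show ?thesis using xs(3) by (auto simp: unconverted_def nth_append)
            next
              case False
              then have "i = length xs - 1" using i by simp
              then show ?thesis using xs' y(4) tau by (simp add: nth_append last_conv_nth)
            qed
          qed
          have "path_sum (tau1 \<omega>) (xs @ [x]) = path_sum (tau1 \<omega>) xs + ?s"
            using path_sum_join[of xs "[y, x]" "tau1 \<omega>"] xs' tau by simp
          then show "T1 x = ennreal (path_sum (tau1 \<omega>) (xs @ [x]))"
            unfolding y(2) xs(4) using s path_sum_nonneg[of "tau1 \<omega>" xs] by (simp add: ennreal_plus)
          show "\<forall>z\<in>set (xs @ [x]). T1 z \<le> T1 x" using xs(5) less by auto
        qed
      qed (use nonpos fin in simp)
    qed
  qed
  with assms show ?thesis by simp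
qed

text \<open>Type 2 starts from the origin with its conversion at the latest and is hindered by
  nothing, as it also overruns type 1; a lineage must be faster than that. The last conjunct says
  that the whole lineage was once of type 1, so the argument can be restarted at a site where it
  meets a given sphere.\<close>

lemma T1_lineage_competition:
  assumes "T1 x < \<infinity>"
  shows "\<exists>xs. xs \<in> lpaths 0 x \<and> distinct xs \<and> unconverted \<omega> xs \<and>
    path_sum (tau1 \<omega>) xs \<le> \<omega> (Conversion 0) + fpp (tau2 \<omega>) 0 x \<and> (\<forall>z\<in>set xs. T1 z < \<infinity>)"
proof -
  from assms obtain t where "T1 x \<le> ennreal t" by (cases "T1 x") auto
  from T1_lineage[OF this] obtain xs where xs: "xs \<in> lpaths 0 x" "distinct xs" "unconverted \<omega> xs"
    "T1 x = ennreal (path_sum (tau1 \<omega>) xs)" "\<forall>z\<in>set xs. T1 z \<le> T1 x" by blast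
  have "0 \<in> set xs" using xs(1) hd_in_set[of xs] by (auto simp: lpaths_def)
  \<comment> \<open>That the origin really becomes type 1 is read off from the existence of the
    lineage.\<close>
  then have "T1 0 < \<infinity>" using xs(5) assms le_less_trans by blast
  then have "T1 0 = 0" using T1_finite[of 0] by (simp add: first_attempt1_def)
  then have T20: "T2 0 \<le> ennreal (\<omega> (Conversion 0))" using T2_eq[of 0] by simp
  have "path_sum (tau1 \<omega>) xs - \<omega> (Conversion 0) \<le> fpp (tau2 \<omega>) 0 x"
  proof (rule fpp_greatest)
    fix ys assume ys: "ys \<in> lpaths 0 x"
    have "ennreal (path_sum (tau1 \<omega>) xs) < T2 x" using T1_less_T2[OF assms] xs(4) by simp
    also have "\<dots> \<le> T2 0 + ennreal (path_sum (tau2 \<omega>) ys)" by (rule T2_path[OF ys])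
    also have "\<dots> \<le> ennreal (\<omega> (Conversion 0)) + ennreal (path_sum (tau2 \<omega>) ys)" using T20 by (intro add_right_mono)
    also have "\<dots> = ennreal (\<omega> (Conversion 0) + path_sum (tau2 \<omega>) ys)"
      using clocks_pos[of "Conversion 0"] path_sum_nonneg[of "tau2 \<omega>" ys] by (simp add: ennreal_plus)
    finally have "ennreal (path_sum (tau1 \<omega>) xs) < ennreal (\<omega> (Conversion 0) + path_sum (tau2 \<omega>) ys)" .
    then show "path_sum (tau1 \<omega>) xs - \<omega> (Conversion 0) \<le> path_sum (tau2 \<omega>) ys"
      using ennreal_leI not_le by (metis diff_le_eq add.commute linear)
  qed
  moreover have "\<forall>z\<in>set xs. T1 z < \<infinity>" using xs(5) assms le_less_trans by blast
  ultimately show ?thesis using xs by (intro exI[of _ xs]) simp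
qed

end

section \<open>From a barrier on one sphere to extinction\<close>

lemma lpath_hits_sphere:
  fixes xs :: "(int ^ 'd::finite) list"
  assumes "xs \<in> lpaths 0 x" "L \<le> l1 x"
  shows "\<exists>z\<in>set xs. l1 z = L"
  using assms
proof (induction "length xs" arbitrary: xs x)
  case 0 then show ?case by (simp add: lpaths_def)
next
  case (Suc n)
  show ?case
  proof (cases "l1 x = L")
    case True
    then show ?thesis using Suc.prems by (intro bexI[of _ x]) (auto simp: lpaths_def)
  next
    case False
    then have "xs \<noteq> [0]" using Suc.prems by (auto simp: lpaths_def)
    obtain ys where ys: "xs = ys @ [x]"
      using Suc.prems(1) by (cases xs rule: rev_cases) (auto simp: lpaths_def)
    have ys_ne: "ys \<noteq> []" using \<open>xs \<noteq> [0]\<close> ys Suc.prems(1) by (auto simp: lpaths_def)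
    with ys have p: "ys \<in> lpaths 0 (last ys)" "lattice_adj (last ys) x"
      using Suc.prems by (auto simp: lpaths_def successively_append_iff hd_append)
    have "L \<le> l1 (last ys)"
      using False Suc.prems(2) l1_triangle[of x 0 "last ys"] p(2) by (simp add: lattice_adj_iff l1_commute)
    then have "\<exists>z\<in>set ys. l1 z = L" using Suc.hyps ys p(1) by auto
    then show ?thesis using ys by auto
  qed
qed

text \<open>One sphere suffices: a lineage to a site on or outside it passes through a type 1 site
  on it, and the barrier forbids such sites. Only finitely many sites are then ever of type 1, and
  each of them converts in finite time.\<close>

lemma dies_out_if_barrier:
  fixes \<omega> :: "(int ^ 'd::finite) clock \<Rightarrow> real"
  assumes lf: "locally_finite_clocks \<omega>"
    and barrier: "\<And>x xs. l1 x = L \<Longrightarrow> xs \<in> lpaths 0 x \<Longrightarrow> distinct xs \<Longrightarrow> unconverted \<omega> xs \<Longrightarrow>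
      \<omega> (Conversion 0) + fpp (tau2 \<omega>) 0 x < path_sum (tau1 \<omega>) xs"
  shows "type1_dies_out lattice_adj 0 \<omega>"
proof
  define T1 T2 where "T1 = fst (evolution lattice_adj 0 \<omega>)" and "T2 = snd (evolution lattice_adj 0 \<omega>)"
  have ev: "is_evolution lattice_adj 0 \<omega> T1 T2" unfolding T1_def T2_def by (rule evolution_exists[OF lf])
  have fin: "l1 x < L" if x: "T1 x < \<infinity>" for x
  proof (rule ccontr)
    assume "\<not> ?thesis"
    then have "L \<le> l1 x" by simp
    moreover obtain xs where "xs \<in> lpaths 0 x" "\<forall>z\<in>set xs. T1 z < \<infinity>" using T1_lineage_competition[OF lf ev x] by blast
    ultimately obtain z where z: "l1 z = L" "T1 z < \<infinity>" using lpath_hits_sphere by blast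
    from T1_lineage_competition[OF lf ev z(2)] barrier[OF z(1)] show False by (meson not_le)
  qed
  define F where "F = {x. T1 x < \<infinity>}"
  have "F \<subseteq> {x. l1 (x - 0) \<le> L}" unfolding F_def using fin by (auto intro: less_imp_le)
  then have "finite F" by (rule finite_subset) (rule finite_l1_ball)
  \<comment> \<open>By this time every site that was ever of type 1 has converted; inserting 0
    covers an empty \<open>F\<close> and gives \<open>0 \<le> t\<close>.\<close>
  define t where "t = Max (insert 0 ((\<lambda>x. enn2real (T2 x)) ` F))"
  have t: "0 \<le> t" unfolding t_def using \<open>finite F\<close> by (intro Max_ge) auto
  have T2: "T2 x \<le> ennreal t" if "x \<in> F" for x
  proof -
    have "enn2real (T2 x) \<le> t" unfolding t_def using \<open>finite F\<close> that by (intro Max_ge) auto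
    moreover have "T2 x < \<infinity>" using T2_finite[OF lf ev] that by (simp add: F_def)
    ultimately show ?thesis by (metis ennreal_enn2real ennreal_leI infinity_ennreal_def)
  qed
  assume "type1_survives lattice_adj 0 \<omega>"
  then obtain x where x: "state_at lattice_adj 0 \<omega> t x = Type1"
    using t unfolding type1_survives_def by blast
  then have "\<not> T2 x \<le> ennreal t" "T1 x \<le> ennreal t"
    unfolding state_at_def T1_def T2_def by (auto split: if_splits)
  moreover from this(2) have "x \<in> F" unfolding F_def using le_less_trans[OF _ ennreal_less_top] by simp
  ultimately show False using T2 by blast
qed

section \<open>Blocks and paths\<close>

definition cell :: "nat \<Rightarrow> int ^ 'd::finite \<Rightarrow> int ^ 'd" where
  "cell k x = (\<chi> i. x $ i div int k)"

text \<open>\<open>block k 0 z\<close> is a single cube of side \<open>k\<close>. Distances are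
  measured between cube indices, so that \<open>last_exit_chain\<close> and \<open>chains\<close>
  can be reused on the coarse lattice.\<close>

definition block :: "nat \<Rightarrow> nat \<Rightarrow> int ^ 'd::finite \<Rightarrow> (int ^ 'd) set" where
  "block k r z = {x. l1 (cell k x - z) \<le> r}"

lemma abs_div_diff_le: assumes "0 < (k::int)" shows "\<bar>a div k - b div k\<bar> \<le> \<bar>a - b\<bar>"
proof -
  have *: "b div k - a div k \<le> b - a" if "a \<le> b" for a b :: int
  proof -
    have "b div k = (a + (b - a)) div k" by simp
    also have "\<dots> \<le> (a + (b - a) * k) div k"
      using assms that mult_left_mono[of 1 k "b - a"] by (intro zdiv_mono1) auto
    also have "\<dots> = a div k + (b - a)" using assms by simp
    finally show ?thesis by simp
  qed
  show ?thesis
  proof (cases "a \<le> b")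
    case True
    then show ?thesis using *[OF True] zdiv_mono1[OF True assms] by simp
  next
    case False
    then have "b \<le> a" by simp
    then show ?thesis using *[of b a] zdiv_mono1[of b a k] assms by simp
  qed
qed

lemma l1_cell_diff_le: "0 < k \<Longrightarrow> l1 (cell k x - cell k y) \<le> l1 (x - y)"
proof -
  assume "0 < k"
  then have "int (l1 (cell k x - cell k y)) \<le> int (l1 (x - y))"
    unfolding int_l1 cell_def by (intro sum_mono) (simp add: abs_div_diff_le)
  then show ?thesis by simp
qed

lemma block_sub_box:
  assumes "0 < k"
  shows "block k r z \<subseteq> (\<lambda>f. \<chi> i. f i) ` (\<Pi>\<^sub>E i\<in>UNIV. {int k * (z $ i - int r) ..< int k * (z $ i + int r + 1)})"
proof
  fix x assume "x \<in> block k r z"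
  then have c: "\<bar>x $ i div int k - z $ i\<bar> \<le> int r" for i
    using abs_nth_le_l1[of "cell k x - z" i] by (simp add: block_def cell_def)
  have "x $ i \<in> {int k * (z $ i - int r) ..< int k * (z $ i + int r + 1)}" for i
  proof -
    have "int k * (z $ i - int r) \<le> int k * (x $ i div int k)" using c[of i] assms by (intro mult_left_mono) auto
    moreover have "int k * (x $ i div int k) \<le> x $ i"
      using assms pos_mod_sign[of "int k" "x $ i"] mult_div_mod_eq[of "int k" "x $ i"] by linarith
    moreover have "x $ i < int k * (x $ i div int k + 1)"
      using assms pos_mod_bound[of "int k" "x $ i"] mult_div_mod_eq[of "int k" "x $ i"]
      unfolding distrib_left mult_1_right by linarith
    moreover have "int k * (x $ i div int k + 1) \<le> int k * (z $ i + int r + 1)" using c[of i] assms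
      by (intro mult_left_mono) auto
    ultimately show ?thesis by simp
  qed
  then show "x \<in> (\<lambda>f. \<chi> i. f i) ` (\<Pi>\<^sub>E i\<in>UNIV. {int k * (z $ i - int r) ..< int k * (z $ i + int r + 1)})"
    by (intro image_eqI[of _ _ "\<lambda>i. x $ i"]) (auto simp: vec_eq_iff)
qed

lemma finite_block: "0 < k \<Longrightarrow> finite (block k r z)"
  by (rule finite_subset[OF block_sub_box]) (auto intro!: finite_imageI finite_PiE)

text \<open>What counts is that the bound is polynomial in \<open>k\<close>: it will be played
  against factors that are exponentially small in \<open>k\<close>.\<close>

lemma card_block_le:
  assumes "0 < k" shows "card (block k r (z :: int ^ 'd::finite)) \<le> (k * (2 * r + 1)) ^ CARD('d)"
proof -
  let ?P = "\<Pi>\<^sub>E i\<in>(UNIV :: 'd set). {int k * (z $ i - int r) ..< int k * (z $ i + int r + 1)}"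
  have fin: "finite ?P" by (intro finite_PiE) auto
  have "card (block k r z) \<le> card ((\<lambda>f. (\<chi> i. f i) :: int ^ 'd) ` ?P)"
    using fin by (intro card_mono block_sub_box assms) auto
  also have "\<dots> \<le> card ?P" using fin by (rule card_image_le)
  also have "\<dots> = (\<Prod>i\<in>(UNIV :: 'd set). k * (2 * r + 1))"
  proof (subst card_PiE, simp, intro prod.cong refl)
    fix i
    have "int k * (z $ i + int r + 1) - int k * (z $ i - int r) = int (k * (2 * r + 1))"
      by (simp add: algebra_simps)
    then show "card {int k * (z $ i - int r) ..< int k * (z $ i + int r + 1)} = k * (2 * r + 1)"
      unfolding card_atLeastLessThan_int by (simp only: nat_int)
  qed
  finally show ?thesis by simp
qed

section \<open>Self-avoiding paths and near ties\<close>

definition path_edges :: "'v list \<Rightarrow> ('v \<times> 'v) set" where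
  "path_edges xs = {(xs ! i, xs ! Suc i) | i. Suc i < length xs}"

lemma finite_path_edges: "finite (path_edges xs)"
proof -
  have "path_edges xs = (\<lambda>i. (xs ! i, xs ! Suc i)) ` {i. Suc i < length xs}"
    by (auto simp: path_edges_def)
  moreover have "finite {i. Suc i < length xs}" by (rule finite_subset[of _ "{..<length xs}"]) auto
  ultimately show ?thesis by simp
qed

lemma path_sum_edges:
  assumes "distinct xs"
  shows "path_sum t xs = (\<Sum>(x, y)\<in>path_edges xs. t x y)"
proof -
  have eq: "path_edges xs = (\<lambda>i. (xs ! i, xs ! Suc i)) ` {..<length xs - 1}"
    by (auto simp: path_edges_def)
  have inj: "inj_on (\<lambda>i. (xs ! i, xs ! Suc i)) {..<length xs - 1}"
    using assms by (auto simp: inj_on_def nth_eq_iff_index_eq)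
  show ?thesis unfolding eq path_sum_conv_nth by (subst sum.reindex[OF inj]) simp
qed

text \<open>A self-avoiding \<open>ys\<close> leaves each site by at most one edge, so
  \<open>xs\<close>, starting where \<open>ys\<close> does, must follow it edge by edge; the common
  last site rules out that \<open>xs\<close> stops early. Hence of two different self-avoiding paths
  with the same ends each has an edge that the other lacks.\<close>

lemma path_edges_subset_imp_eq:
  assumes "distinct xs" "distinct ys" "xs \<noteq> []" "ys \<noteq> []" "hd xs = hd ys" "last xs = last ys" "path_edges xs
    \<subseteq> path_edges ys"
  shows "xs = ys"
proof -
  have same: "i < length ys \<and> xs ! i = ys ! i" if "i < length xs" for i
    using that
  proof (induction i)
    case 0 then show ?case using assms by (simp add: hd_conv_nth)
  next
    case (Suc i)
    then have IH: "i < length ys" "xs ! i = ys ! i" by auto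
    have "(xs ! i, xs ! Suc i) \<in> path_edges ys" using Suc.prems assms(7) by (auto simp: path_edges_def)
    then obtain j where j: "Suc j < length ys" "xs ! i = ys ! j" "xs ! Suc i = ys ! Suc j"
      by (auto simp: path_edges_def)
    then have "j = i" using IH assms(2) by (metis Suc_lessD nth_eq_iff_index_eq)
    then show ?case using j by simp
  qed
  have "length xs = length ys"
  proof -
    have "xs ! (length xs - 1) = ys ! (length ys - 1)" using assms by (simp add: last_conv_nth)
    moreover have "length xs - 1 < length ys" "xs ! (length xs - 1) = ys ! (length xs - 1)"
      using same[of "length xs - 1"] assms(3) by auto
    ultimately have "length xs - 1 = length ys - 1"
      using assms(2,4) by (metis diff_less length_greater_0_conv nth_eq_iff_index_eq zero_less_one)
    then show ?thesis using assms(3,4) by (metis Suc_diff_1 length_greater_0_conv)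
  qed
  then show ?thesis using same by (intro nth_equalityI) auto
qed

lemma lpath_length: "xs \<in> lpaths x y \<Longrightarrow> l1 (y - x) < length xs"
proof (induction xs arbitrary: x)
  case (Cons a xs)
  show ?case
  proof (cases xs)
    case Nil
    then show ?thesis using Cons.prems by (auto simp: lpaths_def)
  next
    case (Cons b ys)
    then have b: "xs \<in> lpaths b y" "lattice_adj x b" using Cons.prems by (auto simp: lpaths_def)
    then show ?thesis using Cons.IH[OF b(1)] l1_triangle[of y x b] by (simp add: lattice_adj_iff l1_commute)
  qed
qed (simp add: lpaths_def)

primrec clock_source :: "'v clock \<Rightarrow> 'v" where
  "clock_source (Spread1 y x) = y" | "clock_source (Spread2 y x) = y" | "clock_source (Conversion x) = x"

lemma nth_in_butlast: "Suc i < length xs \<Longrightarrow> xs ! i \<in> set (butlast xs)"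
  using nth_mem[of i "butlast xs"] by (simp add: nth_butlast)

lemma path_sum_depends:
  assumes "\<And>c. clock_source c \<in> set (butlast xs) \<Longrightarrow> \<omega> c = \<omega>' c"
  shows "path_sum (tau1 \<omega>) xs = path_sum (tau1 \<omega>') xs"
proof (rule path_sum_cong)
  fix i assume "Suc i < length xs"
  then show "tau1 \<omega> (xs ! i) (xs ! Suc i) = tau1 \<omega>' (xs ! i) (xs ! Suc i)"
    using assms[of "Spread1 (xs ! i) (xs ! Suc i)"] nth_in_butlast[of i xs] by (simp add: tau1_def)
qed

lemma unconverted_depends:
  assumes "\<And>c. clock_source c \<in> set (butlast xs) \<Longrightarrow> \<omega> c = \<omega>' c"
  shows "unconverted \<omega> xs = unconverted \<omega>' xs"
proof -
  have "tau1 \<omega> (xs ! i) (xs ! Suc i) = tau1 \<omega>' (xs ! i) (xs ! Suc i)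
    \<and> \<omega> (Conversion (xs ! i)) = \<omega>' (Conversion (xs ! i))"
    if "Suc i < length xs" for i
    using assms[of "Spread1 (xs ! i) (xs ! Suc i)"] assms[of "Conversion (xs ! i)"] nth_in_butlast[OF that]
    by (simp add: tau1_def)
  then show ?thesis unfolding unconverted_def by simp
qed

context clocks
begin

lemma tau_measurable [measurable]: "(\<lambda>\<omega>. tau1 \<omega> x y) \<in> borel_measurable M" "(\<lambda>\<omega>. tau2 \<omega> x y) \<in> borel_measurable M"
  unfolding tau1_def tau2_def by measurable

lemma path_sum_measurable [measurable]:
  "(\<lambda>\<omega>. path_sum (tau1 \<omega>) xs) \<in> borel_measurable M" "(\<lambda>\<omega>. path_sum (tau2 \<omega>) xs) \<in> borel_measurable M"
  unfolding path_sum_conv_nth by measurable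

lemma unconverted_measurable [measurable]: "Measurable.pred M (\<lambda>\<omega>. unconverted \<omega> xs)"
  unfolding unconverted_def by measurable

text \<open>Condition on all clocks except that of the edge. Then \<open>W\<close> is a constant,
  the event confines the remaining clock to an interval of length \<open>2 * \<eta>\<close>, and its
  density is at most 1.\<close>

lemma prob_near_tie:
  assumes dep: "\<And>\<omega> \<omega>'. (\<And>c'. c' \<noteq> Spread1 u v \<Longrightarrow> \<omega> c' = \<omega>' c') \<Longrightarrow> W \<omega> = W \<omega>'"
    and W [measurable]: "W \<in> borel_measurable M" and \<eta>: "0 \<le> \<eta>"
  shows "prob {\<omega>. \<bar>tau1 \<omega> u v + W \<omega>\<bar> \<le> \<eta>} \<le> 2 * \<eta>"
proof -
  let ?c = "Spread1 u v"
  define f where "f b = (if b then (\<lambda>\<omega>. \<omega> ?c) else W)" for b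
  have "indep_vars (\<lambda>_. borel) f UNIV"
    unfolding M_PiM
  proof (rule indep_vars_disjoint_support[where K = "\<lambda>b. if b then {?c} else - {?c}"])
    show "f j \<in> PiM UNIV clock_law \<rightarrow>\<^sub>M borel" for j unfolding M_PiM[symmetric] f_def by simp
    fix j and \<omega> \<omega>' :: "(int ^ 'd) clock \<Rightarrow> real"
    assume *: "\<And>i. i \<in> (if j then {?c} else - {?c}) \<Longrightarrow> \<omega> i = \<omega>' i"
    show "f j \<omega> = f j \<omega>'"
    proof (cases j)
      case True then show ?thesis using *[of ?c] by (simp add: f_def)
    next
      case False then show ?thesis using * by (auto simp: f_def intro!: dep)
    qed
  qed (auto simp: disjoint_family_on_def prob_space_law)
  then have "indep_var borel (\<lambda>\<omega>. \<omega> ?c) borel W"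
    unfolding indep_var_def by (rule indep_vars_cong[THEN iffD1, rotated -1]) (auto simp: f_def split: bool.split)
  then have joint: "distr M borel (\<lambda>\<omega>. \<omega> ?c) \<Otimes>\<^sub>M distr M borel W = distr M (borel \<Otimes>\<^sub>M borel) (\<lambda>\<omega>. (\<omega> ?c, W \<omega>))"
    by (simp add: indep_var_distribution_eq)
  have law: "distr M borel (\<lambda>\<omega>. \<omega> ?c) = density lborel (exponential_density 1)"
  proof -
    have "distr M borel (\<lambda>\<omega>. \<omega> ?c) = distr M lborel (\<lambda>\<omega>. \<omega> ?c)" by (intro distr_cong) auto
    also have "\<dots> = density lborel (exponential_density 1)"
      using distributed_clock[of ?c] by (simp add: distributed_def)
    finally show ?thesis .
  qed
  interpret W: prob_space "distr M borel W" by (rule prob_space_distr) measurable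
  interpret X: prob_space "distr M borel (\<lambda>\<omega>. \<omega> ?c)" by (rule prob_space_distr) measurable
  interpret P: pair_sigma_finite "distr M borel (\<lambda>\<omega>. \<omega> ?c)" "distr M borel W" ..
  define A where "A = {p :: real \<times> real. \<bar>max 0 (fst p) + snd p\<bar> \<le> \<eta>}"
  have A [measurable]: "A \<in> sets (borel \<Otimes>\<^sub>M borel)"
  proof -
    have "{p \<in> space (borel \<Otimes>\<^sub>M borel). \<bar>max 0 (fst p) + snd p\<bar>
      \<le> \<eta>} \<in> sets (borel \<Otimes>\<^sub>M borel :: (real \<times> real) measure)"
      by measurable
    moreover have "{p \<in> space (borel \<Otimes>\<^sub>M borel). \<bar>max 0 (fst p) + snd p\<bar> \<le> \<eta>} = A"
      by (auto simp: A_def space_pair_measure)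
    ultimately show ?thesis by (simp only:)
  qed
  have "emeasure M {\<omega>. \<bar>tau1 \<omega> u v + W \<omega>\<bar> \<le> \<eta>} = emeasure (distr M (borel \<Otimes>\<^sub>M borel) (\<lambda>\<omega>. (\<omega> ?c, W \<omega>))) A"
  proof (subst emeasure_distr[OF _ A])
    show "(\<lambda>\<omega>. (\<omega> ?c, W \<omega>)) \<in> M \<rightarrow>\<^sub>M borel \<Otimes>\<^sub>M borel" by measurable
    show "emeasure M {\<omega>. \<bar>tau1 \<omega> u v + W \<omega>\<bar> \<le> \<eta>} = emeasure M ((\<lambda>\<omega>. (\<omega> ?c, W \<omega>)) -` A \<inter> space M)"
      by (simp add: A_def tau1_def vimage_def)
  qed
  also have "\<dots> = (\<integral>\<^sup>+w. emeasure (distr M borel (\<lambda>\<omega>. \<omega> ?c)) ((\<lambda>x. (x, w)) -` A) \<partial>distr M borel W)"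
    unfolding joint[symmetric] by (rule P.emeasure_pair_measure_alt2) simp
  also have "\<dots> \<le> (\<integral>\<^sup>+w. ennreal (2 * \<eta>) \<partial>distr M borel W)"
  proof (rule nn_integral_mono)
    fix w
    have sl: "(\<lambda>x. (x, w)) -` A \<in> sets borel"
    proof -
      have "{x \<in> space borel. \<bar>max 0 x + w\<bar> \<le> \<eta>} \<in> sets (borel :: real measure)" by measurable
      then show ?thesis by (simp add: A_def vimage_def)
    qed
    have "emeasure (density lborel (exponential_density 1)) ((\<lambda>x. (x, w)) -` A) =
      (\<integral>\<^sup>+x. ennreal (exponential_density 1 x) * indicator ((\<lambda>x. (x, w)) -` A) x \<partial>lborel)"
      using sl by (intro emeasure_density) auto
    \<comment> \<open>The density vanishes on the negative axis, where the clamping in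
      \<open>tau1\<close> would make a difference.\<close>
    also have "\<dots> \<le> (\<integral>\<^sup>+x. indicator {- w - \<eta> .. - w + \<eta>} x \<partial>lborel)"
      by (intro nn_integral_mono) (auto simp: A_def exponential_density_def indicator_def split: if_splits)
    also have "\<dots> = ennreal (2 * \<eta>)" using \<eta> by simp
    finally show "emeasure (distr M borel (\<lambda>\<omega>. \<omega> ?c)) ((\<lambda>x. (x, w)) -` A) \<le> ennreal (2 * \<eta>)" unfolding law .
  qed
  also have "\<dots> = ennreal (2 * \<eta>)" using W.emeasure_space_1 by simp
  finally show ?thesis using \<eta> by (simp add: emeasure_eq_measure)
qed

text \<open>An edge of \<open>xs\<close> that is not in \<open>ys\<close> contributes its clock to
  the difference exactly once; all other terms form \<open>W\<close>, which does not read that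
  clock.\<close>

lemma prob_path_tie:
  assumes xs: "xs \<in> lpaths x y" "distinct xs" and ys: "ys \<in> lpaths x y" "distinct ys" and "xs \<noteq> ys" "0 \<le> \<eta>"
  shows "prob {\<omega>. \<bar>path_sum (tau1 \<omega>) xs - path_sum (tau1 \<omega>) ys\<bar> \<le> \<eta>} \<le> 2 * \<eta>"
proof -
  have "\<not> path_edges xs \<subseteq> path_edges ys"
    using assms path_edges_subset_imp_eq[of xs ys] by (auto simp: lpaths_def)
  then obtain u v where e: "(u, v) \<in> path_edges xs" "(u, v) \<notin> path_edges ys" by auto
  define W where "W \<omega> = (\<Sum>(a, b)\<in>path_edges xs - {(u, v)}. tau1 \<omega> a b) - (\<Sum>(a, b)\<in>path_edges ys. tau1 \<omega> a b)" for \<omega>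
  have eq: "path_sum (tau1 \<omega>) xs - path_sum (tau1 \<omega>) ys = tau1 \<omega> u v + W \<omega>" for \<omega>
    unfolding W_def path_sum_edges[OF xs(2)] path_sum_edges[OF ys(2)] using e(1) finite_path_edges[of xs]
    by (subst sum.remove[of _ "(u, v)"]) auto
  show ?thesis unfolding eq
  proof (rule prob_near_tie)
    show "W \<in> borel_measurable M" unfolding W_def case_prod_beta by measurable
    fix \<omega> \<omega>' :: "(int ^ 'd) clock \<Rightarrow> real" assume *: "\<And>c'. c' \<noteq> Spread1 u v \<Longrightarrow> \<omega> c' = \<omega>' c'"
    have "tau1 \<omega> a b = tau1 \<omega>' a b" if "(a, b) \<noteq> (u, v)" for a b using that *[of "Spread1 a b"]
      by (auto simp: tau1_def)
    note ** = this
    have "(\<Sum>(a, b)\<in>path_edges xs - {(u, v)}. tau1 \<omega> a b) = (\<Sum>(a, b)\<in>path_edges xs - {(u, v)}. tau1 \<omega>' a b)"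
      by (rule sum.cong) (auto intro: **)
    moreover have "(\<Sum>(a, b)\<in>path_edges ys. tau1 \<omega> a b) = (\<Sum>(a, b)\<in>path_edges ys. tau1 \<omega>' a b)"
      by (rule sum.cong) (use e(2) in \<open>auto intro: **\<close>)
    ultimately show "W \<omega> = W \<omega>'" unfolding W_def by simp
  qed (fact assms)
qed

end

section \<open>Geodesics without conversion across a block\<close>

lemma poly_times_geometric_tendsto_0:
  fixes r c :: real
  assumes r: "0 \<le> r" "r < 1" and p: "0 < p"
  shows "(\<lambda>k. (real k * c) ^ p * r ^ k) \<longlonglongrightarrow> 0"
proof -
  \<comment> \<open>Taking the \<open>p\<close>-th root of \<open>r\<close> reduces the claim to the
    sequence \<open>k * x ^ k\<close>.\<close>
  define x where "x = root p r"
  have x: "norm x < 1" "x ^ p = r" using r p by (simp_all add: x_def)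
  have "(\<lambda>k. c ^ p * (real k * x ^ k) ^ p) \<longlonglongrightarrow> c ^ p * 0 ^ p"
    by (intro tendsto_intros powser_times_n_limit_0 x)
  moreover have "c ^ p * (real k * x ^ k) ^ p = (real k * c) ^ p * r ^ k" for k
    unfolding x(2)[symmetric] by (simp add: power_mult_distrib power_mult[symmetric] mult.commute)
  ultimately show ?thesis using p by (simp add: zero_power)
qed

text \<open>The end point is left free: it will be the site at which the path leaves the block. Only
  the sites of \<open>butlast\<close> have clocks that the path reads.\<close>

definition exits :: "nat \<Rightarrow> int ^ 'd::finite \<Rightarrow> int ^ 'd \<Rightarrow> int ^ 'd \<Rightarrow> (int ^ 'd) list set" where
  "exits k z x y = {xs \<in> lpaths x y. distinct xs \<and> set (butlast xs) \<subseteq> block k CARD('d) z}"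

lemma set_subset_butlast: "set xs \<subseteq> insert (last xs) (set (butlast xs))"
  by (cases xs rule: rev_cases) auto

lemma exits_subset:
  assumes "(y :: int ^ 'd::finite) \<in> block k (Suc CARD('d)) z"
  shows "exits k z x y \<subseteq> {xs. set xs \<subseteq> block k (Suc CARD('d)) z \<and> distinct xs}"
proof -
  have "block k CARD('d) z \<subseteq> block k (Suc CARD('d)) z" by (auto simp: block_def)
  moreover have "set xs \<subseteq> insert y (set (butlast xs))" if "xs \<in> lpaths x y" for xs
    using that set_subset_butlast[of xs] by (simp add: lpaths_def)
  ultimately show ?thesis using assms unfolding exits_def by blast
qed

lemma finite_exits: "0 < k \<Longrightarrow> (y :: int ^ 'd::finite) \<in> block k (Suc CARD('d)) z \<Longrightarrow> finite (exits k z x y)"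
  by (rule finite_subset[OF exits_subset finite_subset_distinct[OF finite_block]])

lemma card_distinct_lists_le:
  assumes "finite A" "card A \<le> m"
  shows "card {xs. set xs \<subseteq> A \<and> distinct xs} \<le> (\<Sum>i\<le>m. m ^ i)"
proof -
  have "{xs. set xs \<subseteq> A \<and> distinct xs} \<subseteq> {xs. set xs \<subseteq> A \<and> length xs \<le> m}"
    using order_trans[OF card_mono[OF assms(1)] assms(2)] by (auto simp: distinct_card[symmetric])
  then have "card {xs. set xs \<subseteq> A \<and> distinct xs} \<le> card {xs. set xs \<subseteq> A \<and> length xs \<le> m}"
    using assms by (intro card_mono finite_lists_length_le)
  also have "\<dots> = (\<Sum>i\<le>m. card A ^ i)" by (rule card_lists_length_le[OF assms(1)])
  also have "\<dots> \<le> (\<Sum>i\<le>m. m ^ i)" using assms by (intro sum_mono power_mono) auto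
  finally show ?thesis .
qed

text \<open>The block radius \<open>CARD('d)\<close> is made for this: a larger l1 distance forces
  two cube indices to differ by at least 2 in some coordinate, so a full cube lies in between and
  the path has at least \<open>k\<close> steps.\<close>

lemma exit_length:
  fixes x y z :: "int ^ 'd::finite"
  assumes "0 < k" "x \<in> block k 0 z" "y \<notin> block k CARD('d) z" "xs \<in> lpaths x y"
  shows "k < length xs"
proof -
  have cx: "cell k x = z" using assms(2) by (simp add: block_def)
  have "\<exists>i. 2 \<le> \<bar>cell k y $ i - cell k x $ i\<bar>"
  proof (rule ccontr)
    assume "\<not> ?thesis"
    then have "\<not> 2 \<le> \<bar>cell k y $ i - cell k x $ i\<bar>" for i by iprover
    from this[unfolded not_le] have "\<bar>(cell k y - cell k x) $ i\<bar> \<le> int 1" for i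
      unfolding vector_minus_component of_nat_1 by (metis zle_add1_eq_le one_add_one)
    then have "l1 (cell k y - cell k x) \<le> CARD('d) * 1" by (rule l1_le_card)
    then show False using assms(3) cx by (simp add: block_def)
  qed
  then obtain i where "2 \<le> \<bar>y $ i div int k - x $ i div int k\<bar>" by (auto simp: cell_def)
  moreover have "\<bar>a - b\<bar> \<ge> int k" if "2 \<le> \<bar>a div int k - b div int k\<bar>" for a b :: int
  proof -
    have *: "int k \<le> a - b" if "2 \<le> a div int k - b div int k" for a b :: int
    proof -
      have "int k * 2 \<le> int k * (a div int k - b div int k)" using that assms(1) by (intro mult_left_mono) auto
      moreover have "int k * (a div int k - b div int k) = (a - a mod int k) - (b - b mod int k)"
        by (simp add: algebra_simps minus_mod_eq_mult_div)
      moreover have "0 \<le> a mod int k" "b mod int k < int k" using assms(1) by simp_all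
      ultimately show ?thesis by linarith
    qed
    show ?thesis using that *[of a b] *[of b a] by linarith
  qed
  ultimately have "int k \<le> \<bar>(y - x) $ i\<bar>" by simp
  then have "int k \<le> int (l1 (y - x))" using abs_nth_le_l1[of "y - x" i] by linarith
  then show ?thesis using lpath_length[OF assms(4)] by simp
qed

context clocks
begin

text \<open>
  Competing paths are confined to the block, so that the event depends only on clocks with source in
  it and separated blocks are independent.
\<close>

definition crossing :: "nat \<Rightarrow> real \<Rightarrow> int ^ 'd \<Rightarrow> ((int ^ 'd) clock \<Rightarrow> real) set" where
  "crossing k \<eta> z = {\<omega>. \<exists>x\<in>block k 0 z. \<exists>y\<in>block k (Suc CARD('d)) z - block k CARD('d) z. \<exists>xs\<in>exits k z x y.
     unconverted \<omega> xs \<and> (\<forall>ys\<in>exits k z x y. path_sum (tau1 \<omega>) xs \<le> path_sum (tau1 \<omega>) ys + \<eta>)}"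

lemma crossing_measurable [measurable]: "crossing k \<eta> z \<in> events"
proof -
  have "{\<omega>\<in>space M. \<exists>x\<in>block k 0 z. \<exists>y\<in>block k (Suc CARD('d)) z - block k CARD('d) z. \<exists>xs\<in>exits k z x y.
     unconverted \<omega> xs \<and> (\<forall>ys\<in>exits k z x y. path_sum (tau1 \<omega>) xs \<le> path_sum (tau1 \<omega>) ys + \<eta>)} \<in> events"
    by (intro predE pred_intros_countable_bounded(3,4) pred_intros_logic) measurable
  then show ?thesis by (simp add: crossing_def)
qed

lemma crossing_depends:
  assumes "\<And>c. clock_source c \<in> block k CARD('d) z \<Longrightarrow> \<omega> c = \<omega>' c"
  shows "\<omega> \<in> crossing k \<eta> z \<longleftrightarrow> \<omega>' \<in> crossing k \<eta> z"
proof -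
  have "path_sum (tau1 \<omega>) xs = path_sum (tau1 \<omega>') xs" "unconverted \<omega> xs = unconverted \<omega>' xs"
    if "xs \<in> exits k z x y" for x y xs
    using that assms by (auto intro!: path_sum_depends unconverted_depends simp: exits_def subset_iff)
  then show ?thesis unfolding crossing_def by (simp cong: bex_cong ball_cong)
qed

text \<open>An exit site lies one layer of cubes outside the block, hence the radius
  \<open>Suc CARD('d)\<close>.\<close>

definition tie :: "nat \<Rightarrow> real \<Rightarrow> int ^ 'd \<Rightarrow> ((int ^ 'd) clock \<Rightarrow> real) set" where
  "tie k \<eta> z = {\<omega>. \<exists>(xs, ys) \<in> {(xs, ys). xs \<noteq> ys \<and> xs \<noteq> [] \<and> hd xs = hd ys \<and> last xs = last ys
    \<and> xs \<in> lpaths (hd xs) (last xs) \<and> ys \<in> lpaths (hd xs) (last xs) \<and>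
     distinct xs \<and> distinct ys \<and> set xs \<subseteq> block k (Suc CARD('d)) z \<and> set ys \<subseteq> block k (Suc CARD('d)) z}.
     \<bar>path_sum (tau1 \<omega>) xs - path_sum (tau1 \<omega>) ys\<bar> \<le> \<eta>}"

text \<open>A union bound over pairs of self-avoiding lists in the block. The count is enormous but
  independent of \<eta> and \<open>z\<close>, and \<eta> is chosen last.\<close>

lemma prob_tie_le:
  fixes z :: "int ^ 'd"
  assumes "0 < k" "0 \<le> \<eta>"
  defines "m \<equiv> (k * (2 * Suc CARD('d) + 1)) ^ CARD('d)"
  shows "tie k \<eta> z \<in> events" "prob (tie k \<eta> z) \<le> real ((\<Sum>i\<le>m. m ^ i)\<^sup>2) * (2 * \<eta>)"
proof -
  define L where "L = {xs. set xs \<subseteq> block k (Suc CARD('d)) z \<and> distinct xs}"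
  define P where "P = {(xs, ys). xs \<noteq> ys \<and> xs \<noteq> [] \<and> hd xs = hd ys \<and> last xs = last ys
    \<and> xs \<in> lpaths (hd xs) (last xs) \<and> ys \<in> lpaths (hd xs) (last xs) \<and>
     distinct xs \<and> distinct ys \<and> set xs \<subseteq> block k (Suc CARD('d)) z \<and> set ys \<subseteq> block k (Suc CARD('d)) z}"
  have fL: "finite L" unfolding L_def by (rule finite_subset_distinct[OF finite_block[OF assms(1)]])
  have PL: "P \<subseteq> L \<times> L" by (auto simp: P_def L_def)
  then have fP: "finite P" using fL by (meson finite_SigmaI finite_subset)
  define T where "T p = {\<omega>\<in>space M. \<bar>path_sum (tau1 \<omega>) (fst p) - path_sum (tau1 \<omega>) (snd p)\<bar> \<le> \<eta>}" for p
  have T: "T p \<in> events" for p unfolding T_def by measurable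
  have eq: "tie k \<eta> z = (\<Union>p\<in>P. T p)"
    unfolding tie_def P_def[symmetric] T_def by (auto simp: case_prod_beta)
  show "tie k \<eta> z \<in> events" unfolding eq using fP T by (intro sets.finite_UN) auto
  have "prob (\<Union>p\<in>P. T p) \<le> (\<Sum>p\<in>P. prob (T p))"
    using fP T by (intro finite_measure_subadditive_finite) auto
  also have "\<dots> \<le> (\<Sum>p\<in>P. 2 * \<eta>)"
  proof (rule sum_mono)
    fix p assume "p \<in> P"
    then show "prob (T p) \<le> 2 * \<eta>" unfolding T_def space_M P_def
      using prob_path_tie[of "fst p" "hd (fst p)" "last (fst p)" "snd p" \<eta>] assms(2) by (auto simp: case_prod_beta)
  qed
  also have "\<dots> = card P * (2 * \<eta>)" by simp
  also have "\<dots> \<le> real ((\<Sum>i\<le>m. m ^ i)\<^sup>2) * (2 * \<eta>)"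
  proof (intro mult_right_mono of_nat_mono)
    have "card P \<le> card (L \<times> L)" using fL PL by (intro card_mono) auto
    also have "\<dots> = (card L)\<^sup>2" by (simp add: card_cartesian_product power2_eq_square)
    also have "\<dots> \<le> (\<Sum>i\<le>m. m ^ i)\<^sup>2"
      unfolding L_def m_def by (intro power_mono card_distinct_lists_le finite_block card_block_le assms) auto
    finally show "card P \<le> (\<Sum>i\<le>m. m ^ i)\<^sup>2" .
  qed (use assms in auto)
  finally show "prob (tie k \<eta> z) \<le> real ((\<Sum>i\<le>m. m ^ i)\<^sup>2) * (2 * \<eta>)" unfolding eq by simp
qed

definition mostly_fast :: "real \<Rightarrow> nat \<Rightarrow> int ^ 'd \<Rightarrow> ((int ^ 'd) clock \<Rightarrow> real) set" where
  "mostly_fast a k x = {\<omega>. \<exists>zs\<in>chains x 1 k. distinct zs \<and> k \<le> 2 * card {j. j < k \<and> tau1 \<omega> (zs ! j) (zs ! Suc j)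
    \<le> a}}"

text \<open>Each step is at most \<open>q\<^sup>2\<close> with probability at most
  \<open>q\<^sup>2\<close>, because the rate is 1. Distinct sites make the edges of a chain distinct
  and their clocks independent, so the Peierls bound applies with single edges in place of
  blocks.\<close>

lemma prob_mostly_fast_le:
  assumes "0 < k" "0 \<le> q" "q \<le> 1"
  shows "mostly_fast (q\<^sup>2) k x \<in> events" 
    and "prob (mostly_fast (q\<^sup>2) k x) \<le> (real (card {v :: int ^ 'd. l1 v \<le> 1}) * (2 * q)) ^ k"
proof -
  define L where "L = {zs\<in>chains x 1 k. distinct zs}"
  define E where "E zs j = {\<omega>\<in>space M. tau1 \<omega> (zs ! j) (zs ! Suc j) \<le> q\<^sup>2}" for zs j
  have fc: "finite (chains x 1 k)" using chains_card by blast
  have fin: "finite L" unfolding L_def using fc by simp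
  have ev: "E zs j \<in> events" for zs j unfolding E_def by measurable
  have pE: "prob (E zs j) \<le> q\<^sup>2" for zs j
  proof -
    have "E zs j = {\<omega>. \<omega> (Spread1 (zs ! j) (zs ! Suc j)) \<le> q\<^sup>2}" by (auto simp: E_def tau1_def)
    then show ?thesis
      using prob_clock_le[of "q\<^sup>2" "Spread1 (zs ! j) (zs ! Suc j)"] exp_ge_add_one_self[of "- q\<^sup>2"] by simp
  qed
  have bd: "prob (\<Inter>j\<in>J. E zs j) \<le> (q\<^sup>2) ^ card J" if zs: "zs \<in> L" and J: "J \<subseteq> {..<k}" "J \<noteq> {}" for zs J
  proof -
    have "finite J" using J(1) by (rule finite_subset) simp
    then have "prob (\<Inter>j\<in>J. E zs j) = (\<Prod>j\<in>J. prob (E zs j))"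
    proof (rule prob_INT_indep[where K = "\<lambda>j. {Spread1 (zs ! j) (zs ! Suc j)}"])
      have len: "length zs = Suc k" "distinct zs" using zs by (auto simp: L_def chains_def)
      show "disjoint_family_on (\<lambda>j. {Spread1 (zs ! j) (zs ! Suc j)}) J"
        unfolding disjoint_family_on_def
      proof (intro ballI impI)
        fix i j assume "i \<in> J" "j \<in> J" "i \<noteq> j"
        moreover from this have "i < length zs" "j < length zs" using J(1) len by auto
        ultimately have "zs ! i \<noteq> zs ! j" using len(2) by (simp add: nth_eq_iff_index_eq)
        then show "{Spread1 (zs ! i) (zs ! Suc i)} \<inter> {Spread1 (zs ! j) (zs ! Suc j)} = {}" by simp
      qed
      fix j and \<omega> \<omega>' :: "(int ^ 'd) clock \<Rightarrow> real"
      assume "\<And>c. c \<in> {Spread1 (zs ! j) (zs ! Suc j)} \<Longrightarrow> \<omega> c = \<omega>' c"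
      then have "\<omega> (Spread1 (zs ! j) (zs ! Suc j)) = \<omega>' (Spread1 (zs ! j) (zs ! Suc j))" by simp
      then show "\<omega> \<in> E zs j \<longleftrightarrow> \<omega>' \<in> E zs j" by (simp add: E_def tau1_def)
    qed (use J ev in auto)
    also have "\<dots> \<le> (\<Prod>j\<in>J. q\<^sup>2)" using pE by (intro prod_mono) auto
    finally show ?thesis by simp
  qed
  have eq: "mostly_fast (q\<^sup>2) k x = {\<omega>\<in>space M. \<exists>zs\<in>L. k \<le> 2 * card {j. j < k \<and> \<omega> \<in> E zs j}}"
    unfolding mostly_fast_def L_def E_def by auto
  show "mostly_fast (q\<^sup>2) k x \<in> events"
    unfolding eq by (rule peierls_bound(1)[OF fin ev bd assms(2,3,1)])
  have "prob (mostly_fast (q\<^sup>2) k x) \<le> card L * (2 * q) ^ k"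
    unfolding eq by (rule peierls_bound(2)[OF fin ev bd assms(2,3,1)])
  also have "\<dots> \<le> real (card {v :: int ^ 'd. l1 v \<le> 1} ^ k) * (2 * q) ^ k"
  proof (intro mult_right_mono of_nat_mono)
    have "card L \<le> card (chains x 1 k)" unfolding L_def using fc by (intro card_mono) auto
    also have "\<dots> \<le> card {v :: int ^ 'd. l1 v \<le> 1} ^ k" using chains_card by blast
    finally show "card L \<le> card {v :: int ^ 'd. l1 v \<le> 1} ^ k" .
  qed (use assms in auto)
  also have "\<dots> = (real (card {v :: int ^ 'd. l1 v \<le> 1}) * (2 * q)) ^ k" by (simp add: power_mult_distrib)
  finally show "prob (mostly_fast (q\<^sup>2) k x) \<le> (real (card {v :: int ^ 'd. l1 v \<le> 1}) * (2 * q)) ^ k" .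
qed

text \<open>
  The conversion clocks are independent of the minimiser, and each of its slow steps survives only if the
  conversion clock of its source exceeds \<open>a\<close>.
\<close>

definition slow_minimiser :: "real \<Rightarrow> nat \<Rightarrow> (int ^ 'd) list set \<Rightarrow> ((int ^ 'd) clock \<Rightarrow> real) set" where
  "slow_minimiser a k \<Gamma> = {\<omega>. \<exists>xs\<in>\<Gamma>. unconverted \<omega> xs \<and> (\<forall>ys\<in>\<Gamma>. ys \<noteq> xs
    \<longrightarrow> path_sum (tau1 \<omega>) xs < path_sum (tau1 \<omega>) ys) \<and>
     k \<le> 2 * card {j. j < k \<and> a < tau1 \<omega> (xs ! j) (xs ! Suc j)}}"

text \<open>Split by the minimiser and the set \<open>U\<close> of its slow steps. These cases are
  disjoint and decided by the \<open>Spread1\<close> clocks, so their probabilities sum to at most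
  1. In each case an unconverted minimiser needs the conversion clocks of the sources in
  \<open>U\<close> to exceed \<open>a\<close>, an independent event of probability
  \<open>exp (- a * rho) ^ card U\<close>, where \<open>card U\<close> is at least
  \<open>k / 2\<close>.\<close>

lemma prob_slow_minimiser_le:
  assumes fin: "finite \<Gamma>" and \<Gamma>: "\<And>xs. xs \<in> \<Gamma> \<Longrightarrow> distinct xs \<and> k < length xs" and a: "0 \<le> a" and k: "0 < k"
  shows "slow_minimiser a k \<Gamma> \<in> events" "prob (slow_minimiser a k \<Gamma>) \<le> exp (- a * rho / 2) ^ k"
proof -
  define I where "I = \<Gamma> \<times> {U. U \<subseteq> {..<k} \<and> k \<le> 2 * card U}"
  define A where "A p = {\<omega>\<in>space M. (\<forall>ys\<in>\<Gamma>. ys \<noteq> fst p \<longrightarrow> path_sum (tau1 \<omega>) (fst p) < path_sum (tau1 \<omega>) ys) \<and>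
     (\<forall>j\<in>{..<k}. j \<in> snd p \<longleftrightarrow> a < tau1 \<omega> (fst p ! j) (fst p ! Suc j))}" for p
  define B where "B p = {\<omega>\<in>space M. \<forall>j\<in>snd p. a < \<omega> (Conversion (fst p ! j))}" for p :: "(int ^ 'd) list \<times> nat set"
  have fI: "finite I" unfolding I_def using fin by simp
  have A: "A p \<in> events" for p unfolding A_def by measurable
  have B: "B p \<in> events" for p unfolding B_def by measurable
  show sm: "slow_minimiser a k \<Gamma> \<in> events"
  proof -
    \<comment> \<open>The cardinality condition is expanded over the finitely many possible sets of
      slow steps, which makes it a finite combination of measurable predicates.\<close>
    have "{\<omega>\<in>space M. \<exists>xs\<in>\<Gamma>. unconverted \<omega> xs \<and> (\<forall>ys\<in>\<Gamma>. ys \<noteq> xs \<longrightarrow> path_sum (tau1 \<omega>) xs < path_sum (tau1 \<omega>) ys) \<and>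
     (\<exists>U\<in>{U\<in>Pow {..<k}. k \<le> 2 * card U}. \<forall>j\<in>{..<k}. j \<in> U \<longleftrightarrow> a < tau1 \<omega> (xs ! j) (xs ! Suc j))} \<in> events"
      by (intro predE pred_intros_finite pred_intros_logic fin) measurable
    moreover have "(\<exists>U\<in>{U\<in>Pow {..<k}. k \<le> 2 * card U}. \<forall>j\<in>{..<k}. j \<in> U \<longleftrightarrow> a < tau1 \<omega> (xs ! j) (xs ! Suc j))
      \<longleftrightarrow> k \<le> 2 * card {j. j < k \<and> a < tau1 \<omega> (xs ! j) (xs ! Suc j)}" (is "?l \<longleftrightarrow> ?r") for \<omega> and xs :: "(int ^ 'd) list"
    proof
      assume ?l
      then obtain U where U: "U \<subseteq> {..<k}" "k \<le> 2 * card U" "\<forall>j\<in>{..<k}. j \<in> U \<longleftrightarrow> a < tau1 \<omega> (xs ! j) (xs ! Suc j)"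
        by auto
      then have "U = {j. j < k \<and> a < tau1 \<omega> (xs ! j) (xs ! Suc j)}" by auto
      with U(2) show ?r by simp
    next
      assume ?r
      then show ?l by (intro bexI[of _ "{j. j < k \<and> a < tau1 \<omega> (xs ! j) (xs ! Suc j)}"]) auto
    qed
    ultimately show ?thesis unfolding slow_minimiser_def space_M by simp
  qed
  have sub: "slow_minimiser a k \<Gamma> \<subseteq> (\<Union>p\<in>I. A p \<inter> B p)"
  proof
    fix \<omega> assume "\<omega> \<in> slow_minimiser a k \<Gamma>"
    then obtain xs where xs: "xs \<in> \<Gamma>" "unconverted \<omega> xs" "\<forall>ys\<in>\<Gamma>. ys \<noteq> xs
      \<longrightarrow> path_sum (tau1 \<omega>) xs < path_sum (tau1 \<omega>) ys"
      "k \<le> 2 * card {j. j < k \<and> a < tau1 \<omega> (xs ! j) (xs ! Suc j)}" by (auto simp: slow_minimiser_def)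
    define U where "U = {j. j < k \<and> a < tau1 \<omega> (xs ! j) (xs ! Suc j)}"
    have "(xs, U) \<in> I" using xs unfolding I_def U_def by auto
    moreover have "\<omega> \<in> A (xs, U)" using xs(3) by (simp add: A_def U_def)
    moreover have "\<omega> \<in> B (xs, U)"
    proof -
      have "a < \<omega> (Conversion (xs ! j))" if "j \<in> U" for j
      proof -
        have "Suc j < length xs" using that \<Gamma>[OF xs(1)] by (auto simp: U_def)
        then have "tau1 \<omega> (xs ! j) (xs ! Suc j) < \<omega> (Conversion (xs ! j))" using xs(2) by (simp add: unconverted_def)
        then show ?thesis using that by (simp add: U_def)
      qed
      then show ?thesis by (simp add: B_def)
    qed
    ultimately show "\<omega> \<in> (\<Union>p\<in>I. A p \<inter> B p)" by blast
  qed
  have pB: "prob (B p) \<le> exp (- a * rho / 2) ^ k" if p: "p \<in> I" for p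
  proof -
    obtain xs U where xs: "p = (xs, U)" "xs \<in> \<Gamma>" "U \<subseteq> {..<k}" "k \<le> 2 * card U" using p by (auto simp: I_def)
    have "U \<noteq> {}" "finite U" using xs k by (auto intro: finite_subset)
    have "B p = (\<Inter>j\<in>U. {\<omega>\<in>space M. a < \<omega> (Conversion (xs ! j))})" using \<open>U \<noteq> {}\<close> by (auto simp: B_def xs)
    also have "prob \<dots> = (\<Prod>j\<in>U. prob {\<omega>\<in>space M. a < \<omega> (Conversion (xs ! j))})"
    proof (rule prob_INT_indep[where K = "\<lambda>j. {Conversion (xs ! j)}"])
      show "disjoint_family_on (\<lambda>j. {Conversion (xs ! j)}) U"
        unfolding disjoint_family_on_def
      proof (intro ballI impI)
        fix i j assume "i \<in> U" "j \<in> U" "i \<noteq> j"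
        moreover from this have "i < length xs" "j < length xs" using xs(3) \<Gamma>[OF xs(2)] by auto
        ultimately have "xs ! i \<noteq> xs ! j" using \<Gamma>[OF xs(2)] by (simp add: nth_eq_iff_index_eq)
        then show "{Conversion (xs ! i)} \<inter> {Conversion (xs ! j)} = {}" by simp
      qed
      show "{\<omega>\<in>space M. a < \<omega> (Conversion (xs ! j))} \<in> events" for j by measurable
      fix j and \<omega> \<omega>' :: "(int ^ 'd) clock \<Rightarrow> real"
      assume "\<And>c. c \<in> {Conversion (xs ! j)} \<Longrightarrow> \<omega> c = \<omega>' c"
      then have "\<omega> (Conversion (xs ! j)) = \<omega>' (Conversion (xs ! j))" by simp
      then show "\<omega> \<in> {\<omega>\<in>space M. a < \<omega> (Conversion (xs ! j))} \<longleftrightarrow> \<omega>' \<in> {\<omega>\<in>space M. a < \<omega> (Conversion (xs ! j))}" by simp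
    qed fact+
    also have "\<dots> = exp (- a * rho) ^ card U" using prob_clock_gt[OF a] by simp
    also have "\<dots> = exp (- a * rho / 2) ^ (2 * card U)"
      by (simp add: power_mult exp_of_nat_mult[symmetric] power2_eq_square exp_add[symmetric])
    also have "\<dots> \<le> exp (- a * rho / 2) ^ k" using xs(4) a rho by (intro power_decreasing) auto
    finally show ?thesis .
  qed
  have AB: "prob (A p \<inter> B p) = prob (A p) * prob (B p)" for p
  proof -
    define K :: "bool \<Rightarrow> (int ^ 'd) clock set" where "K b
      = (if b then range (case_prod Spread1) else range Conversion)" for b
    have "prob (\<Inter>b\<in>{True, False}. if b then A p else B p) = (\<Prod>b\<in>{True, False}. prob (if b then A p else B p))"
    proof (rule prob_INT_indep[where K = K])
      show "disjoint_family_on K {True, False}" by (auto simp: disjoint_family_on_def K_def)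
      fix j and \<omega> \<omega>' :: "(int ^ 'd) clock \<Rightarrow> real" assume *: "\<And>c. c \<in> K j \<Longrightarrow> \<omega> c = \<omega>' c"
      show "\<omega> \<in> (if j then A p else B p) \<longleftrightarrow> \<omega>' \<in> (if j then A p else B p)"
      proof (cases j)
        case True
        have "Spread1 u v \<in> K j" for u v using True by (auto simp: K_def)
        then have "tau1 \<omega> = tau1 \<omega>'" using * by (auto simp: tau1_def fun_eq_iff)
        then show ?thesis using True by (simp add: A_def)
      next
        case False
        have "Conversion u \<in> K j" for u using False by (auto simp: K_def)
        then have "\<omega> (Conversion u) = \<omega>' (Conversion u)" for u using * by blast
        then show ?thesis using False by (simp add: B_def)
      qed
    qed (use A B in auto)
    then show ?thesis by (simp add: Int_commute)
  qed
  \<comment> \<open>Strict minimality makes the first component unique, and the clocks then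
    determine the second.\<close>
  have "disjoint_family_on A I"
    unfolding disjoint_family_on_def
  proof (intro ballI impI)
    fix p q assume pq: "p \<in> I" "q \<in> I" "p \<noteq> q"
    show "A p \<inter> A q = {}"
    proof (rule ccontr)
      assume "\<not> ?thesis"
      then obtain \<omega> where w: "\<omega> \<in> A p" "\<omega> \<in> A q" by blast
      have "fst p = fst q"
      proof (rule ccontr)
        assume ne: "fst p \<noteq> fst q"
        have "fst p \<in> \<Gamma>" "fst q \<in> \<Gamma>" using pq by (auto simp: I_def)
        then have "path_sum (tau1 \<omega>) (fst p) < path_sum (tau1 \<omega>) (fst q)" "path_sum (tau1 \<omega>) (fst q)
          < path_sum (tau1 \<omega>) (fst p)"
          using w ne by (auto simp: A_def)
        then show False by simp
      qed
      moreover have "snd p = snd q" using w calculation pq by (auto simp: A_def I_def)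
      ultimately show False using pq(3) by (simp add: prod_eq_iff)
    qed
  qed
  then have sumA: "(\<Sum>p\<in>I. prob (A p)) \<le> 1"
    using finite_measure_finite_Union[OF fI, of A] A prob_le_1 by (metis image_subsetI)
  have "prob (slow_minimiser a k \<Gamma>) \<le> prob (\<Union>p\<in>I. A p \<inter> B p)"
    using sub fI A B by (intro finite_measure_mono sets.finite_UN) auto
  also have "\<dots> \<le> (\<Sum>p\<in>I. prob (A p \<inter> B p))"
    using fI A B by (intro finite_measure_subadditive_finite) auto
  also have "\<dots> \<le> (\<Sum>p\<in>I. prob (A p) * exp (- a * rho / 2) ^ k)"
    unfolding AB by (intro sum_mono mult_left_mono pB) auto
  also have "\<dots> = (\<Sum>p\<in>I. prob (A p)) * exp (- a * rho / 2) ^ k" by (simp add: sum_distrib_right)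
  also have "\<dots> \<le> 1 * exp (- a * rho / 2) ^ k" by (intro mult_right_mono sumA) simp
  finally show "prob (slow_minimiser a k \<Gamma>) \<le> exp (- a * rho / 2) ^ k" by simp
qed

end

section \<open>Cutting long paths into pieces that cross a block\<close>

lemma cell_0 [simp]: "cell k 0 = 0"
  by (simp add: cell_def vec_eq_iff)

lemma l1_le_cell: assumes "0 < k" shows "l1 (x :: int ^ 'd::finite) \<le> k * (l1 (cell k x) + CARD('d))"
proof -
  have "\<bar>x $ i\<bar> \<le> int k * (\<bar>cell k x $ i\<bar> + 1)" for i
  proof -
    have "x $ i = int k * (x $ i div int k) + x $ i mod int k" by simp
    moreover have "0 \<le> x $ i mod int k" "x $ i mod int k < int k" using assms by simp_all
    moreover have "\<bar>int k * (x $ i div int k)\<bar> = int k * \<bar>x $ i div int k\<bar>" by (simp add: abs_mult)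
    ultimately have "\<bar>x $ i\<bar> \<le> int k * \<bar>x $ i div int k\<bar> + int k" by linarith
    then show ?thesis by (simp add: cell_def distrib_left)
  qed
  then have "int (l1 x) \<le> (\<Sum>i\<in>UNIV. int k * (\<bar>cell k x $ i\<bar> + 1))"
    unfolding int_l1 by (intro sum_mono)
  also have "\<dots> = int (k * (l1 (cell k x) + CARD('d)))"
    by (simp add: int_l1 sum_distrib_left[symmetric] sum.distrib)
  finally show ?thesis by linarith
qed

definition segment :: "'v list \<Rightarrow> nat \<Rightarrow> nat \<Rightarrow> 'v list" where
  "segment xs a b = take (Suc (b - a)) (drop a xs)"

lemma length_segment: "a \<le> b \<Longrightarrow> b < length xs \<Longrightarrow> length (segment xs a b) = Suc (b - a)"
  by (simp add: segment_def)

lemma nth_segment: "a \<le> b \<Longrightarrow> b < length xs \<Longrightarrow> i \<le> b - a \<Longrightarrow> segment xs a b ! i = xs ! (a + i)"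
  by (simp add: segment_def)

lemma segment_lpaths:
  assumes "xs \<in> lpaths x y" "a \<le> b" "b < length xs"
  shows "segment xs a b \<in> lpaths (xs ! a) (xs ! b)"
proof -
  note len = length_segment[OF assms(2,3)]
  have ne: "segment xs a b \<noteq> []" using len by auto
  have "hd (segment xs a b) = xs ! a" using ne assms by (simp add: hd_conv_nth nth_segment)
  moreover have "last (segment xs a b) = xs ! b" using ne assms len by (simp add: last_conv_nth nth_segment)
  moreover have "successively lattice_adj (segment xs a b)"
    using assms len by (auto simp: successively_conv_nth nth_segment lpaths_def)
  ultimately show ?thesis using ne by (simp add: lpaths_def)
qed

lemma path_sum_segment:
  assumes "a \<le> b" "b < length xs"
  shows "path_sum t (segment xs a b) = (\<Sum>i\<in>{a..<b}. t (xs ! i) (xs ! Suc i))"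
proof -
  have "path_sum t (segment xs a b) = (\<Sum>i<b - a. t (xs ! (a + i)) (xs ! Suc (a + i)))"
    unfolding path_sum_conv_nth length_segment[OF assms]
    by (intro sum.cong) (use assms in \<open>auto simp: nth_segment\<close>)
  also have "\<dots> = (\<Sum>i\<in>{a..<b}. t (xs ! i) (xs ! Suc i))"
    by (rule sum.reindex_bij_witness[of _ "\<lambda>i. i - a" "\<lambda>i. a + i"]) (use assms in auto)
  finally show ?thesis .
qed

context clocks
begin

text \<open>Outside \<open>tie\<close> any competitor differs from \<open>xs\<close> by more than
  \<eta>, so being at most \<eta> above it means being strictly below it: the near-minimiser is the
  unique minimiser. Its first \<open>k\<close> steps form a chain, and outside
  \<open>mostly_fast\<close> at least half of them are slow.\<close>

lemma crossing_subset:
  assumes "0 < k"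
  shows "crossing k \<eta> z \<subseteq> tie k \<eta> z \<union> (\<Union>x\<in>block k 0 z. mostly_fast a k x) \<union>
    (\<Union>(x, y)\<in>block k 0 z \<times> (block k (Suc CARD('d)) z - block k CARD('d) z). slow_minimiser a k (exits k z x y))"
proof
  fix \<omega> assume "\<omega> \<in> crossing k \<eta> z"
  then obtain x y xs where x: "x \<in> block k 0 z" and y: "y \<in> block k (Suc CARD('d)) z - block k CARD('d) z"
    and xs: "xs \<in> exits k z x y" "unconverted \<omega> xs"
    and min: "\<And>ys. ys \<in> exits k z x y \<Longrightarrow> path_sum (tau1 \<omega>) xs \<le> path_sum (tau1 \<omega>) ys + \<eta>"
    unfolding crossing_def by blast
  have path: "xs \<in> lpaths x y" "distinct xs" using xs by (auto simp: exits_def)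
  have len: "k < length xs" using exit_length[OF assms x _ path(1)] y by simp
  show "\<omega> \<in> tie k \<eta> z \<union> (\<Union>x\<in>block k 0 z. mostly_fast a k x) \<union>
    (\<Union>(x, y)\<in>block k 0 z \<times> (block k (Suc CARD('d)) z - block k CARD('d) z). slow_minimiser a k (exits k z x y))"
  proof (rule ccontr)
    assume "\<not> ?thesis"
    then have n1: "\<omega> \<notin> tie k \<eta> z" and n2: "\<omega> \<notin> mostly_fast a k x" and n3: "\<omega> \<notin> slow_minimiser a k (exits k z x y)"
      using x y by auto
    have strict: "path_sum (tau1 \<omega>) xs < path_sum (tau1 \<omega>) ys" if ys: "ys \<in> exits k z x y" "ys \<noteq> xs" for ys
    proof -
      have sub: "set xs \<subseteq> block k (Suc CARD('d)) z" "set ys \<subseteq> block k (Suc CARD('d)) z"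
        using exits_subset[of y k z x] y xs(1) ys(1) by auto
      have ys': "ys \<in> lpaths x y" "distinct ys" using ys by (auto simp: exits_def)
      have "\<not> \<bar>path_sum (tau1 \<omega>) xs - path_sum (tau1 \<omega>) ys\<bar> \<le> \<eta>"
      proof
        assume t: "\<bar>path_sum (tau1 \<omega>) xs - path_sum (tau1 \<omega>) ys\<bar> \<le> \<eta>"
        have "\<omega> \<in> tie k \<eta> z" unfolding tie_def mem_Collect_eq
          by (rule bexI[of _ "(xs, ys)"]) (use t ys ys' path sub in \<open>auto simp: lpaths_def\<close>)
        with n1 show False ..
      qed
      then show ?thesis using min[OF ys(1)] by linarith
    qed
    have zs: "take (Suc k) xs \<in> chains x 1 k"
      using path(1) len
        by (auto simp: chains_def lpaths_def hd_conv_nth successively_conv_nth lattice_adj_iff l1_commute)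
    have nth: "take (Suc k) xs ! j = xs ! j" "take (Suc k) xs ! Suc j = xs ! Suc j" if "j < k" for j using that
      by simp_all
    have "\<not> k \<le> 2 * card {j. j < k \<and> tau1 \<omega> (take (Suc k) xs ! j) (take (Suc k) xs ! Suc j) \<le> a}"
      using n2 zs path(2) unfolding mostly_fast_def by auto
    moreover have "{j. j < k \<and> tau1 \<omega> (take (Suc k) xs ! j) (take (Suc k) xs ! Suc j) \<le> a} = {j. j < k
      \<and> tau1 \<omega> (xs ! j) (xs ! Suc j) \<le> a}"
      using nth by auto
    ultimately have few: "2 * card {j. j < k \<and> tau1 \<omega> (xs ! j) (xs ! Suc j) \<le> a} < k" by simp
    have split: "{..<k} = {j. j < k \<and> tau1 \<omega> (xs ! j) (xs ! Suc j) \<le> a} \<union> {j. j < k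
      \<and> a < tau1 \<omega> (xs ! j) (xs ! Suc j)}" by auto
    have "card {..<k} \<le> card {j. j < k \<and> tau1 \<omega> (xs ! j) (xs ! Suc j) \<le> a} + card {j. j < k
      \<and> a < tau1 \<omega> (xs ! j) (xs ! Suc j)}"
      unfolding split by (rule card_Un_le)
    with few have "k \<le> 2 * card {j. j < k \<and> a < tau1 \<omega> (xs ! j) (xs ! Suc j)}" by simp
    then have "\<omega> \<in> slow_minimiser a k (exits k z x y)" unfolding slow_minimiser_def using xs strict by blast
    with n3 show False ..
  qed
qed

lemma prob_crossing_le:
  fixes z :: "int ^ 'd"
  assumes k: "0 < k" and \<eta>: "0 \<le> \<eta>" and q: "0 \<le> q" "q \<le> 1"
  defines "m \<equiv> (k * (2 * Suc CARD('d) + 1)) ^ CARD('d)"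
  shows "prob (crossing k \<eta> z) \<le> real ((\<Sum>i\<le>m. m ^ i)\<^sup>2) * (2 * \<eta>)
    + real m * (real (card {v :: int ^ 'd. l1 v \<le> 1}) * (2 * q)) ^ k + real m * real m * exp (- q\<^sup>2 * rho / 2) ^ k"
proof -
  let ?B = "block k 0 z" and ?B' = "block k (Suc CARD('d)) z - block k CARD('d) z"
  have fB: "finite ?B" "finite ?B'" using finite_block[OF k] by auto
  have "card ?B \<le> card (block k (Suc CARD('d)) z)"
    by (intro card_mono finite_block k) (auto simp: block_def)
  then have cB: "card ?B \<le> m" "card ?B' \<le> m"
    using card_block_le[OF k, of "Suc CARD('d)" z] card_mono[OF finite_block[OF k, of "Suc CARD('d)" z], of ?B']
      unfolding m_def by auto
  have ex: "finite (exits k z x y)" "\<And>xs. xs \<in> exits k z x y \<Longrightarrow> distinct xs \<and> k < length xs"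
    if "x \<in> ?B" "y \<in> ?B'" for x y
    using finite_exits[OF k, of y z x] exit_length[OF k that(1), of y] that(2) by (auto simp: exits_def)
  have mf: "mostly_fast (q\<^sup>2) k x \<in> events" for x by (rule prob_mostly_fast_le(1)[OF k q])
  have sl: "slow_minimiser (q\<^sup>2) k (exits k z x y) \<in> events" if "x \<in> ?B" "y \<in> ?B'" for x y
    by (rule prob_slow_minimiser_le(1)[OF ex[OF that] _ k]) auto
  have te: "tie k \<eta> z \<in> events" by (rule prob_tie_le(1)[OF k \<eta>])
  let ?U1 = "\<Union>x\<in>?B. mostly_fast (q\<^sup>2) k x"
  let ?U2 = "\<Union>(x, y)\<in>?B \<times> ?B'. slow_minimiser (q\<^sup>2) k (exits k z x y)"
  have U: "?U1 \<in> events" "?U2 \<in> events" using fB mf sl by (auto intro!: sets.finite_UN)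
  have "prob (crossing k \<eta> z) \<le> prob (tie k \<eta> z \<union> ?U1 \<union> ?U2)"
    using te U by (intro finite_measure_mono crossing_subset k) auto
  also have "\<dots> \<le> prob (tie k \<eta> z) + prob ?U1 + prob ?U2"
    using te U by (meson add_mono_thms_linordered_semiring(3) measure_Un_le order_trans sets.Un)
  also have "\<dots> \<le> real ((\<Sum>i\<le>m. m ^ i)\<^sup>2) * (2 * \<eta>) + real m * (real (card {v :: int ^ 'd. l1 v \<le> 1}) * (2 * q)) ^ k
     + real m * real m * exp (- q\<^sup>2 * rho / 2) ^ k"
  proof (intro add_mono)
    show "prob (tie k \<eta> z) \<le> real ((\<Sum>i\<le>m. m ^ i)\<^sup>2) * (2 * \<eta>)"
      unfolding m_def by (rule prob_tie_le(2)[OF k \<eta>])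
    have "prob ?U1 \<le> (\<Sum>x\<in>?B. prob (mostly_fast (q\<^sup>2) k x))"
      using fB mf by (intro finite_measure_subadditive_finite) auto
    also have "\<dots> \<le> (\<Sum>x\<in>?B. (real (card {v :: int ^ 'd. l1 v \<le> 1}) * (2 * q)) ^ k)"
      by (intro sum_mono prob_mostly_fast_le(2) k q)
    also have "\<dots> \<le> real m * (real (card {v :: int ^ 'd. l1 v \<le> 1}) * (2 * q)) ^ k"
      using cB q by (simp add: mult_right_mono)
    finally show "prob ?U1 \<le> real m * (real (card {v :: int ^ 'd. l1 v \<le> 1}) * (2 * q)) ^ k" .
    have "prob ?U2 \<le> (\<Sum>p\<in>?B \<times> ?B'. prob (case p of (x, y) \<Rightarrow> slow_minimiser (q\<^sup>2) k (exits k z x y)))"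
      using fB sl by (intro finite_measure_subadditive_finite) auto
    also have "\<dots> \<le> (\<Sum>p\<in>?B \<times> ?B'. exp (- q\<^sup>2 * rho / 2) ^ k)"
    proof (rule sum_mono)
      fix p assume "p \<in> ?B \<times> ?B'"
      then obtain x y where p: "p = (x, y)" "x \<in> ?B" "y \<in> ?B'" by auto
      show "prob (case p of (x, y) \<Rightarrow> slow_minimiser (q\<^sup>2) k (exits k z x y)) \<le> exp (- q\<^sup>2 * rho / 2) ^ k"
        unfolding p(1) prod.case by (rule prob_slow_minimiser_le(2)[OF ex[OF p(2,3)] _ k]) auto
    qed
    also have "\<dots> = (real (card ?B) * real (card ?B')) * exp (- q\<^sup>2 * rho / 2) ^ k"
      by (simp add: card_cartesian_product)
    also have "\<dots> \<le> real m * real m * exp (- q\<^sup>2 * rho / 2) ^ k"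
      using cB by (intro mult_right_mono mult_mono) auto
    finally show "prob ?U2 \<le> real m * real m * exp (- q\<^sup>2 * rho / 2) ^ k" .
  qed
  finally show ?thesis .
qed

text \<open>The order of choice: \<open>q\<close> makes \<open>?C * (2 * q)\<close> equal to 1/2;
  \<open>k\<close> lets the exponential factors beat the polynomial number of starting and exit
  sites; \<eta> then beats the number \<open>F\<close> of pairs of paths for this
  \<open>k\<close>.\<close>

lemma crossing_small:
  assumes "0 < \<epsilon>"
  shows "\<exists>k>0. \<exists>\<eta>>0. \<forall>z. prob (crossing k \<eta> z) \<le> \<epsilon>"
proof -
  let ?c = "real (2 * Suc CARD('d) + 1)" and ?C = "card {v :: int ^ 'd. l1 v \<le> 1}"
  have C: "0 < ?C" using finite_l1_ball[of "0 :: int ^ 'd" 1] by (auto simp: card_gt_0_iff intro: exI[of _ 0])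
  define q :: real where "q = 1 / (4 * ?C)"
  have q: "0 < q" "q \<le> 1" "?C * (2 * q) = 1/2" using C by (auto simp: q_def)
  have "(\<lambda>k. (real k * ?c) ^ CARD('d) * (1/2) ^ k) \<longlonglongrightarrow> 0"
    by (intro poly_times_geometric_tendsto_0) auto
  moreover have "(\<lambda>k. (real k * ?c) ^ (2 * CARD('d)) * exp (- q\<^sup>2 * rho / 2) ^ k) \<longlonglongrightarrow> 0"
    using q rho by (intro poly_times_geometric_tendsto_0) auto
  ultimately have "(\<lambda>k. (real k * ?c) ^ CARD('d) * (1/2) ^ k
    + (real k * ?c) ^ (2 * CARD('d)) * exp (- q\<^sup>2 * rho / 2) ^ k) \<longlonglongrightarrow> 0 + 0"
    by (rule tendsto_add)
  then have "eventually (\<lambda>k. (real k * ?c) ^ CARD('d) * (1/2) ^ k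
    + (real k * ?c) ^ (2 * CARD('d)) * exp (- q\<^sup>2 * rho / 2) ^ k < \<epsilon> / 2) sequentially"
    using assms by (intro order_tendstoD(2)) auto
  then have "eventually (\<lambda>k. 0 < k \<and> (real k * ?c) ^ CARD('d) * (1/2) ^ k
    + (real k * ?c) ^ (2 * CARD('d)) * exp (- q\<^sup>2 * rho / 2) ^ k < \<epsilon> / 2) sequentially"
    using eventually_gt_at_top[of 0] by eventually_elim simp
  from eventually_happens'[OF sequentially_bot this] obtain k
    where k: "0 < k" "(real k * ?c) ^ CARD('d) * (1/2) ^ k
      + (real k * ?c) ^ (2 * CARD('d)) * exp (- q\<^sup>2 * rho / 2) ^ k < \<epsilon> / 2"
    by (elim exE conjE)
  define m where "m = (k * (2 * Suc CARD('d) + 1)) ^ CARD('d)"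
  have m: "real m = (real k * ?c) ^ CARD('d)" unfolding m_def by (simp only: of_nat_power of_nat_mult)
  have mm: "real m * real m = (real k * ?c) ^ (2 * CARD('d))" unfolding m by (simp only: mult_2 power_add)
  define F where "F = real ((\<Sum>i\<le>m. m ^ i)\<^sup>2)"
  have F: "0 \<le> F" unfolding F_def by (rule of_nat_0_le_iff)
  define \<eta> where "\<eta> = \<epsilon> / (4 * (F + 1))"
  have \<eta>: "0 < \<eta>" using F assms by (simp add: \<eta>_def)
  have "F * (2 * \<eta>) \<le> (F + 1) * (2 * \<eta>)" using \<eta> by (intro mult_right_mono) auto
  also have "\<dots> = \<epsilon> / 2" using F by (simp add: \<eta>_def field_simps)
  finally have F\<eta>: "F * (2 * \<eta>) \<le> \<epsilon> / 2" .
  have "prob (crossing k \<eta> z) \<le> \<epsilon>" for z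
  proof -
    have "prob (crossing k \<eta> z) \<le> F * (2 * \<eta>) + real m * (?C * (2 * q)) ^ k
      + real m * real m * exp (- q\<^sup>2 * rho / 2) ^ k"
      unfolding F_def m_def using \<eta> q by (intro prob_crossing_le k) auto
    also have "\<dots> \<le> \<epsilon>" using F\<eta> k(2) unfolding mm q(3) unfolding m by linarith
    finally show ?thesis .
  qed
  with k(1) \<eta> show ?thesis by blast
qed

text \<open>
  The excess of a path over the passage time is superadditive over consecutive pieces, so an excess that
  is small compared with the number of visited blocks is tiny in most of them.
\<close>

lemma near_geodesic_crossings:
  fixes xs :: "(int ^ 'd) list"
  assumes k: "0 < k" and N: "0 < N" and \<eta>: "0 < \<eta>"
    and x: "l1 x = k * (N * (2 * CARD('d) + 2) + CARD('d))"
    and xs: "xs \<in> lpaths 0 x" "distinct xs" "unconverted \<omega> xs"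
    and short: "path_sum (tau1 \<omega>) xs \<le> fpp (tau1 \<omega>) 0 x + \<eta> / (4 * real k * (3 * real CARD('d) + 2)) * real (l1 x)"
  shows "\<exists>zs\<in>chains 0 (2 * CARD('d) + 2) N. separated (2 * CARD('d) + 1) N zs \<and>
    N \<le> 2 * card {j. j < N \<and> \<omega> \<in> crossing k \<eta> (zs ! j)}"
proof -
  let ?d = "CARD('d)"
  define n where "n = length xs - 1"
  have ne: "xs \<noteq> []" using xs(1) by (simp add: lpaths_def)
  have len: "length xs = Suc n" using ne by (simp add: n_def)
  have ends: "xs ! 0 = 0" "xs ! n = x" using xs(1) ne by (auto simp: lpaths_def hd_conv_nth last_conv_nth n_def)
  define v where "v i = cell k (xs ! i)" for i
  have step: "l1 (xs ! Suc i - xs ! i) = 1" if "i < n" for i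
    using xs(1) that len by (auto simp: lpaths_def successively_conv_nth lattice_adj_iff l1_commute)
  have vstep: "l1 (v (Suc i) - v i) \<le> 1" if "i < n" for i
    using l1_cell_diff_le[OF k, of "xs ! Suc i" "xs ! i"] step[OF that] by (simp add: v_def)
  \<comment> \<open>The norm of \<open>x\<close> is chosen so that, after the loss of
    \<open>?d\<close> in passing to cube indices, the coarse path still has room for
    \<open>N\<close> jumps of \<open>2 * ?d + 2\<close>.\<close>
  have "k * (N * (2 * ?d + 2) + ?d) \<le> k * (l1 (cell k x) + ?d)" using l1_le_cell[OF k, of x] x by simp
  then have "N * (2 * ?d + 2) \<le> l1 (cell k x)" using k by simp
  then have far: "N * ((2 * ?d + 1) + 1) \<le> l1 (v n - v 0)" by (simp add: v_def ends)
  \<comment> \<open>Separation \<open>2 * ?d + 1\<close> of the centres makes the blocks of radius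
    \<open>?d\<close> around them disjoint.\<close>
  from last_exit_chain[of n v 1 "2 * ?d + 1", OF vstep _ _ far] obtain f where f: "f 0 = 0" "\<And>j. j \<le> N \<Longrightarrow> f j \<le> n"
    "\<And>j. j < N \<Longrightarrow> f j < f (Suc j)" "\<And>j. j < N \<Longrightarrow> l1 (v (f (Suc j)) - v (f j)) \<le> 2 * ?d + 2"
    "\<And>j i. j < N \<Longrightarrow> f (Suc j) \<le> i \<Longrightarrow> i \<le> n \<Longrightarrow> 2 * ?d + 1 \<le> l1 (v i - v (f j))"
    by auto
  \<comment> \<open>First exit from the block around the \<open>j\<close>-th centre. It comes no
    later than the next centre, so the pieces from \<open>f j\<close> to \<open>g j\<close> do not
    overlap.\<close>
  define g where "g j = (LEAST i. f j \<le> i \<and> xs ! i \<notin> block k ?d (v (f j)))" for j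
  have g: "f j \<le> g j" "xs ! g j \<notin> block k ?d (v (f j))" "g j \<le> f (Suc j)"
    "\<And>i. f j \<le> i \<Longrightarrow> i < g j \<Longrightarrow> xs ! i \<in> block k ?d (v (f j))" if "j < N" for j
  proof -
    have ex: "f j \<le> f (Suc j) \<and> xs ! f (Suc j) \<notin> block k ?d (v (f j))"
      using f(3)[OF that] f(5)[OF that, of "f (Suc j)"] f(2)[of "Suc j"] that by (auto simp: block_def v_def)
    from LeastI[of "\<lambda>i. f j \<le> i \<and> xs ! i \<notin> block k ?d (v (f j))", OF ex] show "f j
      \<le> g j" "xs ! g j \<notin> block k ?d (v (f j))"
      by (auto simp: g_def)
    from Least_le[of "\<lambda>i. f j \<le> i \<and> xs ! i \<notin> block k ?d (v (f j))", OF ex] show "g j \<le> f (Suc j)" by (simp add: g_def)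
    fix i assume "f j \<le> i" "i < g j"
    then show "xs ! i \<in> block k ?d (v (f j))"
      using not_less_Least[of i "\<lambda>i. f j \<le> i \<and> xs ! i \<notin> block k ?d (v (f j))"] by (auto simp: g_def)
  qed
  have gn: "g j \<le> n" if "j < N" for j using g(3)[OF that] f(2)[of "Suc j"] that by simp
  define S where "S a b = (\<Sum>i\<in>{a..<b}. tau1 \<omega> (xs ! i) (xs ! Suc i))" for a b
  define sl where "sl a b = S a b - fpp (tau1 \<omega>) (xs ! a) (xs ! b)" for a b
  have S_seg: "path_sum (tau1 \<omega>) (segment xs a b) = S a b" if "a \<le> b" "b \<le> n" for a b
    using that len unfolding S_def by (intro path_sum_segment) auto
  have sl_nonneg: "0 \<le> sl a b" if "a \<le> b" "b \<le> n" for a b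
    using fpp_le[of "tau1 \<omega>", OF _ segment_lpaths[OF xs(1) that(1)]] S_seg[OF that] that len by (simp add: sl_def)
  have sl_split: "sl a b + sl b c \<le> sl a c" if "a \<le> b" "b \<le> c" for a b c
  proof -
    have "S a c = S a b + S b c" unfolding S_def using that by (simp add: sum.atLeastLessThan_concat)
    then show ?thesis using fpp_triangle[of "tau1 \<omega>" "xs ! a" "xs ! c" "xs ! b"] by (simp add: sl_def)
  qed
  have slack: "(\<Sum>j<J. sl (f j) (g j)) + sl (f J) n \<le> sl 0 n" if "J \<le> N" for J
    using that
  proof (induction J)
    case 0 then show ?case using f(1) by simp
  next
    case (Suc J)
    then have J: "J < N" by simp
    have "sl (f J) (g J) + sl (g J) n \<le> sl (f J) n" using g(1)[OF J] gn[OF J] by (intro sl_split)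
    moreover have "sl (g J) (f (Suc J)) + sl (f (Suc J)) n \<le> sl (g J) n" using g(3)[OF J] f(2)[OF Suc.prems]
      by (intro sl_split)
    moreover have "0 \<le> sl (g J) (f (Suc J))" using g(3)[OF J] f(2)[OF Suc.prems] by (intro sl_nonneg)
    moreover have "(\<Sum>j<J. sl (f j) (g j)) + sl (f J) n \<le> sl 0 n" using J by (intro Suc.IH) simp
    ultimately show ?case by simp
  qed
  \<comment> \<open>As \<open>N\<close> is at least 1, the norm of \<open>x\<close> is at most
    \<open>k * (N * (3 * ?d + 2))\<close>; this is the origin of the constant in
    \<open>short\<close>.\<close>
  have total: "sl 0 n \<le> \<eta> * N / 4"
  proof -
    let ?D = "3 * real ?d + 2"
    have "path_sum (tau1 \<omega>) xs = S 0 n" unfolding S_def path_sum_conv_nth n_def by (simp add: atLeast0LessThan)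
    then have "sl 0 n \<le> \<eta> / (4 * real k * ?D) * real (l1 x)" using short by (simp add: sl_def ends)
    also have "\<dots> \<le> \<eta> / (4 * real k * ?D) * (real k * (real N * ?D))"
    proof (intro mult_left_mono)
      have "N * (2 * ?d + 2) + ?d \<le> N * (3 * ?d + 2)" using N by (simp add: algebra_simps)
      then have "l1 x \<le> k * (N * (3 * ?d + 2))" unfolding x by (intro mult_left_mono) auto
      then have "real (l1 x) \<le> real (k * (N * (3 * ?d + 2)))" by (rule of_nat_mono)
      then show "real (l1 x) \<le> real k * (real N * ?D)" by (simp only: of_nat_mult of_nat_add of_nat_numeral)
    qed (use \<eta> in auto)
    also have "\<dots> = \<eta> * N / 4"
    proof -
      have "\<eta> / (4 * real k * D) * (real k * (real N * D)) = \<eta> * N / 4" if "0 < D" for D :: real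
        using that k by (simp add: field_simps)
      moreover have "0 < ?D" by (simp add: add_nonneg_pos)
      ultimately show ?thesis by blast
    qed
    finally show ?thesis .
  qed
  have cross: "\<omega> \<in> crossing k \<eta> (v (f j))" if j: "j < N" and s: "sl (f j) (g j) \<le> \<eta>" for j
  proof -
    have fj: "xs ! f j \<in> block k 0 (v (f j))" by (simp add: block_def v_def)
    then have "xs ! f j \<in> block k ?d (v (f j))" by (simp add: block_def)
    then have lt: "f j < g j" using g(1,2)[OF j] by (metis le_neq_implies_less)
    have out: "xs ! g j \<in> block k (Suc ?d) (v (f j))"
    proof -
      have "xs ! (g j - 1) \<in> block k ?d (v (f j))" using lt by (intro g(4)[OF j]) auto
      moreover have "l1 (v (g j) - v (g j - 1)) \<le> 1" using vstep[of "g j - 1"] lt gn[OF j] by simp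
      ultimately show ?thesis using l1_triangle[of "v (g j)" "v (f j)" "v (g j - 1)"] by (simp add: block_def v_def)
    qed
    have le: "f j \<le> g j" and gl: "g j < length xs" using lt gn[OF j] len by auto
    let ?s = "segment xs (f j) (g j)"
    note ls = length_segment[OF le gl]
    have "set (butlast ?s) \<subseteq> block k ?d (v (f j))"
    proof
      fix u assume "u \<in> set (butlast ?s)"
      then obtain i where i: "i < g j - f j" "u = butlast ?s ! i" using ls by (auto simp: in_set_conv_nth)
      then have "u = xs ! (f j + i)" using ls le gl by (simp add: nth_butlast nth_segment)
      then show "u \<in> block k ?d (v (f j))" using i by (auto intro!: g(4)[OF j])
    qed
    moreover have "distinct ?s" unfolding segment_def using xs(2) by simp
    moreover have sp: "?s \<in> lpaths (xs ! f j) (xs ! g j)" by (rule segment_lpaths[OF xs(1) le gl])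
    ultimately have "?s \<in> exits k (v (f j)) (xs ! f j) (xs ! g j)" by (simp add: exits_def)
    moreover have "unconverted \<omega> ?s" unfolding unconverted_def
    proof (intro allI impI)
      fix i assume "Suc i < length ?s"
      then have i: "i < g j - f j" using ls by simp
      then have "?s ! i = xs ! (f j + i)" "?s ! Suc i = xs ! Suc (f j + i)" using le gl by (simp_all add: nth_segment)
      moreover have "Suc (f j + i) < length xs" using i gl by simp
      ultimately show "tau1 \<omega> (?s ! i) (?s ! Suc i) < \<omega> (Conversion (?s ! i))" using xs(3)
        by (simp add: unconverted_def)
    qed
    \<comment> \<open>Competitors are confined to the block, while the excess is measured against
      the unrestricted passage time, which is at most theirs.\<close>
    moreover have "path_sum (tau1 \<omega>) ?s \<le> path_sum (tau1 \<omega>) ys + \<eta>"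
      if "ys \<in> exits k (v (f j)) (xs ! f j) (xs ! g j)" for ys
    proof -
      have "fpp (tau1 \<omega>) (xs ! f j) (xs ! g j) \<le> path_sum (tau1 \<omega>) ys" using that
        by (intro fpp_le) (auto simp: exits_def)
      then show ?thesis using s S_seg[OF le gn[OF j]] by (simp add: sl_def)
    qed
    ultimately show ?thesis unfolding crossing_def using fj out g(2)[OF j] by blast
  qed
  \<comment> \<open>By \<open>total\<close> at most a quarter of the pieces have an excess above
    \<eta>; three quarters remain, more than the half that the Peierls bound asks for.\<close>
  define bad where "bad = {j. j < N \<and> \<eta> < sl (f j) (g j)}"
  have fb: "finite bad" "bad \<subseteq> {..<N}" by (auto simp: bad_def)
  have "real (card bad) * \<eta> = (\<Sum>j\<in>bad. \<eta>)" by simp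
  also have "\<dots> \<le> (\<Sum>j\<in>bad. sl (f j) (g j))" by (intro sum_mono) (auto simp: bad_def)
  also have "\<dots> \<le> (\<Sum>j<N. sl (f j) (g j))" using fb g gn by (intro sum_mono2) (auto intro!: sl_nonneg)
  also have "\<dots> \<le> sl 0 n" using slack[of N] sl_nonneg[of "f N" n] f(2)[of N] by simp
  also have "\<dots> \<le> (N / 4) * \<eta>" using total by (simp add: mult.commute)
  finally have "real (card bad) \<le> N / 4" using \<eta> by simp
  then have cb: "4 * card bad \<le> N" by linarith
  define zs where "zs = map (\<lambda>j. v (f j)) [0..<Suc N]"
  have nth: "zs ! j = v (f j)" if "j \<le> N" for j using that unfolding zs_def
    by (subst nth_map) (auto simp del: upt_Suc)
  have mono: "f i \<le> f j" if "i \<le> j" "j \<le> N" for i j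
    using that
  proof (induction j rule: dec_induct)
    case (step n')
    then have "f n' < f (Suc n')" using f(3)[of n'] by simp
    with step show ?case by simp
  qed simp
  have "{..<N} \<subseteq> bad \<union> {j. j < N \<and> \<omega> \<in> crossing k \<eta> (zs ! j)}"
  proof
    fix j assume "j \<in> {..<N}"
    then show "j \<in> bad \<union> {j. j < N \<and> \<omega> \<in> crossing k \<eta> (zs ! j)}"
      using cross[of j] nth[of j] by (cases "sl (f j) (g j) \<le> \<eta>") (auto simp: bad_def)
  qed
  then have "N \<le> card (bad \<union> {j. j < N \<and> \<omega> \<in> crossing k \<eta> (zs ! j)})"
    using fb(1) card_mono[of "bad \<union> {j. j < N \<and> \<omega> \<in> crossing k \<eta> (zs ! j)}" "{..<N}"] by simp
  also have "\<dots> \<le> card bad + card {j. j < N \<and> \<omega> \<in> crossing k \<eta> (zs ! j)}" by (rule card_Un_le)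
  finally have many: "N \<le> 2 * card {j. j < N \<and> \<omega> \<in> crossing k \<eta> (zs ! j)}" using cb by simp
  have "zs \<in> chains 0 (2 * ?d + 2) N"
    unfolding chains_def using f(1,4) by (auto simp: nth v_def ends) (simp add: zs_def)
  moreover have "separated (2 * ?d + 1) N zs" unfolding separated_def
  proof (intro allI impI)
    fix i j assume ij: "i < j \<and> j < N"
    then have "f (Suc i) \<le> f j" by (intro mono) auto
    then have "2 * ?d + 1 \<le> l1 (v (f j) - v (f i))" using f(2)[of j] f(5)[of i "f j"] ij by auto
    then show "2 * ?d + 1 \<le> l1 (zs ! i - zs ! j)" using ij by (simp add: nth l1_commute)
  qed
  ultimately show ?thesis using many by blast
qed

text \<open>Both \<epsilon> and \<open>k\<close> are fixed before the radius, so the excess of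
  unconverted paths is linear, while the exceptional event \<open>A\<close> shrinks geometrically in
  \<open>N\<close>. Blocks around separated centres read disjoint sets of clocks, which gives the
  product bound for the Peierls argument.\<close>

lemma unconverted_paths_slow:
  "\<exists>\<epsilon>>0. \<exists>k>0. \<forall>N>0. \<exists>A\<in>events. prob A \<le> (1/2) ^ N \<and>
    (\<forall>\<omega>. \<omega> \<notin> A \<longrightarrow> (\<forall>x xs. l1 x = k * (N * (2 * CARD('d) + 2) + CARD('d)) \<longrightarrow> xs \<in> lpaths 0 x \<longrightarrow> distinct xs
      \<longrightarrow> unconverted \<omega> xs \<longrightarrow>
      fpp (tau1 \<omega>) 0 x + \<epsilon> * real (l1 x) < path_sum (tau1 \<omega>) xs))"
proof -
  let ?d = "CARD('d)"
  define C where "C = card {v :: int ^ 'd. l1 v \<le> 2 * ?d + 2}"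
  have C: "0 < C" unfolding C_def using finite_l1_ball[of "0 :: int ^ 'd" "2 * ?d + 2"]
    by (auto simp: card_gt_0_iff intro: exI[of _ 0])
  define q :: real where "q = 1 / (4 * C)"
  have q: "0 < q" "q \<le> 1" using C by (auto simp: q_def)
  have "0 < q\<^sup>2" using q by simp
  from crossing_small[OF this] obtain k \<eta> where k: "0 < k" and \<eta>: "0 < \<eta>" and cr: "\<And>z. prob (crossing k \<eta> z) \<le> q\<^sup>2"
    by blast
  \<comment> \<open>The excess per unit of distance that \<open>near_geodesic_crossings\<close>
    tolerates.\<close>
  define \<epsilon> where "\<epsilon> = \<eta> / (4 * real k * (3 * real ?d + 2))"
  have \<epsilon>: "0 < \<epsilon>" unfolding \<epsilon>_def using \<eta> k by (intro divide_pos_pos mult_pos_pos) (auto intro: add_nonneg_pos)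
  have "\<exists>A\<in>events. prob A \<le> (1/2) ^ N \<and>
    (\<forall>\<omega>. \<omega> \<notin> A \<longrightarrow> (\<forall>x xs. l1 x = k * (N * (2 * ?d + 2) + ?d) \<longrightarrow> xs \<in> lpaths 0 x \<longrightarrow> distinct xs \<longrightarrow> unconverted \<omega> xs \<longrightarrow>
      fpp (tau1 \<omega>) 0 x + \<epsilon> * real (l1 x) < path_sum (tau1 \<omega>) xs))" if N: "0 < N" for N
  proof -
    define L where "L = {zs\<in>chains (0 :: int ^ 'd) (2 * ?d + 2) N. separated (2 * ?d + 1) N zs}"
    define A where "A = {\<omega>\<in>space M. \<exists>zs\<in>L. N \<le> 2 * card {j. j < N \<and> \<omega> \<in> crossing k \<eta> (zs ! j)}}"
    have fc: "finite (chains (0 :: int ^ 'd) (2 * ?d + 2) N)" using chains_card by blast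
    have fL: "finite L" unfolding L_def using fc by simp
    have bd: "prob (\<Inter>j\<in>J. crossing k \<eta> (zs ! j)) \<le> (q\<^sup>2) ^ card J" if zs: "zs \<in> L" and J: "J
      \<subseteq> {..<N}" "J \<noteq> {}" for zs J
    proof -
      have "finite J" using J(1) by (rule finite_subset) simp
      then have "prob (\<Inter>j\<in>J. crossing k \<eta> (zs ! j)) = (\<Prod>j\<in>J. prob (crossing k \<eta> (zs ! j)))"
      proof (rule prob_INT_indep[where K = "\<lambda>j. {c. clock_source c \<in> block k ?d (zs ! j)}"])
        show "disjoint_family_on (\<lambda>j. {c. clock_source c \<in> block k ?d (zs ! j)}) J"
          unfolding disjoint_family_on_def
        proof (intro ballI impI)
          fix i j assume ij: "i \<in> J" "j \<in> J" "i \<noteq> j"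
          have sep: "2 * ?d + 1 \<le> l1 (zs ! i - zs ! j)"
          proof (cases "i < j")
            case True then show ?thesis using zs ij J(1) by (auto simp: L_def separated_def)
          next
            case False
            then have "2 * ?d + 1 \<le> l1 (zs ! j - zs ! i)" using zs ij J(1) by (auto simp: L_def separated_def)
            then show ?thesis by (simp add: l1_commute)
          qed
          show "{c. clock_source c \<in> block k ?d (zs ! i)} \<inter> {c. clock_source c \<in> block k ?d (zs ! j)} = {}"
          proof (rule ccontr)
            assume "\<not> ?thesis"
            then obtain u where "u \<in> block k ?d (zs ! i)" "u \<in> block k ?d (zs ! j)" by auto
            then show False using l1_triangle[of "zs ! i" "zs ! j" "cell k u"] sep l1_commute[of "zs ! i" "cell k u"]
              by (simp add: block_def)
          qed
        qed
        fix j and \<omega> \<omega>' :: "(int ^ 'd) clock \<Rightarrow> real"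
        assume "\<And>c. c \<in> {c. clock_source c \<in> block k ?d (zs ! j)} \<Longrightarrow> \<omega> c = \<omega>' c"
        then show "\<omega> \<in> crossing k \<eta> (zs ! j) \<longleftrightarrow> \<omega>' \<in> crossing k \<eta> (zs ! j)" by (intro crossing_depends) simp
      qed (use J in auto)
      also have "\<dots> \<le> (\<Prod>j\<in>J. q\<^sup>2)" using cr by (intro prod_mono) auto
      finally show ?thesis by simp
    qed
    note pe = peierls_bound[OF fL crossing_measurable bd less_imp_le[OF q(1)] q(2) N]
    have A: "A \<in> events" unfolding A_def by (rule pe(1))
    have "prob A \<le> card L * (2 * q) ^ N" unfolding A_def by (rule pe(2))
    also have "\<dots> \<le> real (C ^ N) * (2 * q) ^ N"
    proof (intro mult_right_mono of_nat_mono)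
      have "card L \<le> card (chains (0 :: int ^ 'd) (2 * ?d + 2) N)" unfolding L_def using fc by (intro card_mono) auto
      also have "\<dots> \<le> C ^ N" unfolding C_def using chains_card by blast
      finally show "card L \<le> C ^ N" .
    qed (use q in auto)
    also have "\<dots> = (real C * (2 * q)) ^ N" by (simp add: power_mult_distrib)
    also have "real C * (2 * q) = 1/2" using C by (simp add: q_def)
    finally have pA: "prob A \<le> (1/2) ^ N" .
    have "fpp (tau1 \<omega>) 0 x + \<epsilon> * real (l1 x) < path_sum (tau1 \<omega>) xs"
      if "\<omega> \<notin> A" and x: "l1 x = k * (N * (2 * ?d + 2) + ?d)" and xs: "xs
        \<in> lpaths 0 x" "distinct xs" "unconverted \<omega> xs" for \<omega> x xs
    proof (rule ccontr)
      assume "\<not> ?thesis"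
      then have "path_sum (tau1 \<omega>) xs \<le> fpp (tau1 \<omega>) 0 x + \<epsilon> * real (l1 x)" by simp
      from near_geodesic_crossings[OF k N \<eta> x xs this[unfolded \<epsilon>_def]] have "\<omega> \<in> A"
        unfolding A_def L_def space_M by blast
      with that show False by blast
    qed
    with A pA show ?thesis by blast
  qed
  with \<epsilon> k show ?thesis by blast
qed

end

section \<open>First passage percolation\<close>

text \<open>Bounding the number of sites confines paths to a ball, which makes passage times between
  far apart pairs independent; the truncated time lies above \<open>fpp\<close>. For
  \<open>R\<close> at most the distance of the end points the infimum is over the empty set, hence
  the recurring assumption \<open>l1 (x - y) < R\<close>.\<close>

definition fpp_upto :: "nat \<Rightarrow> (int ^ 'd::finite \<Rightarrow> int ^ 'd \<Rightarrow> real) \<Rightarrow> int ^ 'd \<Rightarrow> int ^ 'd \<Rightarrow> real" where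
  "fpp_upto R t x y = (INF xs\<in>{xs \<in> lpaths x y. length xs \<le> R}. path_sum t xs)"

lemma fpp_upto_le: "(\<And>x y. 0 \<le> t x y) \<Longrightarrow> xs \<in> lpaths x y \<Longrightarrow> length xs \<le> R \<Longrightarrow> fpp_upto R t x y \<le> path_sum t xs"
  unfolding fpp_upto_def by (intro cINF_lower bdd_below_path_sum) auto

lemma short_lpaths_nonempty: "l1 (x - y) < R \<Longrightarrow> {xs \<in> lpaths x y. length xs \<le> R} \<noteq> {}"
  using exists_straight_path[of x y] by auto

lemma fpp_upto_nonneg: "(\<And>x y. 0 \<le> t x y) \<Longrightarrow> l1 (x - y) < R \<Longrightarrow> 0 \<le> fpp_upto R t x y"
  unfolding fpp_upto_def by (intro cINF_greatest short_lpaths_nonempty path_sum_nonneg)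

lemma fpp_le_fpp_upto: "(\<And>x y. 0 \<le> t x y) \<Longrightarrow> l1 (x - y) < R \<Longrightarrow> fpp t x y \<le> fpp_upto R t x y"
  unfolding fpp_upto_def by (intro cINF_greatest short_lpaths_nonempty) (auto intro: fpp_le)

lemma fpp_upto_tendsto:
  assumes t: "\<And>x y. 0 \<le> t x y"
  shows "(\<lambda>R. fpp_upto R t x y) \<longlonglongrightarrow> fpp t x y"
proof (rule LIMSEQ_I)
  fix e :: real assume e: "0 < e"
  have "\<exists>xs\<in>lpaths x y. path_sum t xs < fpp t x y + e"
  proof (rule ccontr)
    assume "\<not> ?thesis"
    then have "fpp t x y + e \<le> fpp t x y" by (intro fpp_greatest) (auto simp: not_less)
    with e show False by simp
  qed
  then obtain xs where xs: "xs \<in> lpaths x y" "path_sum t xs < fpp t x y + e" by blast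
  have "norm (fpp_upto R t x y - fpp t x y) < e" if R: "max (length xs) (Suc (l1 (x - y))) \<le> R" for R
  proof -
    have "fpp_upto R t x y \<le> path_sum t xs" using R by (intro fpp_upto_le t xs(1)) auto
    moreover have "fpp t x y \<le> fpp_upto R t x y" using R by (intro fpp_le_fpp_upto t) auto
    ultimately show ?thesis using xs(2) by simp
  qed
  then show "\<exists>no. \<forall>n\<ge>no. norm (fpp_upto n t x y - fpp t x y) < e" by blast
qed

lemma lpath_nth_close: "xs \<in> lpaths x y \<Longrightarrow> i < length xs \<Longrightarrow> l1 (xs ! i - x) \<le> i"
proof (induction i)
  case 0
  then show ?case by (auto simp: lpaths_def hd_conv_nth)
next
  case (Suc i)
  then have "lattice_adj (xs ! i) (xs ! Suc i)" by (auto simp: lpaths_def successively_conv_nth)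
  then show ?case using Suc l1_triangle[of "xs ! Suc i" x "xs ! i"] by (simp add: lattice_adj_iff l1_commute)
qed

lemma fpp_upto_depends:
  assumes "\<And>u v. l1 (u - x) < R \<Longrightarrow> t u v = t' u v"
  shows "fpp_upto R t x y = fpp_upto R t' x y"
proof -
  have "path_sum t xs = path_sum t' xs" if "xs \<in> lpaths x y" "length xs \<le> R" for xs
  proof (rule path_sum_cong)
    fix i assume "Suc i < length xs"
    then show "t (xs ! i) (xs ! Suc i) = t' (xs ! i) (xs ! Suc i)"
      using lpath_nth_close[OF that(1), of i] that(2) by (intro assms) simp
  qed
  then show ?thesis unfolding fpp_upto_def by (intro INF_cong) auto
qed

section \<open>Translations and exchange of the two spreading families\<close>

lemma lattice_adj_shift [simp]: "lattice_adj (x + u) (y + u) \<longleftrightarrow> lattice_adj x (y :: int ^ 'd::finite)"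
  by (simp add: lattice_adj_def)

lemma path_sum_map: "path_sum t (map f xs) = path_sum (\<lambda>x y. t (f x) (f y)) xs"
proof (induction xs rule: induct_list012)
  case (3 x y zs)
  then show ?case by simp
qed auto

lemma lpaths_shift: "lpaths (x + u) (y + u) = map (\<lambda>z. z + u) ` lpaths x (y :: int ^ 'd::finite)"
proof -
  have 1: "map (\<lambda>z. z + u) xs \<in> lpaths (x + u) (y + u)" if "xs \<in> lpaths x y" for x y u :: "int ^ 'd" and xs
    using that by (auto simp: lpaths_def hd_map last_map successively_map)
  show ?thesis
  proof
    show "lpaths (x + u) (y + u) \<subseteq> map (\<lambda>z. z + u) ` lpaths x y"
    proof
      fix xs assume "xs \<in> lpaths (x + u) (y + u)"
      from 1[OF this, of "- u"] have "map (\<lambda>z. z + - u) xs \<in> lpaths x y" by simp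
      then show "xs \<in> map (\<lambda>z. z + u) ` lpaths x y"
        by (intro image_eqI[of _ _ "map (\<lambda>z. z + - u) xs"]) (simp_all add: o_def)
    qed
  qed (use 1 in auto)
qed

lemma fpp_upto_shift: "fpp_upto R t (x + u) (y + u) = fpp_upto R (\<lambda>a b. t (a + u) (b + u)) x y"
proof -
  have "{xs \<in> lpaths (x + u) (y + u). length xs \<le> R} = map (\<lambda>z. z + u) ` {xs \<in> lpaths x y. length xs \<le> R}"
    unfolding lpaths_shift by auto
  then show ?thesis unfolding fpp_upto_def by (simp add: image_image path_sum_map)
qed

text \<open>A symmetry of the law when both spreading rates are 1; it carries every estimate for
  \<open>tau1\<close> over to \<open>tau2\<close>.\<close>

primrec swap_clock :: "'v clock \<Rightarrow> 'v clock" where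
  "swap_clock (Spread1 y x) = Spread2 y x" | "swap_clock (Spread2 y x) = Spread1 y x"
| "swap_clock (Conversion x) = Conversion x"

lemma tau1_swap: "tau1 (\<lambda>c. \<omega> (swap_clock c)) = tau2 \<omega>"
  by (simp add: tau1_def tau2_def fun_eq_iff)

lemma inj_swap_clock: "inj swap_clock"
proof (rule injI)
  fix a b :: "'a clock" assume "swap_clock a = swap_clock b" then show "a = b" by (cases a; cases b) auto
qed

lemma inj_map_clock_shift: "inj (map_clock (\<lambda>z. z + u) :: (int ^ 'd) clock \<Rightarrow> _)"
  by (intro clock.inj_map injI) simp

lemma tau1_map_clock: "tau1 (\<lambda>c. \<omega> (map_clock f c)) = (\<lambda>a b. tau1 \<omega> (f a) (f b))"
  by (simp add: tau1_def fun_eq_iff)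

context clocks
begin

text \<open>Covers both translations of the lattice and \<open>swap_clock\<close>.\<close>

lemma distr_reindex:
  assumes "inj f" "\<And>c. clock_rate lam rho (f c) = clock_rate lam rho c"
  shows "distr M M (\<lambda>\<omega> c. \<omega> (f c)) = M"
proof -
  have "distr (PiM UNIV clock_law) (PiM UNIV (\<lambda>c. clock_law (f c))) (\<lambda>\<omega>. \<lambda>c\<in>UNIV. \<omega> (f c))
    = PiM UNIV (\<lambda>c. clock_law (f c))"
    using assms(1) by (intro distr_PiM_reindex prob_space_law) auto
  then show ?thesis unfolding M_PiM by (simp add: assms(2) restrict_UNIV)
qed

lemma measurable_reindex: "(\<lambda>\<omega> c. \<omega> (f c)) \<in> measurable M M"
  unfolding M_PiM
  by (rule measurable_PiM_single') (simp_all add: M_PiM[symmetric] space_PiM)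

lemma prob_reindex:
  assumes "inj f" "\<And>c. clock_rate lam rho (f c) = clock_rate lam rho c" "A \<in> events"
  shows "prob {\<omega>. (\<lambda>c. \<omega> (f c)) \<in> A} = prob A"
proof -
  have "prob A = measure (distr M M (\<lambda>\<omega> c. \<omega> (f c))) A" using distr_reindex[OF assms(1,2)] by simp
  also have "\<dots> = prob {\<omega>. (\<lambda>c. \<omega> (f c)) \<in> A}"
    by (subst measure_distr[OF measurable_reindex assms(3)]) (simp add: vimage_def)
  finally show ?thesis ..
qed

lemma expectation_reindex:
  assumes "inj f" "\<And>c. clock_rate lam rho (f c) = clock_rate lam rho c" "g \<in> borel_measurable M"
  shows "expectation (\<lambda>\<omega>. g (\<lambda>c. \<omega> (f c))) = (expectation g :: real)"
proof -
  have "expectation g = integral\<^sup>L (distr M M (\<lambda>\<omega> c. \<omega> (f c))) g" using distr_reindex[OF assms(1,2)] by simp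
  also have "\<dots> = expectation (\<lambda>\<omega>. g (\<lambda>c. \<omega> (f c)))"
    by (rule integral_distr[OF measurable_reindex assms(3)])
  finally show ?thesis ..
qed

lemma rate_map_clock: "clock_rate lam rho (map_clock f c) = clock_rate lam rho c"
  by (cases c) auto

lemma fpp_measurable [measurable]:
  "(\<lambda>\<omega>. fpp (tau1 \<omega>) x y) \<in> borel_measurable M" "(\<lambda>\<omega>. fpp (tau2 \<omega>) x y) \<in> borel_measurable M"
  unfolding fpp_def by (intro borel_measurable_cINF_real countableI_type path_sum_measurable)+

lemma fpp_upto_measurable [measurable]:
  "(\<lambda>\<omega>. fpp_upto R (tau1 \<omega>) x y) \<in> borel_measurable M" "(\<lambda>\<omega>. fpp_upto R (tau2 \<omega>) x y) \<in> borel_measurable M"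
  unfolding fpp_upto_def by (intro borel_measurable_cINF_real countableI_type path_sum_measurable)+

section \<open>Moments and tails of passage times\<close>

lemma tau1_square_integrable: "integrable M (\<lambda>\<omega>. (tau1 \<omega> x y)\<^sup>2)"
proof (rule Bochner_Integration.integrable_bound)
  have "distributed M lborel (\<lambda>\<omega>. \<omega> (Spread1 x y)) (exponential_density 1)"
    using distributed_clock[of "Spread1 x y"] by simp
  from erlang_ith_moment_integrable[OF _ this, of 2]
  show "integrable M (\<lambda>\<omega>. (\<omega> (Spread1 x y))\<^sup>2)" by simp
  show "AE \<omega> in M. norm ((tau1 \<omega> x y)\<^sup>2) \<le> norm ((\<omega> (Spread1 x y))\<^sup>2)"
    by (intro AE_I2) (simp add: tau1_def max_def)
qed measurable

lemma path_sum_square_integrable: "integrable M (\<lambda>\<omega>. (path_sum (tau1 \<omega>) xs)\<^sup>2)"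
proof (induction xs rule: induct_list012)
  case (3 x y zs)
  have m: "(\<lambda>\<omega>. path_sum (tau1 \<omega>) (y # zs)) \<in> borel_measurable M" by measurable
  have "integrable M (\<lambda>\<omega>. (tau1 \<omega> x y + path_sum (tau1 \<omega>) (y # zs))\<^sup>2)"
  proof (rule Bochner_Integration.integrable_bound)
    show "integrable M (\<lambda>\<omega>. 2 * (tau1 \<omega> x y)\<^sup>2 + 2 * (path_sum (tau1 \<omega>) (y # zs))\<^sup>2)"
      using 3 tau1_square_integrable by (intro Bochner_Integration.integrable_add integrable_mult_right) auto
    show "(\<lambda>\<omega>. (tau1 \<omega> x y + path_sum (tau1 \<omega>) (y # zs))\<^sup>2) \<in> borel_measurable M" using m by measurable
    show "AE \<omega> in M. norm ((tau1 \<omega> x y + path_sum (tau1 \<omega>) (y # zs))\<^sup>2)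
      \<le> norm (2 * (tau1 \<omega> x y)\<^sup>2 + 2 * (path_sum (tau1 \<omega>) (y # zs))\<^sup>2)"
    proof (intro AE_I2)
      fix \<omega>
      have "(a + b)\<^sup>2 \<le> 2 * a\<^sup>2 + 2 * b\<^sup>2" for a b :: real
        using zero_le_power2[of "a - b"] by (simp add: power2_eq_square algebra_simps)
      then show "norm ((tau1 \<omega> x y + path_sum (tau1 \<omega>) (y # zs))\<^sup>2)
        \<le> norm (2 * (tau1 \<omega> x y)\<^sup>2 + 2 * (path_sum (tau1 \<omega>) (y # zs))\<^sup>2)"
        by simp
    qed
  qed
  then show ?case by simp
qed auto

lemma fpp_upto_square_integrable:
  assumes "l1 (x - y) < R"
  shows "integrable M (\<lambda>\<omega>. (fpp_upto R (tau1 \<omega>) x y)\<^sup>2)"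
proof -
  obtain xs where xs: "xs \<in> lpaths x y" "length xs \<le> R" using short_lpaths_nonempty[OF assms] by blast
  show ?thesis
  proof (rule Bochner_Integration.integrable_bound[OF path_sum_square_integrable[of xs]])
    show "AE \<omega> in M. norm ((fpp_upto R (tau1 \<omega>) x y)\<^sup>2) \<le> norm ((path_sum (tau1 \<omega>) xs)\<^sup>2)"
      using fpp_upto_nonneg[OF _ assms] fpp_upto_le[OF _ xs]
      by (intro AE_I2) (simp add: power_mono)
  qed measurable
qed

lemma path_sum_integrable: "integrable M (\<lambda>\<omega>. path_sum (tau1 \<omega>) xs)"
  by (rule square_integrable_imp_integrable[OF _ path_sum_square_integrable]) measurable

lemma fpp_upto_integrable: "l1 (x - y) < R \<Longrightarrow> integrable M (\<lambda>\<omega>. fpp_upto R (tau1 \<omega>) x y)"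
  by (rule square_integrable_imp_integrable[OF _ fpp_upto_square_integrable]) measurable

lemma fpp_integrable: "integrable M (\<lambda>\<omega>. fpp (tau1 \<omega>) x y)"
proof -
  obtain xs where xs: "xs \<in> lpaths x y" using lpaths_nonempty by blast
  show ?thesis
  proof (rule Bochner_Integration.integrable_bound[OF path_sum_integrable[of xs]])
    show "AE \<omega> in M. norm (fpp (tau1 \<omega>) x y) \<le> norm (path_sum (tau1 \<omega>) xs)"
    proof (intro AE_I2)
      fix \<omega>
      show "norm (fpp (tau1 \<omega>) x y) \<le> norm (path_sum (tau1 \<omega>) xs)"
        using fpp_nonneg[of "tau1 \<omega>" x y] fpp_le[OF _ xs, of "tau1 \<omega>"] by simp
    qed
  qed measurable
qed

lemma expectation_fpp_upto_tendsto:
  "(\<lambda>R. expectation (\<lambda>\<omega>. fpp_upto R (tau1 \<omega>) x y)) \<longlonglongrightarrow> expectation (\<lambda>\<omega>. fpp (tau1 \<omega>) x y)"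
proof -
  obtain xs where xs: "xs \<in> lpaths x y" "length xs = Suc (l1 (x - y))" using exists_straight_path by blast
  let ?k = "Suc (l1 (x - y))"
  \<comment> \<open>The shift by \<open>?k\<close> skips the values of \<open>R\<close> for which
    the truncated infimum is over the empty set; beyond them the sum along the straight path
    dominates.\<close>
  have "(\<lambda>R. expectation (\<lambda>\<omega>. fpp_upto (R + ?k) (tau1 \<omega>) x y)) \<longlonglongrightarrow> expectation (\<lambda>\<omega>. fpp (tau1 \<omega>) x y)"
  proof (rule integral_dominated_convergence[where w = "\<lambda>\<omega>. path_sum (tau1 \<omega>) xs"])
    show "AE \<omega> in M. (\<lambda>R. fpp_upto (R + ?k) (tau1 \<omega>) x y) \<longlonglongrightarrow> fpp (tau1 \<omega>) x y"
      by (intro AE_I2 LIMSEQ_ignore_initial_segment fpp_upto_tendsto) simp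
    show "AE \<omega> in M. norm (fpp_upto (R + ?k) (tau1 \<omega>) x y) \<le> path_sum (tau1 \<omega>) xs" for R
      using fpp_upto_nonneg[of "tau1 _" x y "R + ?k"] fpp_upto_le[OF _ xs(1), of "tau1 _" "R + ?k"] xs(2)
      by (intro AE_I2) simp
  qed (measurable, rule path_sum_integrable)
  then show ?thesis by (rule LIMSEQ_offset)
qed

lemma expectation_fpp_upto_shift:
  assumes [measurable]: "h \<in> borel_measurable borel"
  shows "expectation (\<lambda>\<omega>. h (fpp_upto R (tau1 \<omega>) (x + u) (y + u)))
    = (expectation (\<lambda>\<omega>. h (fpp_upto R (tau1 \<omega>) x y)) :: real)"
proof -
  have "expectation (\<lambda>\<omega>. h (fpp_upto R (tau1 \<omega>) (x + u) (y + u)))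
    = expectation (\<lambda>\<omega>. h (fpp_upto R (tau1 (\<lambda>c. \<omega> (map_clock (\<lambda>z. z + u) c))) x y))"
    by (simp add: fpp_upto_shift tau1_map_clock)
  also have "\<dots> = expectation (\<lambda>\<omega>. h (fpp_upto R (tau1 \<omega>) x y))"
    by (rule expectation_reindex[OF inj_map_clock_shift rate_map_clock]) measurable
  finally show ?thesis .
qed

lemma nn_integral_exp_tau: "(\<integral>\<^sup>+\<omega>. ennreal (exp (tau1 \<omega> x y / 2)) \<partial>M) = 2"
proof -
  have D: "distributed M lborel (\<lambda>\<omega>. \<omega> (Spread1 x y)) (exponential_density 1)"
    using distributed_clock[of "Spread1 x y"] by simp
  have "(\<integral>\<^sup>+\<omega>. ennreal (exp (tau1 \<omega> x y / 2)) \<partial>M)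
    = (\<integral>\<^sup>+z. ennreal (exponential_density 1 z) * ennreal (exp (max 0 z / 2)) \<partial>lborel)"
    unfolding tau1_def
  proof (rule distributed_nn_integral[OF D, of "\<lambda>z. ennreal (exp (max 0 z / 2))", symmetric])
    have "(\<lambda>z::real. exp (max 0 z / 2)) \<in> borel_measurable borel"
      by (intro borel_measurable_continuous_onI continuous_intros) simp
    then show "(\<lambda>z. ennreal (exp (max 0 z / 2))) \<in> borel_measurable lborel" by simp
  qed
  also have "\<dots> = (\<integral>\<^sup>+z. 2 * ennreal (exponential_density (1/2) z) \<partial>lborel)"
  proof (rule nn_integral_cong)
    fix z :: real
    have "ennreal (exponential_density 1 z) * ennreal (exp (max 0 z / 2))
      = ennreal (exponential_density 1 z * exp (max 0 z / 2))"
      by (simp add: ennreal_mult' exponential_density_nonneg)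
    \<comment> \<open>Tilting the density of rate 1 by \<open>exp (z / 2)\<close> gives twice the
      density of rate 1/2.\<close>
    also have "exponential_density 1 z * exp (max 0 z / 2) = 2 * exponential_density (1/2) z"
      by (simp add: exponential_density_def exp_add[symmetric])
    finally show "ennreal (exponential_density 1 z) * ennreal (exp (max 0 z / 2))
      = 2 * ennreal (exponential_density (1/2) z)"
      by (simp add: ennreal_mult' exponential_density_nonneg)
  qed
  also have "\<dots> = 2 * (\<integral>\<^sup>+z. ennreal (exponential_density (1/2) z) \<partial>lborel)" by (rule nn_integral_cmult) simp
  also have "(\<integral>\<^sup>+z. ennreal (exponential_density (1/2) z) \<partial>lborel)
    = emeasure (density lborel (exponential_density (1/2))) (space lborel)"
    by (subst emeasure_density) auto
  also have "\<dots> = 1" using prob_space.emeasure_space_1[OF prob_space_exponential_density[of "1/2"]] by simp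
  finally show ?thesis by simp
qed

text \<open>Chernoff bound along a straight path: each of its at most \<open>m\<close> steps has
  exponential moment 2 at 1/2, and \<open>exp (- 2) * 2\<close> is at most 1/3. Allowing
  \<open>m\<close> above the distance makes the bound uniform over a ball.\<close>

lemma prob_fpp_large:
  assumes "l1 (x - y) \<le> m"
  shows "prob {\<omega>. 4 * real m < fpp (tau1 \<omega>) x y} \<le> (1/3) ^ m"
proof -
  obtain xs where xs: "xs \<in> lpaths x y" "distinct xs" "length xs = Suc (l1 (x - y))" using exists_straight_path
    by blast
  let ?S = "\<lambda>\<omega>. path_sum (tau1 \<omega>) xs"
  have card: "card (path_edges xs) \<le> m"
  proof -
    have "path_edges xs = (\<lambda>i. (xs ! i, xs ! Suc i)) ` {..<length xs - 1}" by (auto simp: path_edges_def)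
    then have "card (path_edges xs) \<le> length xs - 1" using card_image_le[of "{..<length xs - 1}"] by simp
    then show ?thesis using xs(3) assms by simp
  qed
  have ind: "indep_vars (\<lambda>_. borel) (\<lambda>e \<omega>. ennreal (exp (tau1 \<omega> (fst e) (snd e) / 2))) (path_edges xs)"
    unfolding M_PiM
  proof (rule indep_vars_disjoint_support[where K = "\<lambda>e. {Spread1 (fst e) (snd e)}"])
    show "(\<lambda>\<omega>. ennreal (exp (tau1 \<omega> (fst e) (snd e) / 2))) \<in> borel_measurable (PiM UNIV clock_law)" for e
      unfolding M_PiM[symmetric] by measurable
    show "disjoint_family_on (\<lambda>e. {Spread1 (fst e) (snd e)}) (path_edges xs)"
      by (auto simp: disjoint_family_on_def)
    fix e and \<omega> \<omega>' :: "(int ^ 'd) clock \<Rightarrow> real"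
    assume "\<And>c. c \<in> {Spread1 (fst e) (snd e)} \<Longrightarrow> \<omega> c = \<omega>' c"
    then show "ennreal (exp (tau1 \<omega> (fst e) (snd e) / 2)) = ennreal (exp (tau1 \<omega>' (fst e) (snd e) / 2))"
      by (simp add: tau1_def)
  qed (rule prob_space_law)
  have "(\<integral>\<^sup>+\<omega>. ennreal (exp (?S \<omega> / 2)) \<partial>M)
    = (\<integral>\<^sup>+\<omega>. (\<Prod>e\<in>path_edges xs. ennreal (exp (tau1 \<omega> (fst e) (snd e) / 2))) \<partial>M)"
    by (intro nn_integral_cong)
      (simp add: path_sum_edges[OF xs(2)] sum_divide_distrib exp_sum[OF finite_path_edges] prod_ennreal case_prod_beta)
  also have "\<dots> = (\<Prod>e\<in>path_edges xs. \<integral>\<^sup>+\<omega>. ennreal (exp (tau1 \<omega> (fst e) (snd e) / 2)) \<partial>M)"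
    by (rule indep_vars_nn_integral[OF finite_path_edges ind]) simp
  also have "\<dots> = 2 ^ card (path_edges xs)" by (simp add: nn_integral_exp_tau)
  also have "\<dots> \<le> 2 ^ m" using card by (intro power_increasing) auto
  finally have mom: "(\<integral>\<^sup>+\<omega>. ennreal (exp (?S \<omega> / 2)) \<partial>M) \<le> 2 ^ m" .
  have "emeasure M {\<omega>. 4 * real m < fpp (tau1 \<omega>) x y} \<le> emeasure M {\<omega>\<in>space M. 1
    \<le> ennreal (exp (- 2 * real m)) * ennreal (exp (?S \<omega> / 2))}"
  proof (rule emeasure_mono)
    show "{\<omega>. 4 * real m < fpp (tau1 \<omega>) x y} \<subseteq> {\<omega>\<in>space M. 1
      \<le> ennreal (exp (- 2 * real m)) * ennreal (exp (?S \<omega> / 2))}"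
    proof
      fix \<omega> assume "\<omega> \<in> {\<omega>. 4 * real m < fpp (tau1 \<omega>) x y}"
      then have "4 * real m < ?S \<omega>" using fpp_le[OF _ xs(1), of "tau1 \<omega>"] by simp
      then have "1 \<le> exp (- 2 * real m + ?S \<omega> / 2)" by simp
      also have "\<dots> = exp (- 2 * real m) * exp (?S \<omega> / 2)" by (rule exp_add)
      finally have "ennreal 1 \<le> ennreal (exp (- 2 * real m) * exp (?S \<omega> / 2))" by (rule ennreal_leI)
      then show "\<omega> \<in> {\<omega>\<in>space M. 1 \<le> ennreal (exp (- 2 * real m)) * ennreal (exp (?S \<omega> / 2))}"
        by (simp add: ennreal_mult')
    qed
  qed measurable
  also have "\<dots> \<le> ennreal (exp (- 2 * real m)) * (\<integral>\<^sup>+\<omega>. ennreal (exp (?S \<omega> / 2)) * indicator (space M) \<omega> \<partial>M)"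
  proof (rule nn_integral_Markov_inequality)
    have "(\<lambda>\<omega>. ennreal (exp (?S \<omega> / 2))) \<in> borel_measurable M" by measurable
    then show "(\<lambda>\<omega>. ennreal (exp (?S \<omega> / 2)) * indicator (space M) \<omega>) \<in> borel_measurable M" by simp
  qed (rule sets.top)
  also have "\<dots> \<le> ennreal (exp (- 2 * real m)) * 2 ^ m"
    using mom by (intro mult_left_mono) simp_all
  also have "\<dots> = ennreal (exp (- 2 * real m) * 2 ^ m)"
    by (simp add: ennreal_mult' ennreal_power[symmetric])
  finally have "prob {\<omega>. 4 * real m < fpp (tau1 \<omega>) x y} \<le> exp (- 2 * real m) * 2 ^ m"
    by (simp add: emeasure_eq_measure)
  also have "\<dots> = (exp (- 2) * 2) ^ m" by (simp add: power_mult_distrib exp_of_nat2_mult[symmetric] mult.commute)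
  also have "\<dots> \<le> (1/3) ^ m"
  proof (rule power_mono)
    have "(1 + 3/2) * (1 + 3/2) \<le> exp (1 :: real) * exp 1"
      using exp_lower_Taylor_quadratic[of "1 :: real"] by (intro mult_mono) (auto simp: power2_eq_square)
    then have "6 \<le> exp (2 :: real)" by (simp add: exp_add[symmetric])
    then show "exp (- 2) * 2 \<le> (1/3 :: real)" by (simp add: exp_minus field_simps)
  qed simp
  finally show ?thesis .
qed

end

section \<open>A weak law for passage times\<close>

definition scale :: "nat \<Rightarrow> int ^ 'd::finite \<Rightarrow> int ^ 'd" where
  "scale n u = (\<chi> i. int n * u $ i)"

lemma scale_add: "scale (m + n) u = scale m u + scale n u"
  by (simp add: scale_def vec_eq_iff algebra_simps)

lemma scale_0 [simp]: "scale 0 u = 0" "scale n 0 = 0"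
  by (simp_all add: scale_def vec_eq_iff)

lemma l1_scale: "l1 (scale n u) = n * l1 u"
proof -
  have "int (l1 (scale n u)) = int (n * l1 u)"
    unfolding int_l1 of_nat_mult scale_def by (simp add: abs_mult sum_distrib_left)
  then show ?thesis by linarith
qed

lemma scale_diff: "j \<le> i \<Longrightarrow> scale i u - scale j u = scale (i - j) u"
  by (simp add: scale_def vec_eq_iff algebra_simps of_nat_diff)

text \<open>An upper bound for the passage time to \<open>scale (N * m) u\<close> that takes the
  place of a subadditive ergodic theorem: its terms are identically distributed and, thanks to the
  truncation, independent once they are far apart.\<close>

definition chunk_sum :: "nat \<Rightarrow> nat \<Rightarrow> nat \<Rightarrow> int ^ 'd::finite \<Rightarrow> (int ^ 'd \<Rightarrow> int ^ 'd \<Rightarrow> real) \<Rightarrow> real" where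
  "chunk_sum R m N u t = (\<Sum>i<N. fpp_upto R t (scale (i * m) u) (scale (Suc i * m) u))"

lemma fpp_same: assumes "\<And>x y. 0 \<le> t x y" shows "fpp t x x = 0"
proof (rule antisym)
  have "[x] \<in> lpaths x x" by (simp add: lpaths_def)
  from fpp_le[of t, OF assms this] show "fpp t x x \<le> 0" by simp
  show "0 \<le> fpp t x x" by (rule fpp_nonneg[OF assms])
qed

lemma fpp_le_chunk_sum:
  assumes t: "\<And>x y. 0 \<le> t x y" and R: "l1 (scale m u) < R"
  shows "fpp t 0 (scale (N * m) u) \<le> chunk_sum R m N u t"
proof (induction N)
  case 0
  then show ?case by (simp add: chunk_sum_def fpp_same[OF t])
next
  case (Suc N)
  have "l1 (scale (N * m) u - scale (Suc N * m) u) < R"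
    using R scale_diff[of "N * m" "Suc N * m" u] l1_commute[of "scale (N * m) u" "scale (Suc N * m) u"] by simp
  then have "fpp t (scale (N * m) u) (scale (Suc N * m) u) \<le> fpp_upto R t (scale (N * m) u) (scale (Suc N * m) u)"
    by (rule fpp_le_fpp_upto[OF t])
  moreover have "fpp t 0 (scale (Suc N * m) u) \<le> fpp t 0 (scale (N * m) u)
    + fpp t (scale (N * m) u) (scale (Suc N * m) u)"
    by (rule fpp_triangle[OF t])
  ultimately show ?case using Suc by (simp add: chunk_sum_def)
qed

context clocks
begin

definition mean_upto :: "nat \<Rightarrow> int ^ 'd \<Rightarrow> real" where
  "mean_upto R x = expectation (\<lambda>\<omega>. fpp_upto R (tau1 \<omega>) 0 x)"

lemma chunk_sum_measurable [measurable]: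
  "(\<lambda>\<omega>. chunk_sum R m N u (tau1 \<omega>)) \<in> borel_measurable M" "(\<lambda>\<omega>. chunk_sum R m N u (tau2 \<omega>)) \<in> borel_measurable M"
  unfolding chunk_sum_def by measurable

lemma chunk_ends: "scale (i * m) u = 0 + scale (i * m) u" "scale (Suc i * m) u = scale m u + scale (i * m) u"
  by (simp_all add: scale_add[symmetric])

lemma chunk_short: "l1 (scale m u) < R \<Longrightarrow> l1 (scale (i * m) u - scale (Suc i * m) u) < R"
  using scale_diff[of "i * m" "Suc i * m" u] l1_commute[of "scale (i * m) u" "scale (Suc i * m) u"] by simp

lemma expectation_chunk:
  assumes "h \<in> borel_measurable borel"
  shows "expectation (\<lambda>\<omega>. h (fpp_upto R (tau1 \<omega>) (scale (i * m) u) (scale (Suc i * m) u))) =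
    (expectation (\<lambda>\<omega>. h (fpp_upto R (tau1 \<omega>) 0 (scale m u))) :: real)"
  using expectation_fpp_upto_shift[OF assms, of R 0 "scale (i * m) u" "scale m u"] chunk_ends[of i m u] by simp

lemma expectation_chunk_sum:
  assumes R: "l1 (scale m u) < R"
  shows "integrable M (\<lambda>\<omega>. chunk_sum R m N u (tau1 \<omega>))"
    "expectation (\<lambda>\<omega>. chunk_sum R m N u (tau1 \<omega>)) = N * mean_upto R (scale m u)"
proof -
  have int: "integrable M (\<lambda>\<omega>. fpp_upto R (tau1 \<omega>) (scale (i * m) u) (scale (Suc i * m) u))" for i
    by (rule fpp_upto_integrable[OF chunk_short[OF R]])
  show "integrable M (\<lambda>\<omega>. chunk_sum R m N u (tau1 \<omega>))"
    unfolding chunk_sum_def by (intro Bochner_Integration.integrable_sum int)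
  have "expectation (\<lambda>\<omega>. chunk_sum R m N u (tau1 \<omega>))
    = (\<Sum>i<N. expectation (\<lambda>\<omega>. fpp_upto R (tau1 \<omega>) (scale (i * m) u) (scale (Suc i * m) u)))"
    unfolding chunk_sum_def by (intro Bochner_Integration.integral_sum int)
  also have "\<dots> = (\<Sum>i<N. mean_upto R (scale m u))"
    unfolding mean_upto_def using expectation_chunk[of "\<lambda>x. x"] by (intro sum.cong) auto
  finally show "expectation (\<lambda>\<omega>. chunk_sum R m N u (tau1 \<omega>)) = N * mean_upto R (scale m u)" by simp
qed

definition var_upto :: "nat \<Rightarrow> int ^ 'd \<Rightarrow> real" where
  "var_upto R x = expectation (\<lambda>\<omega>. (fpp_upto R (tau1 \<omega>) 0 x - mean_upto R x)\<^sup>2)"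

lemma var_upto_nonneg: "0 \<le> var_upto R x"
  unfolding var_upto_def by (intro Bochner_Integration.integral_nonneg) simp

text \<open>Terms whose indices differ by more than \<open>2 * R\<close> read disjoint clocks and
  have covariance 0; every other covariance is at most \<open>V\<close>, and each \<open>i\<close>
  has at most \<open>4 * R + 1\<close> such partners. The second moment thus grows only linearly in
  \<open>N\<close>.\<close>

lemma chunk_sum_second_moment:
  assumes R: "l1 (scale m u) < R" and m: "0 < m" and u: "u \<noteq> 0"
  defines "b \<equiv> mean_upto R (scale m u)" and "V \<equiv> var_upto R (scale m u)"
  shows "integrable M (\<lambda>\<omega>. (chunk_sum R m N u (tau1 \<omega>) - N * b)\<^sup>2)"
    "expectation (\<lambda>\<omega>. (chunk_sum R m N u (tau1 \<omega>) - N * b)\<^sup>2) \<le> real N * (real (4 * R + 1) * V)"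
proof -
  define D where "D i \<omega> = fpp_upto R (tau1 \<omega>) (scale (i * m) u) (scale (Suc i * m) u)" for i \<omega>
  define W where "W i \<omega> = D i \<omega> - b" for i \<omega>
  have [measurable]: "D i \<in> borel_measurable M" "W i \<in> borel_measurable M" for i unfolding D_def W_def by measurable
  have intD: "integrable M (D i)" "integrable M (\<lambda>\<omega>. (D i \<omega>)\<^sup>2)" for i
    unfolding D_def
      by (rule fpp_upto_integrable[OF chunk_short[OF R]]) (rule fpp_upto_square_integrable[OF chunk_short[OF R]])
  have intW: "integrable M (W i)" for i unfolding W_def using intD(1)
    by (intro Bochner_Integration.integrable_diff) auto
  have intW2: "integrable M (\<lambda>\<omega>. (W i \<omega>)\<^sup>2)" for i
  proof -
    have "integrable M (\<lambda>\<omega>. (D i \<omega>)\<^sup>2 - 2 * b * D i \<omega> + b\<^sup>2)"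
      using intD[of i]
        by (intro Bochner_Integration.integrable_add Bochner_Integration.integrable_diff integrable_mult_right) auto
    then show ?thesis by (simp add: W_def power2_diff algebra_simps)
  qed
  have EW: "expectation (W i) = 0" for i
  proof -
    have "expectation (W i) = expectation (\<lambda>\<omega>. fpp_upto R (tau1 \<omega>) 0 (scale m u) - b)"
      unfolding W_def D_def by (rule expectation_chunk[of "\<lambda>x. x - b"]) measurable
    also have "\<dots> = 0"
      using R fpp_upto_integrable[of 0 "scale m u" R] l1_commute[of 0 "scale m u"] prob_space
      by (subst Bochner_Integration.integral_diff) (auto simp: b_def mean_upto_def)
    finally show ?thesis .
  qed
  have EW2: "expectation (\<lambda>\<omega>. (W i \<omega>)\<^sup>2) = V" for i
    unfolding W_def D_def V_def var_upto_def b_def[symmetric]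
      by (rule expectation_chunk[of "\<lambda>x. (x - b)\<^sup>2"]) measurable
  have prod_le: "W i \<omega> * W j \<omega> \<le> ((W i \<omega>)\<^sup>2 + (W j \<omega>)\<^sup>2) / 2" "\<bar>W i \<omega> * W j \<omega>\<bar> \<le> (W i \<omega>)\<^sup>2 + (W j \<omega>)\<^sup>2" for i j \<omega>
  proof -
    have "0 \<le> (W i \<omega> - W j \<omega>)\<^sup>2" "0 \<le> (W i \<omega> + W j \<omega>)\<^sup>2" by simp_all
    then show "W i \<omega> * W j \<omega> \<le> ((W i \<omega>)\<^sup>2 + (W j \<omega>)\<^sup>2) / 2" "\<bar>W i \<omega> * W j \<omega>\<bar> \<le> (W i \<omega>)\<^sup>2 + (W j \<omega>)\<^sup>2"
      unfolding power2_diff power2_sum by (simp_all add: abs_le_iff)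
  qed
  have intWW: "integrable M (\<lambda>\<omega>. W i \<omega> * W j \<omega>)" for i j
  proof (rule Bochner_Integration.integrable_bound)
    show "integrable M (\<lambda>\<omega>. (W i \<omega>)\<^sup>2 + (W j \<omega>)\<^sup>2)" by (intro Bochner_Integration.integrable_add intW2)
    show "AE \<omega> in M. norm (W i \<omega> * W j \<omega>) \<le> norm ((W i \<omega>)\<^sup>2 + (W j \<omega>)\<^sup>2)"
      using prod_le(2) by (intro AE_I2) simp
  qed measurable
  have cov_near: "expectation (\<lambda>\<omega>. W i \<omega> * W j \<omega>) \<le> V" for i j
  proof -
    have "expectation (\<lambda>\<omega>. W i \<omega> * W j \<omega>) \<le> expectation (\<lambda>\<omega>. ((W i \<omega>)\<^sup>2 + (W j \<omega>)\<^sup>2) / 2)"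
      using intWW intW2 prod_le(1) by (intro integral_mono) auto
    also have "\<dots> = V" using intW2 EW2 by simp
    finally show ?thesis .
  qed
  have cov_far: "expectation (\<lambda>\<omega>. W i \<omega> * W j \<omega>) = 0" if ij: "2 * R < i - j \<or> 2 * R < j - i" for i j
  proof -
    define f where "f c = (if c then W i else W j)" for c
    define K where "K c = {a. l1 (clock_source a - scale ((if c then i else j) * m) u) < R}" for c
    \<comment> \<open>Here \<open>m\<close> and \<open>u\<close> being nonzero enters: starting
      points are at least as far apart as their indices.\<close>
    have far: "2 * R < l1 (scale (i * m) u - scale (j * m) u)"
    proof -
      have l1u: "1 \<le> l1 u" using u l1_eq_0_iff[of u] by linarith
      have *: "2 * R < l1 (scale (i * m) u - scale (j * m) u)" if "2 * R < i - j" for i j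
      proof -
        have "scale (i * m) u - scale (j * m) u = scale ((i - j) * m) u"
          using that scale_diff[OF mult_le_mono1[of j i m], of u] by (simp add: diff_mult_distrib)
        then have "l1 (scale (i * m) u - scale (j * m) u) = (i - j) * (m * l1 u)" by (simp add: l1_scale)
        moreover have "(i - j) * 1 \<le> (i - j) * (m * l1 u)" using m l1u by (intro mult_left_mono) auto
        ultimately show ?thesis using that by linarith
      qed
      show ?thesis using ij *[of i j] *[of j i] l1_commute[of "scale (i * m) u"] by auto
    qed
    have "indep_vars (\<lambda>_. borel) f UNIV"
      unfolding M_PiM
    proof (rule indep_vars_disjoint_support[where K = K])
      show "f c \<in> borel_measurable (PiM UNIV clock_law)" for c unfolding M_PiM[symmetric] f_def by (cases c) simp_all
      have "K True \<inter> K False = {}"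
      proof (rule ccontr)
        assume "\<not> ?thesis"
        then obtain a where "l1 (clock_source a - scale (i * m) u) < R" "l1 (clock_source a - scale (j * m) u) < R"
          by (auto simp: K_def)
        then show False using far l1_triangle[of "scale (i * m) u" "scale (j * m) u" "clock_source a"]
          l1_commute[of "scale (i * m) u" "clock_source a"] by simp
      qed
      then show "disjoint_family_on K UNIV" by (auto simp: disjoint_family_on_def) (metis (full_types) disjoint_iff)+
      fix c and \<omega> \<omega>' :: "(int ^ 'd) clock \<Rightarrow> real" assume *: "\<And>a. a \<in> K c \<Longrightarrow> \<omega> a = \<omega>' a"
      have "D (if c then i else j) \<omega> = D (if c then i else j) \<omega>'"
        unfolding D_def
      proof (rule fpp_upto_depends)
        fix v w assume "l1 (v - scale ((if c then i else j) * m) u) < R"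
        then have "\<omega> (Spread1 v w) = \<omega>' (Spread1 v w)" by (intro *) (simp add: K_def)
        then show "tau1 \<omega> v w = tau1 \<omega>' v w" by (simp add: tau1_def)
      qed
      then show "f c \<omega> = f c \<omega>'" by (simp add: f_def W_def split: if_splits)
    qed (rule prob_space_law)
    then have "indep_var borel (W i) borel (W j)"
      unfolding indep_var_def by (rule indep_vars_cong[THEN iffD1, rotated -1]) (auto simp: f_def split: bool.split)
    from indep_var_lebesgue_integral[OF this intW intW] show ?thesis by (simp add: EW)
  qed
  have eq: "(chunk_sum R m N u (tau1 \<omega>) - N * b)\<^sup>2 = (\<Sum>i<N. \<Sum>j<N. W i \<omega> * W j \<omega>)" for \<omega>
  proof -
    have "chunk_sum R m N u (tau1 \<omega>) - N * b = (\<Sum>i<N. W i \<omega>)"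
      by (simp add: chunk_sum_def W_def D_def sum_subtractf)
    then show ?thesis by (simp add: power2_eq_square sum_product)
  qed
  show "integrable M (\<lambda>\<omega>. (chunk_sum R m N u (tau1 \<omega>) - N * b)\<^sup>2)"
    unfolding eq by (intro Bochner_Integration.integrable_sum intWW)
  have "expectation (\<lambda>\<omega>. (chunk_sum R m N u (tau1 \<omega>) - N * b)\<^sup>2) = (\<Sum>i<N. \<Sum>j<N. expectation (\<lambda>\<omega>. W i \<omega> * W j \<omega>))"
    unfolding eq by (simp add: Bochner_Integration.integral_sum Bochner_Integration.integrable_sum intWW)
  also have "\<dots> \<le> (\<Sum>i<N. real (4 * R + 1) * V)"
  proof (rule sum_mono)
    fix i
    let ?near = "{j. j < N \<and> i - j \<le> 2 * R \<and> j - i \<le> 2 * R}"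
    have V: "0 \<le> V" unfolding V_def by (rule var_upto_nonneg)
    have "(\<Sum>j<N. expectation (\<lambda>\<omega>. W i \<omega> * W j \<omega>)) = (\<Sum>j\<in>?near. expectation (\<lambda>\<omega>. W i \<omega> * W j \<omega>))"
    proof (rule sum.mono_neutral_right)
      show "\<forall>j\<in>{..<N} - ?near. expectation (\<lambda>\<omega>. W i \<omega> * W j \<omega>) = 0"
      proof
        fix j assume "j \<in> {..<N} - ?near"
        then have "2 * R < i - j \<or> 2 * R < j - i" by auto
        then show "expectation (\<lambda>\<omega>. W i \<omega> * W j \<omega>) = 0" by (rule cov_far)
      qed
    qed auto
    also have "\<dots> \<le> (\<Sum>j\<in>?near. V)" by (intro sum_mono cov_near)
    also have "\<dots> = card ?near * V" by simp
    also have "\<dots> \<le> real (4 * R + 1) * V"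
    proof (intro mult_right_mono of_nat_mono V)
      have "?near \<subseteq> {i - 2 * R .. i + 2 * R}" by auto
      then have "card ?near \<le> card {i - 2 * R .. i + 2 * R}" by (intro card_mono) auto
      also have "\<dots> \<le> 4 * R + 1" by simp
      finally show "card ?near \<le> 4 * R + 1" .
    qed
    finally show "(\<Sum>j<N. expectation (\<lambda>\<omega>. W i \<omega> * W j \<omega>)) \<le> real (4 * R + 1) * V" by simp
  qed
  also have "\<dots> = real N * (real (4 * R + 1) * V)" by simp
  finally show "expectation (\<lambda>\<omega>. (chunk_sum R m N u (tau1 \<omega>) - N * b)\<^sup>2) \<le> real N * (real (4 * R + 1) * V)" .
qed

lemma prob_chunk_sum_deviation:
  assumes R: "l1 (scale m u) < R" and m: "0 < m" and u: "u \<noteq> 0" and s: "0 < s"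
  shows "prob {\<omega>. s \<le> \<bar>chunk_sum R m N u (tau1 \<omega>) - N * mean_upto R (scale m u)\<bar>}
    \<le> real N * (real (4 * R + 1) * var_upto R (scale m u)) / s\<^sup>2"
proof -
  let ?Q = "\<lambda>\<omega>. (chunk_sum R m N u (tau1 \<omega>) - N * mean_upto R (scale m u))\<^sup>2"
  note mom = chunk_sum_second_moment[OF R m u, of N]
  have "{\<omega>. s \<le> \<bar>chunk_sum R m N u (tau1 \<omega>) - N * mean_upto R (scale m u)\<bar>} = {\<omega>\<in>space M. s\<^sup>2 \<le> ?Q \<omega>}"
    using s by (auto simp: abs_le_square_iff[symmetric])
  also have "prob \<dots> \<le> expectation ?Q / s\<^sup>2"
    using s mom(1) by (intro integral_Markov_inequality_measure[where A = "{}"]) auto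
  also have "\<dots> \<le> real N * (real (4 * R + 1) * var_upto R (scale m u)) / s\<^sup>2"
    by (rule divide_right_mono[OF mom(2)]) simp
  finally show ?thesis .
qed

lemma prob_chunk_sum_deviation2:
  assumes lam1: "lam = 1" and "l1 (scale m u) < R" "0 < m" "u \<noteq> 0" "0 < s"
  shows "prob {\<omega>. s \<le> \<bar>chunk_sum R m N u (tau2 \<omega>) - N * mean_upto R (scale m u)\<bar>}
    \<le> real N * (real (4 * R + 1) * var_upto R (scale m u)) / s\<^sup>2"
proof -
  let ?A = "{\<omega>. s \<le> \<bar>chunk_sum R m N u (tau1 \<omega>) - N * mean_upto R (scale m u)\<bar>}"
  have A: "?A \<in> events"
    by (rule events_Collect) measurable
  have rate: "clock_rate lam rho (swap_clock c) = clock_rate lam rho c" for c using lam1 by (cases c) auto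
  have "prob {\<omega>. s \<le> \<bar>chunk_sum R m N u (tau2 \<omega>) - N * mean_upto R (scale m u)\<bar>} = prob {\<omega>. (\<lambda>c. \<omega> (swap_clock c))
    \<in> ?A}"
    by (simp add: tau1_swap)
  also have "\<dots> = prob ?A" by (rule prob_reindex[OF inj_swap_clock rate A])
  finally show ?thesis using prob_chunk_sum_deviation[OF assms(2-)] by simp
qed

text \<open>
  Both metrics lie below sums of \<open>N\<close> stationary, finitely dependent blocks, which concentrate around their
  common mean; the blocks can be chosen with a mean so close to the time constant that the metrics
  cannot lie much below them either, in expectation and hence in probability.
\<close>

lemma weak_law:
  assumes lam1: "lam = 1" and U: "finite U" "0 \<notin> U" and \<delta>: "0 < \<delta>" and \<theta>: "0 < \<theta>"
  shows "\<exists>m>0. \<exists>N0. \<forall>N\<ge>N0. prob {\<omega>. \<exists>u\<in>U. fpp (tau1 \<omega>) 0 (scale (N * m) u) + \<delta> * real (N * m)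
    < fpp (tau2 \<omega>) 0 (scale (N * m) u)} \<le> \<theta>"
proof -
  \<comment> \<open>Summing over all directions lets a single \<open>m\<close> serve the whole of
    \<open>U\<close>.\<close>
  define A where "A n = (\<Sum>u\<in>U. expectation (\<lambda>\<omega>. fpp (tau1 \<omega>) 0 (scale n u)))" for n
  have A_nonneg: "0 \<le> A n" for n
    unfolding A_def by (intro sum_nonneg Bochner_Integration.integral_nonneg fpp_nonneg) simp
  \<comment> \<open>An infimum instead of a limit: all that is asked of the time constant is the
    lower bound on \<open>A (N * m)\<close>.\<close>
  define \<mu> where "\<mu> = (INF n\<in>{0<..}. A n / real n)"
  have bdd: "bdd_below ((\<lambda>n. A n / real n) ` {0<..})"
    by (rule bdd_belowI[of _ 0]) (auto intro: divide_nonneg_nonneg A_nonneg)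
  have \<mu>: "real n * \<mu> \<le> A n" if "0 < n" for n
  proof -
    have "\<mu> \<le> A n / real n" unfolding \<mu>_def using that by (intro cINF_lower bdd) auto
    then show ?thesis using that by (simp add: field_simps)
  qed
  \<comment> \<open>Two errors \<delta>1 per unit length, from the choice of \<open>m\<close> and
    from the truncation at \<open>R\<close>, add up to \<open>s * (\<theta> / 2)\<close>, where
    \<open>s\<close> will be a third of \<open>\<delta> * real (N * m)\<close>. Markov's inequality
    then leaves \<open>\<theta> / 2\<close>.\<close>
  define \<delta>1 where "\<delta>1 = \<delta> * \<theta> / 12"
  have \<delta>1: "0 < \<delta>1" using \<delta> \<theta> by (simp add: \<delta>1_def)
  have "\<exists>m\<in>{0<..}. A m / real m < \<mu> + \<delta>1"
  proof (rule ccontr)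
    assume "\<not> ?thesis"
    then have "\<mu> + \<delta>1 \<le> \<mu>" unfolding \<mu>_def[of] by (intro cINF_greatest) (auto simp: not_less \<mu>_def)
    with \<delta>1 show False by simp
  qed
  then obtain m where m: "0 < m" and "A m / real m < \<mu> + \<delta>1" by auto
  then have Am: "A m \<le> real m * (\<mu> + \<delta>1)" by (simp add: field_simps)
  have "(\<lambda>R. \<Sum>u\<in>U. mean_upto R (scale m u)) \<longlonglongrightarrow> A m"
    unfolding A_def mean_upto_def by (intro tendsto_sum expectation_fpp_upto_tendsto)
  then have "eventually (\<lambda>R. (\<Sum>u\<in>U. mean_upto R (scale m u)) < A m + real m * \<delta>1) sequentially"
    using m \<delta>1 by (intro order_tendstoD(2)) auto
  moreover have "eventually (\<lambda>R. \<forall>u\<in>U. l1 (scale m u) < R) sequentially"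
    using U(1) by (intro eventually_ball_finite) (auto intro: eventually_gt_at_top)
  ultimately have "eventually (\<lambda>R. (\<Sum>u\<in>U. mean_upto R (scale m u)) < A m + real m * \<delta>1
    \<and> (\<forall>u\<in>U. l1 (scale m u) < R)) sequentially"
    by (rule eventually_conj)
  from eventually_happens'[OF sequentially_bot this]
  obtain R where Rm: "(\<Sum>u\<in>U. mean_upto R (scale m u)) < A m + real m * \<delta>1" and R: "\<And>u. u \<in> U \<Longrightarrow> l1 (scale m u) < R"
    by blast
  \<comment> \<open>\<open>c / N\<close> is the sum of the Chebyshev bounds for both metrics; the 9
    is the square of the 3 in \<open>s\<close>.\<close>
  define c where "c = (\<Sum>u\<in>U. 2 * (real (4 * R + 1) * var_upto R (scale m u)) * 9 / (\<delta> * m)\<^sup>2)"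
  define N0 where "N0 = Suc (nat \<lceil>2 * c / \<theta>\<rceil>)"
  have "prob {\<omega>. \<exists>u\<in>U. fpp (tau1 \<omega>) 0 (scale (N * m) u) + \<delta> * real (N * m) < fpp (tau2 \<omega>) 0 (scale (N * m) u)}
    \<le> \<theta>" if N: "N0 \<le> N" for N
  proof -
    have N': "0 < N" "2 * c / \<theta> \<le> real N" using N unfolding N0_def by linarith+
    define s where "s = \<delta> * real (N * m) / 3"
    have s: "0 < s" using \<delta> N' m by (simp add: s_def)
    \<comment> \<open>Each summand is nonnegative, so a bound on the sum bounds the gap in every
      direction at once.\<close>
    define Z where "Z \<omega> = (\<Sum>u\<in>U. chunk_sum R m N u (tau1 \<omega>) - fpp (tau1 \<omega>) 0 (scale (N * m) u))" for \<omega>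
    have Z_nonneg: "0 \<le> chunk_sum R m N u (tau1 \<omega>) - fpp (tau1 \<omega>) 0 (scale (N * m) u)" if "u \<in> U" for u \<omega>
      using fpp_le_chunk_sum[OF _ R[OF that], of "tau1 \<omega>" N] by simp
    have Z0: "0 \<le> Z \<omega>" for \<omega> unfolding Z_def by (intro sum_nonneg Z_nonneg)
    have intZ: "integrable M Z" unfolding Z_def
      by (intro Bochner_Integration.integrable_sum Bochner_Integration.integrable_diff expectation_chunk_sum(1) fpp_integrable R)
    have "expectation Z
      = (\<Sum>u\<in>U. expectation (\<lambda>\<omega>. chunk_sum R m N u (tau1 \<omega>)) - expectation (\<lambda>\<omega>. fpp (tau1 \<omega>) 0 (scale (N * m) u)))"
      unfolding Z_def using R
      by (subst Bochner_Integration.integral_sum)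
        (auto intro!: sum.cong Bochner_Integration.integral_diff Bochner_Integration.integrable_diff expectation_chunk_sum(1) fpp_integrable)
    also have "\<dots> = N * (\<Sum>u\<in>U. mean_upto R (scale m u)) - A (N * m)"
      using R by (simp add: sum_subtractf A_def expectation_chunk_sum(2) sum_distrib_left)
    also have "\<dots> \<le> N * (real m * (\<mu> + \<delta>1) + real m * \<delta>1) - real (N * m) * \<mu>"
      using Rm Am \<mu>[of "N * m"] N' m by (intro diff_mono mult_left_mono) auto
    also have "\<dots> = s * (\<theta> / 2)" by (simp add: s_def \<delta>1_def field_simps)
    finally have EZ: "expectation Z \<le> s * (\<theta> / 2)" .
    let ?E1 = "{\<omega>\<in>space M. s \<le> Z \<omega>}"
    let ?E2 = "\<lambda>u. {\<omega>. s \<le> \<bar>chunk_sum R m N u (tau1 \<omega>) - N * mean_upto R (scale m u)\<bar>}"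
    let ?E3 = "\<lambda>u. {\<omega>. s \<le> \<bar>chunk_sum R m N u (tau2 \<omega>) - N * mean_upto R (scale m u)\<bar>}"
    have E1: "?E1 \<in> events" using intZ by measurable
    have E23: "?E2 u \<in> events" "?E3 u \<in> events" for u
      by (rule events_Collect, measurable)+
    have "prob ?E1 \<le> expectation Z / s"
      using s intZ Z_nonneg by (intro integral_Markov_inequality_measure[where A = "{}"]) (auto simp: Z0)
    also have "\<dots> \<le> \<theta> / 2" using EZ s by (simp add: field_simps)
    finally have p1: "prob ?E1 \<le> \<theta> / 2" .
    have p2: "prob (\<Union>u\<in>U. ?E2 u \<union> ?E3 u) \<le> \<theta> / 2"
    proof -
      have "prob (\<Union>u\<in>U. ?E2 u \<union> ?E3 u) \<le> (\<Sum>u\<in>U. prob (?E2 u \<union> ?E3 u))"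
        using U(1) E23 by (intro finite_measure_subadditive_finite) auto
      also have "\<dots> \<le> (\<Sum>u\<in>U. 2 * (real N * (real (4 * R + 1) * var_upto R (scale m u)) / s\<^sup>2))"
      proof (rule sum_mono)
        fix u assume u: "u \<in> U"
        then have "u \<noteq> 0" using U(2) by auto
        have "prob (?E2 u \<union> ?E3 u) \<le> prob (?E2 u) + prob (?E3 u)" using E23 by (intro measure_Un_le)
        also have "\<dots> \<le> real N * (real (4 * R + 1) * var_upto R (scale m u)) / s\<^sup>2 + real N * (real (4 * R
          + 1) * var_upto R (scale m u)) / s\<^sup>2"
          by (intro add_mono prob_chunk_sum_deviation prob_chunk_sum_deviation2 lam1 R u m \<open>u \<noteq> 0\<close> s)
        finally show "prob (?E2 u \<union> ?E3 u) \<le> 2 * (real N * (real (4 * R + 1) * var_upto R (scale m u)) / s\<^sup>2)"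
          by (simp only: mult_2)
      qed
      also have "\<dots> = (\<Sum>u\<in>U. (2 * (real (4 * R + 1) * var_upto R (scale m u)) * 9 / (\<delta> * m)\<^sup>2) / N)"
        using N' m \<delta> by (intro sum.cong) (auto simp: s_def power2_eq_square field_simps)
      also have "\<dots> = c / N" unfolding c_def by (simp only: sum_divide_distrib)
      also have "\<dots> \<le> \<theta> / 2" using N' \<theta> by (simp add: field_simps)
      finally show ?thesis .
    qed
    have "{\<omega>. \<exists>u\<in>U. fpp (tau1 \<omega>) 0 (scale (N * m) u) + \<delta> * real (N * m) < fpp (tau2 \<omega>) 0 (scale (N * m) u)}
      \<subseteq> ?E1 \<union> (\<Union>u\<in>U. ?E2 u \<union> ?E3 u)"
    proof
      fix \<omega> assume "\<omega> \<in> {\<omega>. \<exists>u\<in>U. fpp (tau1 \<omega>) 0 (scale (N * m) u) + \<delta> * real (N * m)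
        < fpp (tau2 \<omega>) 0 (scale (N * m) u)}"
      then obtain u where u: "u \<in> U" "fpp (tau1 \<omega>) 0 (scale (N * m) u) + \<delta> * real (N * m)
        < fpp (tau2 \<omega>) 0 (scale (N * m) u)" by blast
      show "\<omega> \<in> ?E1 \<union> (\<Union>u\<in>U. ?E2 u \<union> ?E3 u)"
      proof (rule ccontr)
        assume "\<not> ?thesis"
        then have n: "Z \<omega> < s" "\<bar>chunk_sum R m N u (tau1 \<omega>) - N * mean_upto R (scale m u)\<bar> < s"
          "\<bar>chunk_sum R m N u (tau2 \<omega>) - N * mean_upto R (scale m u)\<bar> < s" using u(1) by auto
        have "chunk_sum R m N u (tau1 \<omega>) - fpp (tau1 \<omega>) 0 (scale (N * m) u) \<le> Z \<omega>"
          unfolding Z_def by (rule member_le_sum[OF u(1)]) (use U(1) Z_nonneg in auto)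
        moreover have "fpp (tau2 \<omega>) 0 (scale (N * m) u) \<le> chunk_sum R m N u (tau2 \<omega>)"
          by (rule fpp_le_chunk_sum[OF _ R[OF u(1)]]) simp
        \<comment> \<open>The comparison runs from the second metric through its chunk sum, the
          common mean and the first chunk sum to the first metric; each of the three errors is below
          \<open>s\<close>.\<close>
        ultimately show False using n u(2) unfolding s_def by linarith
      qed
    qed
    then have "prob {\<omega>. \<exists>u\<in>U. fpp (tau1 \<omega>) 0 (scale (N * m) u) + \<delta> * real (N * m)
      < fpp (tau2 \<omega>) 0 (scale (N * m) u)} \<le> prob (?E1 \<union> (\<Union>u\<in>U. ?E2 u \<union> ?E3 u))"
      using E1 E23 U(1) by (intro finite_measure_mono) auto
    also have "\<dots> \<le> prob ?E1 + prob (\<Union>u\<in>U. ?E2 u \<union> ?E3 u)"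
      using E1 E23 U(1) by (intro measure_Un_le) auto
    also have "\<dots> \<le> \<theta>" using p1 p2 by simp
    finally show ?thesis .
  qed
  with m show ?thesis by blast
qed

end

section \<open>Extinction of type 1\<close>

lemma card_l1_ball_le: "card {v :: int ^ 'd::finite. l1 v \<le> r} \<le> (2 * r + 1) ^ CARD('d)"
proof -
  have "{v :: int ^ 'd. l1 v \<le> r} = block 1 r 0" by (simp add: block_def cell_def)
  then show ?thesis using card_block_le[of 1 r "0 :: int ^ 'd"] by simp
qed

lemma l1_cell_le: assumes "0 < n" shows "n * l1 (cell n x) \<le> l1 (x :: int ^ 'd::finite) + CARD('d) * n"
proof -
  have "int n * \<bar>cell n x $ i\<bar> \<le> \<bar>x $ i\<bar> + int n" for i
  proof -
    have "int n * (x $ i div int n) = x $ i - x $ i mod int n" by (simp add: minus_mod_eq_mult_div)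
    moreover have "0 \<le> x $ i mod int n" "x $ i mod int n < int n" using assms by simp_all
    moreover have "\<bar>int n * (x $ i div int n)\<bar> = int n * \<bar>x $ i div int n\<bar>" by (simp add: abs_mult)
    ultimately show ?thesis unfolding cell_def by simp
  qed
  then have "(\<Sum>i\<in>UNIV. int n * \<bar>cell n x $ i\<bar>) \<le> (\<Sum>i\<in>UNIV. \<bar>x $ i\<bar> + int n)" by (rule sum_mono)
  then have "int (n * l1 (cell n x)) \<le> int (l1 x + CARD('d) * n)"
    by (simp add: int_l1 sum_distrib_left sum.distrib)
  then show ?thesis by linarith
qed

lemma l1_diff_scale_cell:
  fixes x :: "int ^ 'd::finite"
  assumes "0 < n"
  shows "l1 (x - scale n (cell n x)) \<le> CARD('d) * n"
proof (rule l1_le_card)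
  fix i
  have "(x - scale n (cell n x)) $ i = x $ i mod int n" by (simp add: scale_def cell_def minus_mult_div_eq_mod)
  moreover have "0 \<le> x $ i mod int n" "x $ i mod int n < int n" using assms by simp_all
  ultimately show "\<bar>(x - scale n (cell n x)) $ i\<bar> \<le> int n" by linarith
qed

text \<open>Multiplying the \<open>Spread2\<close> clocks by \<open>lam\<close> turns them into clocks of rate 1.\<close>

primrec clock_weight :: "real \<Rightarrow> 'v clock \<Rightarrow> real" where
  "clock_weight lam (Spread1 y x) = 1" | "clock_weight lam (Spread2 y x) = lam" | "clock_weight lam (Conversion x)
    = 1"

definition normalise :: "real \<Rightarrow> ('v clock \<Rightarrow> real) \<Rightarrow> 'v clock \<Rightarrow> real" where
  "normalise lam \<omega> c = clock_weight lam c * \<omega> c"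

lemma tau1_normalise: "tau1 (normalise lam \<omega>) = tau1 \<omega>"
  by (simp add: tau1_def normalise_def fun_eq_iff)

lemma tau2_normalise: "0 < lam \<Longrightarrow> tau2 (normalise lam \<omega>) y x = lam * tau2 \<omega> y x"
  by (simp add: tau2_def normalise_def max_mult_distrib_left)

lemma unconverted_normalise: "unconverted (normalise lam \<omega>) xs = unconverted \<omega> xs"
  by (simp add: unconverted_def tau1_normalise) (simp add: normalise_def)

lemma path_sum_cmult: "path_sum (\<lambda>y x. c * t y x) xs = c * path_sum t xs"
  by (induction t xs rule: path_sum.induct) (auto simp: algebra_simps)

lemma fpp_tau2_normalise_ge:
  assumes "0 < lam"
  shows "lam * fpp (tau2 \<omega>) x y \<le> fpp (tau2 (normalise lam \<omega>)) x y"
proof (rule fpp_greatest)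
  fix xs assume "xs \<in> lpaths x y"
  then have "lam * fpp (tau2 \<omega>) x y \<le> lam * path_sum (tau2 \<omega>) xs" using assms by (intro mult_left_mono fpp_le) auto
  moreover have "tau2 (normalise lam \<omega>) = (\<lambda>y x. lam * tau2 \<omega> y x)"
    by (intro ext tau2_normalise assms)
  ultimately show "lam * fpp (tau2 \<omega>) x y \<le> path_sum (tau2 (normalise lam \<omega>)) xs"
    by (simp only: path_sum_cmult)
qed

section \<open>Comparison of the two metrics on large spheres\<close>

context clocks
begin

text \<open>Multiplying an exponential clock by a constant divides its rate, and doing so
  coordinatewise preserves independence. This couples the model with rate \<open>lam\<close> to the
  one with rate 1.\<close>

lemma distr_normalise: "distr M (clock_space 1 rho) (normalise lam) = clock_space 1 rho"
proof -
  let ?law = "\<lambda>c :: (int ^ 'd) clock. density lborel (exponential_density (clock_rate 1 rho c))"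
  have meas: "(\<lambda>\<omega>. normalise lam \<omega> c) \<in> measurable M (?law c)" for c
    unfolding normalise_def by simp
  have law: "distr M (?law c) (\<lambda>\<omega>. normalise lam \<omega> c) = ?law c" for c
  proof -
    have w: "0 < clock_weight lam c" using lam by (cases c) auto
    have r: "clock_rate lam rho c = clock_weight lam c * clock_rate 1 rho c" by (cases c) auto
    have "0 < clock_rate 1 rho c" using rho by (cases c) auto
    then have "distributed M lborel (\<lambda>\<omega>. normalise lam \<omega> c) (exponential_density (clock_rate 1 rho c))"
    proof (rule exponential_distributedI[rotated])
      show "(\<lambda>\<omega>. normalise lam \<omega> c) \<in> borel_measurable M" unfolding normalise_def by measurable
      fix a :: real assume a: "0 \<le> a"
      have "{\<omega>\<in>space M. normalise lam \<omega> c \<le> a} = {\<omega>. \<omega> c \<le> a / clock_weight lam c}"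
        using w by (auto simp: normalise_def field_simps)
      then have "prob {\<omega>\<in>space M. normalise lam \<omega> c \<le> a}
        = 1 - exp (- (a / clock_weight lam c) * clock_rate lam rho c)"
        using prob_clock_le[of "a / clock_weight lam c" c] a w by simp
      also have "- (a / clock_weight lam c) * clock_rate lam rho c = - a * clock_rate 1 rho c"
        unfolding r using w by simp
      finally show "emeasure M {\<omega>\<in>space M. normalise lam \<omega> c \<le> a} = 1 - ennreal (exp (- a * clock_rate 1 rho c))"
        by (simp add: emeasure_eq_measure ennreal_minus ennreal_1[symmetric] del: ennreal_1)
    qed
    then have "distr M lborel (\<lambda>\<omega>. normalise lam \<omega> c) = ?law c" by (simp add: distributed_def)
    moreover have "distr M (?law c) (\<lambda>\<omega>. normalise lam \<omega> c) = distr M lborel (\<lambda>\<omega>. normalise lam \<omega> c)"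
      by (intro distr_cong) auto
    ultimately show ?thesis by simp
  qed
  have "indep_vars ?law (\<lambda>c \<omega>. normalise lam \<omega> c) UNIV"
    unfolding M_PiM
  proof (rule indep_vars_disjoint_support[where K = "\<lambda>c. {c}"])
    show "(\<lambda>\<omega>. normalise lam \<omega> c) \<in> measurable (PiM UNIV clock_law) (?law c)" for c using meas unfolding M_PiM .
  qed (auto simp: disjoint_family_on_def normalise_def intro: prob_space_law)
  then have "distr M (PiM UNIV ?law) (\<lambda>\<omega>. \<lambda>c\<in>UNIV. normalise lam \<omega> c)
    = PiM UNIV (\<lambda>c. distr M (?law c) (\<lambda>\<omega>. normalise lam \<omega> c))"
    by (subst (asm) indep_vars_iff_distr_eq_PiM'[OF _ meas]) simp_all
  then show ?thesis unfolding law clock_space_def by (simp add: restrict_UNIV)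
qed

lemma measurable_normalise: "normalise lam \<in> measurable M (clock_space 1 rho)"
proof -
  have "(\<lambda>\<omega> c. normalise lam \<omega> c)
    \<in> measurable M (PiM UNIV (\<lambda>c :: (int ^ 'd) clock. density lborel (exponential_density (clock_rate 1 rho c))))"
    by (rule measurable_PiM_single') (auto simp: normalise_def)
  then show ?thesis unfolding clock_space_def .
qed

lemma prob_fpp_large2:
  assumes lam1: "lam = 1" and "l1 (x - y) \<le> m"
  shows "prob {\<omega>. 4 * real m < fpp (tau2 \<omega>) x y} \<le> (1/3) ^ m"
proof -
  have A: "{\<omega>. 4 * real m < fpp (tau1 \<omega>) x y} \<in> events"
    by (rule events_Collect) measurable
  have rate: "clock_rate lam rho (swap_clock c) = clock_rate lam rho c" for c using lam1 by (cases c) auto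
  have "prob {\<omega>. 4 * real m < fpp (tau2 \<omega>) x y} = prob {\<omega>. (\<lambda>c. \<omega> (swap_clock c)) \<in> {\<omega>. 4 * real m
    < fpp (tau1 \<omega>) x y}}"
    by (simp add: tau1_swap)
  also have "\<dots> = prob {\<omega>. 4 * real m < fpp (tau1 \<omega>) x y}" by (rule prob_reindex[OF inj_swap_clock rate A])
  finally show ?thesis using prob_fpp_large[OF assms(2)] by simp
qed

text \<open>The cost of rounding an end point to a net point. The first metric is taken towards the
  net and the second away from it: the two directions of an edge have different clocks, and the
  triangle inequalities in \<open>metrics_close\<close> use them in this way.\<close>

lemma far_from_net:
  assumes lam1: "lam = 1" and U: "finite U"
  defines "d \<equiv> CARD('d)"
  defines "F n \<equiv> (\<Union>u\<in>U. \<Union>y\<in>{y. l1 y \<le> d * n}. {\<omega>. 4 * real (d * n) < fpp (tau1 \<omega>) (scale n u + y) (scale n u)} \<union>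
      {\<omega>. 4 * real (d * n) < fpp (tau2 \<omega>) (scale n u) (scale n u + y)})"
  shows "F n \<in> events" "prob (F n) \<le> real (card U) * (real ((2 * (d * n) + 1) ^ d) * (2 * (1/3) ^ (d * n)))"
proof -
  let ?A = "\<lambda>u y. {\<omega>. 4 * real (d * n) < fpp (tau1 \<omega>) (scale n u + y) (scale n u)}"
  let ?B = "\<lambda>u y. {\<omega>. 4 * real (d * n) < fpp (tau2 \<omega>) (scale n u) (scale n u + y)}"
  let ?Y = "{y :: int ^ 'd. l1 y \<le> d * n}"
  have fY: "finite ?Y" using finite_l1_ball[of 0 "d * n"] by simp
  have ev: "?A u y \<in> events" "?B u y \<in> events" for u y
    by (rule events_Collect, measurable)+
  have evY: "(\<Union>y\<in>?Y. ?A u y \<union> ?B u y) \<in> events" for u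
    by (rule sets.finite_UN[OF fY]) (intro sets.Un ev)
  show "F n \<in> events" unfolding F_def by (rule sets.finite_UN[OF U evY])
  have "prob (F n) \<le> (\<Sum>u\<in>U. prob (\<Union>y\<in>?Y. ?A u y \<union> ?B u y))"
    unfolding F_def using U evY by (intro finite_measure_subadditive_finite) auto
  also have "\<dots> \<le> (\<Sum>u\<in>U. real ((2 * (d * n) + 1) ^ d) * (2 * (1/3) ^ (d * n)))"
  proof (rule sum_mono)
    fix u
    have "prob (\<Union>y\<in>?Y. ?A u y \<union> ?B u y) \<le> (\<Sum>y\<in>?Y. prob (?A u y \<union> ?B u y))"
      using fY ev by (intro finite_measure_subadditive_finite) auto
    also have "\<dots> \<le> (\<Sum>y\<in>?Y. 2 * (1/3) ^ (d * n))"
    proof (rule sum_mono)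
      fix y assume "y \<in> ?Y"
      then have "l1 ((scale n u + y) - scale n u) \<le> d * n" "l1 (scale n u - (scale n u + y)) \<le> d * n"
        using l1_commute[of "scale n u" "scale n u + y"] by simp_all
      from prob_fpp_large[OF this(1)] prob_fpp_large2[OF lam1 this(2)]
      have "prob (?A u y) \<le> (1/3) ^ (d * n)" "prob (?B u y) \<le> (1/3) ^ (d * n)" .
      then show "prob (?A u y \<union> ?B u y) \<le> 2 * (1/3) ^ (d * n)"
        using measure_Un_le[OF ev(1)[of u y] ev(2)[of u y]] by linarith
    qed
    also have "\<dots> = real (card ?Y) * (2 * (1/3) ^ (d * n))" by simp
    also have "\<dots> \<le> real ((2 * (d * n) + 1) ^ d) * (2 * (1/3) ^ (d * n))"
      using card_l1_ball_le[of "d * n", where 'd = 'd] unfolding d_def by (intro mult_right_mono of_nat_mono) auto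
    finally show "prob (\<Union>y\<in>?Y. ?A u y \<union> ?B u y) \<le> real ((2 * (d * n) + 1) ^ d) * (2 * (1/3) ^ (d * n))" .
  qed
  finally show "prob (F n) \<le> real (card U) * (real ((2 * (d * n) + 1) ^ d) * (2 * (1/3) ^ (d * n)))" by simp
qed

text \<open>Rounding to a mesh \<open>n\<close> proportional to \<open>L\<close> reduces the sphere
  to finitely many directions \<open>U\<close>, independent of \<open>L\<close>, which
  \<open>weak_law\<close> handles. Rounding costs at most \<open>8 * real (d * n)\<close>, and
  \<open>p\<close> is chosen to keep this below half of the allowed error.\<close>

lemma metrics_close:
  assumes lam1: "lam = 1" and \<epsilon>: "0 < \<epsilon>" and \<theta>: "0 < \<theta>"
  shows "\<exists>L0. \<forall>L\<ge>L0. prob {\<omega>. \<exists>x. l1 x = L \<and> fpp (tau1 \<omega>) 0 x + \<epsilon> * real L < fpp (tau2 \<omega>) 0 x} \<le> \<theta>"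
proof -
  define d where "d = CARD('d)"
  have d: "0 < d" by (simp add: d_def)
  define p where "p = Suc (nat \<lceil>16 * d / \<epsilon>\<rceil>)"
  have p: "16 * real d \<le> \<epsilon> * real p" "0 < p"
  proof -
    have "16 * d / \<epsilon> \<le> real p" unfolding p_def by linarith
    then show "16 * real d \<le> \<epsilon> * real p" using \<epsilon> by (simp add: field_simps)
  qed (simp add: p_def)
  \<comment> \<open>Since \<open>L\<close> will be at most \<open>2 * p * n\<close>, the cell index
    of a site on the sphere has norm at most \<open>2 * p + d\<close>.\<close>
  define U where "U = {u :: int ^ 'd. l1 u \<le> 2 * p + d}"
  have fU: "finite U" unfolding U_def using finite_l1_ball[of 0 "2 * p + d"] by simp
  obtain m N0 where m: "0 < m" and wl: "\<And>N. N0 \<le> N \<Longrightarrow>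
      prob {\<omega>. \<exists>u\<in>U - {0}. fpp (tau1 \<omega>) 0 (scale (N * m) u) + \<epsilon> / 2 * real (N * m)
        < fpp (tau2 \<omega>) 0 (scale (N * m) u)} \<le> \<theta> / 2"
    using weak_law[OF lam1, of "U - {0}" "\<epsilon> / 2" "\<theta> / 2"] fU \<epsilon> \<theta> by auto
  define F where "F n = (\<Union>u\<in>U. \<Union>y\<in>{y. l1 y \<le> d * n}. {\<omega>. 4 * real (d * n) < fpp (tau1 \<omega>) (scale n u
    + y) (scale n u)} \<union>
      {\<omega>. 4 * real (d * n) < fpp (tau2 \<omega>) (scale n u) (scale n u + y)})" for n
  have F: "F n \<in> events" "prob (F n) \<le> real (card U) * (real ((2 * (d * n) + 1) ^ d) * (2 * (1/3) ^ (d * n)))" for n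
    unfolding F_def d_def by (rule far_from_net[OF lam1 fU])+
  have "(\<lambda>n. (2 * real (card U)) * ((real n * (3 * d)) ^ d * ((1/3) ^ d) ^ n)) \<longlonglongrightarrow> (2 * real (card U)) * 0"
    using d by (intro tendsto_mult tendsto_const poly_times_geometric_tendsto_0) (auto simp: power_less_one_iff)
  then have "eventually (\<lambda>n. (2 * real (card U)) * ((real n * (3 * d)) ^ d * ((1/3) ^ d) ^ n) < \<theta> / 2) sequentially"
    using \<theta> by (intro order_tendstoD(2)) auto
  then obtain n1 where n1: "\<And>n. n1 \<le> n \<Longrightarrow> (2 * real (card U)) * ((real n * (3 * d)) ^ d * ((1/3) ^ d) ^ n) < \<theta> / 2"
    unfolding eventually_sequentially by blast
  have pF: "prob (F n) \<le> \<theta> / 2" if "n1 \<le> n" "0 < n" for n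
  proof -
    have "2 * (d * n) + 1 \<le> 3 * (d * n)" using d that by (simp add: Suc_le_eq)
    then have "real (2 * (d * n) + 1) \<le> real n * (3 * d)" using of_nat_mono[of "2 * (d * n) + 1" "3 * (d * n)",
      where 'a = real] by (simp add: mult_ac)
    then have "real ((2 * (d * n) + 1) ^ d) \<le> (real n * (3 * d)) ^ d" unfolding of_nat_power
      by (intro power_mono) auto
    then have "real (card U) * (real ((2 * (d * n) + 1) ^ d) * (2 * (1/3) ^ (d * n)))
      \<le> real (card U) * ((real n * (3 * d)) ^ d * (2 * (1/3) ^ (d * n)))"
      by (intro mult_left_mono mult_right_mono) auto
    also have "\<dots> = (2 * real (card U)) * ((real n * (3 * d)) ^ d * ((1/3) ^ d) ^ n)"
      by (simp only: power_mult mult_ac)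
    also have "\<dots> \<le> \<theta> / 2" using n1[OF that(1)] by simp
    finally show ?thesis using F(2)[of n] by simp
  qed
  have "prob {\<omega>. \<exists>x. l1 x = L \<and> fpp (tau1 \<omega>) 0 x + \<epsilon> * real L < fpp (tau2 \<omega>) 0 x} \<le> \<theta>"
    if L: "p * m * (Suc (max N0 n1)) \<le> L" for L
  proof -
    \<comment> \<open>The mesh has to be a multiple of \<open>m\<close>; this choice puts
      \<open>L\<close> between \<open>p * n\<close> and \<open>2 * p * n\<close>.\<close>
    define N where "N = L div (p * m)"
    have pm: "0 < p * m" using p m by simp
    have N: "Suc (max N0 n1) \<le> N" unfolding N_def using L pm by (simp add: less_eq_div_iff_mult_less_eq mult.commute)
    define n where "n = N * m"
    have n: "n1 \<le> n" "0 < n" "N \<le> n" using N m by (auto simp: n_def intro: order_trans[OF _ mult_le_mono2[of 1 m N]])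
    have "N * (p * m) \<le> L" unfolding N_def by (rule div_times_less_eq_dividend)
    then have pn: "p * n \<le> L" by (simp add: n_def mult_ac)
    have "L < (N + 1) * (p * m)" unfolding N_def using pm by (simp add: dividend_less_div_times)
    also have "\<dots> \<le> (2 * N) * (p * m)" using N by (intro mult_right_mono) auto
    finally have Ln: "L \<le> 2 * p * n" by (simp add: n_def mult_ac)
    let ?E = "{\<omega>. \<exists>u\<in>U - {0}. fpp (tau1 \<omega>) 0 (scale n u) + \<epsilon> / 2 * real n < fpp (tau2 \<omega>) 0 (scale n u)}"
    have pE: "prob ?E \<le> \<theta> / 2" unfolding n_def using N by (intro wl) simp
    have E: "?E \<in> events"
      by (rule events_Collect) measurable
    have "{\<omega>. \<exists>x. l1 x = L \<and> fpp (tau1 \<omega>) 0 x + \<epsilon> * real L < fpp (tau2 \<omega>) 0 x} \<subseteq> ?E \<union> F n"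
    proof
      fix \<omega> :: "(int ^ 'd) clock \<Rightarrow> real" assume "\<omega> \<in> {\<omega>. \<exists>x. l1 x = L
        \<and> fpp (tau1 \<omega>) 0 x + \<epsilon> * real L < fpp (tau2 \<omega>) 0 x}"
      then obtain x where x: "l1 x = L" "fpp (tau1 \<omega>) 0 x + \<epsilon> * real L < fpp (tau2 \<omega>) 0 x" by blast
      show "\<omega> \<in> ?E \<union> F n"
      proof (rule ccontr)
        assume "\<not> ?thesis"
        then have nE: "\<omega> \<notin> ?E" and nF: "\<omega> \<notin> F n" by auto
        define u where "u = cell n x"
        define y where "y = x - scale n u"
        have "n * l1 u \<le> L + d * n" using l1_cell_le[OF n(2), of x] x(1) by (simp add: u_def d_def)
        also have "\<dots> \<le> n * (2 * p + d)" using Ln by (simp add: algebra_simps)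
        finally have "u \<in> U" using n(2) by (simp add: U_def)
        have y: "l1 y \<le> d * n" using l1_diff_scale_cell[OF n(2), of x] by (simp add: y_def u_def d_def)
        have xy: "scale n u + y = x" by (simp add: y_def)
        from nF \<open>u \<in> U\<close> y have loc: "fpp (tau1 \<omega>) x (scale n u) \<le> 4 * real (d * n)" "fpp (tau2 \<omega>) (scale n u) x
          \<le> 4 * real (d * n)"
          unfolding F_def xy[symmetric] by (auto simp: not_less)
        \<comment> \<open>Direction 0 is kept out of \<open>weak_law\<close>, as its chunks would
          all coincide; both metrics vanish there.\<close>
        have net: "fpp (tau2 \<omega>) 0 (scale n u) \<le> fpp (tau1 \<omega>) 0 (scale n u) + \<epsilon> / 2 * real n"
        proof (cases "u = 0")
          case True
          then show ?thesis using \<epsilon> by (simp add: fpp_same)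
        next
          case False
          then show ?thesis using nE \<open>u \<in> U\<close> by (auto simp: not_less)
        qed
        have "8 * real (d * n) = 16 * real d * (real n / 2)" by simp
        also have "\<dots> \<le> \<epsilon> * real p * (real n / 2)" using p(1) by (intro mult_right_mono) auto
        also have "\<dots> = \<epsilon> / 2 * real (p * n)" by simp
        also have "\<dots> \<le> \<epsilon> / 2 * real L" using pn \<epsilon> by (intro mult_left_mono of_nat_mono) auto
        finally have a: "8 * real (d * n) \<le> \<epsilon> / 2 * real L" .
        have "1 * n \<le> p * n" using p(2) by (intro mult_right_mono) auto
        with pn have "n \<le> L" by linarith
        then have b: "\<epsilon> / 2 * real n \<le> \<epsilon> / 2 * real L" using \<epsilon> by (intro mult_left_mono of_nat_mono) auto
        have "fpp (tau2 \<omega>) 0 x \<le> fpp (tau2 \<omega>) 0 (scale n u) + fpp (tau2 \<omega>) (scale n u) x" by (rule fpp_triangle) simp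
        moreover have "fpp (tau1 \<omega>) 0 (scale n u) \<le> fpp (tau1 \<omega>) 0 x + fpp (tau1 \<omega>) x (scale n u)"
          by (rule fpp_triangle) simp
        ultimately show False using loc net a b x(2) by linarith
      qed
    qed
    then have "prob {\<omega>. \<exists>x. l1 x = L \<and> fpp (tau1 \<omega>) 0 x + \<epsilon> * real L < fpp (tau2 \<omega>) 0 x} \<le> prob (?E \<union> F n)"
      using E F(1) by (intro finite_measure_mono) auto
    also have "\<dots> \<le> prob ?E + prob (F n)" using E F(1) by (intro measure_Un_le)
    also have "\<dots> \<le> \<theta>" using pE pF[OF n(1,2)] by simp
    finally show ?thesis .
  qed
  then show ?thesis by blast
qed

lemma prob_sphere_far:
  assumes lam1: "lam = 1"
  shows "prob {\<omega>. \<exists>x. l1 x = L \<and> 4 * real L < fpp (tau2 \<omega>) 0 x} \<le> real ((2 * L + 1) ^ CARD('d)) * (1/3) ^ L"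
proof -
  let ?Y = "{x :: int ^ 'd. l1 x \<le> L}"
  have fY: "finite ?Y" using finite_l1_ball[of 0 L] by simp
  have ev: "{\<omega>. 4 * real L < fpp (tau2 \<omega>) 0 x} \<in> events" for x
    by (rule events_Collect) measurable
  have "prob {\<omega>. \<exists>x. l1 x = L \<and> 4 * real L < fpp (tau2 \<omega>) 0 x} \<le> prob (\<Union>x\<in>?Y. {\<omega>. 4 * real L < fpp (tau2 \<omega>) 0 x})"
    using fY ev by (intro finite_measure_mono sets.finite_UN) auto
  also have "\<dots> \<le> (\<Sum>x\<in>?Y. prob {\<omega>. 4 * real L < fpp (tau2 \<omega>) 0 x})"
    using fY ev by (intro finite_measure_subadditive_finite) auto
  also have "\<dots> \<le> (\<Sum>x\<in>?Y. (1/3) ^ L)"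
  proof (rule sum_mono)
    fix x assume "x \<in> ?Y"
    then have "l1 (0 - x) \<le> L" using l1_commute[of 0 x] by simp
    then show "prob {\<omega>. 4 * real L < fpp (tau2 \<omega>) 0 x} \<le> (1/3) ^ L" by (rule prob_fpp_large2[OF lam1])
  qed
  also have "\<dots> = real (card ?Y) * (1/3) ^ L" by simp
  also have "\<dots> \<le> real ((2 * L + 1) ^ CARD('d)) * (1/3) ^ L"
    by (intro mult_right_mono of_nat_mono card_l1_ball_le) simp
  finally show ?thesis .
qed

text \<open>The excess \<open>\<epsilon> * real L\<close> of unconverted paths pays for three errors
  of a quarter each: the difference of the metrics, the factor \<open>1 / lam'\<close> and the
  conversion time of the origin. The last quarter gives strictness. \<open>lam'\<close> precedes
  \<theta>, so it does not depend on how rare the exceptions are to be.\<close>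

lemma barrier_likely:
  assumes lam1: "lam = 1"
  shows "\<exists>lam'. 0 < lam' \<and> lam' < 1 \<and> (\<forall>\<theta>>0. \<exists>Q\<in>events. prob Q \<le> \<theta> \<and> (\<forall>\<omega>. \<omega> \<notin> Q \<longrightarrow>
    (\<exists>L. \<forall>x xs. l1 x = L \<longrightarrow> xs \<in> lpaths 0 x \<longrightarrow> distinct xs \<longrightarrow> unconverted \<omega> xs \<longrightarrow>
      \<omega> (Conversion 0) + fpp (tau2 \<omega>) 0 x / lam' < path_sum (tau1 \<omega>) xs)))"
proof -
  obtain \<epsilon> k where \<epsilon>: "0 < \<epsilon>" and k: "0 < k" and slow: "\<And>N. 0 < N \<Longrightarrow> \<exists>A\<in>events. prob A \<le> (1/2) ^ N \<and>
    (\<forall>\<omega>. \<omega> \<notin> A \<longrightarrow> (\<forall>x xs. l1 x = k * (N * (2 * CARD('d) + 2) + CARD('d)) \<longrightarrow> xs \<in> lpaths 0 x \<longrightarrow> distinct xs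
      \<longrightarrow> unconverted \<omega> xs \<longrightarrow>
      fpp (tau1 \<omega>) 0 x + \<epsilon> * real (l1 x) < path_sum (tau1 \<omega>) xs))"
    using unconverted_paths_slow by blast
  \<comment> \<open>Division by \<open>lam'\<close> adds \<open>\<epsilon> / 16\<close> times a
    passage time that is typically at most \<open>4 * real L\<close>, thus a quarter of the
    excess.\<close>
  define lam' where "lam' = 1 / (1 + \<epsilon> / 16)"
  have lam': "0 < lam'" "lam' < 1" using \<epsilon> by (simp_all add: lam'_def)
  have "\<exists>Q\<in>events. prob Q \<le> \<theta> \<and> (\<forall>\<omega>. \<omega> \<notin> Q \<longrightarrow>
    (\<exists>L. \<forall>x xs. l1 x = L \<longrightarrow> xs \<in> lpaths 0 x \<longrightarrow> distinct xs \<longrightarrow> unconverted \<omega> xs \<longrightarrow>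
      \<omega> (Conversion 0) + fpp (tau2 \<omega>) 0 x / lam' < path_sum (tau1 \<omega>) xs))" if \<theta>: "0 < \<theta>" for \<theta>
  proof -
    define B2 :: "nat \<Rightarrow> ((int ^ 'd) clock \<Rightarrow> real) set" where "B2 L = {\<omega>. \<exists>x. l1 x = L
      \<and> fpp (tau1 \<omega>) 0 x + \<epsilon> / 4 * real L < fpp (tau2 \<omega>) 0 x}" for L
    define B3 :: "nat \<Rightarrow> ((int ^ 'd) clock \<Rightarrow> real) set" where "B3 L = {\<omega>. \<exists>x. l1 x = L
      \<and> 4 * real L < fpp (tau2 \<omega>) 0 x}" for L
    define B4 :: "nat \<Rightarrow> ((int ^ 'd) clock \<Rightarrow> real) set" where "B4 L = {\<omega>. \<epsilon> / 4 * real L < \<omega> (Conversion 0)}" for L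
    have B: "B2 L \<in> events" "B3 L \<in> events" "B4 L \<in> events" for L
      unfolding B2_def B3_def B4_def by (rule events_Collect, measurable)+
    obtain L2 where L2: "\<And>L. L2 \<le> L \<Longrightarrow> prob (B2 L) \<le> \<theta> / 4"
      using metrics_close[OF lam1, of "\<epsilon> / 4" "\<theta> / 4"] \<epsilon> \<theta> unfolding B2_def by auto
    have "(\<lambda>L. (real L * 3) ^ CARD('d) * (1/3) ^ L) \<longlonglongrightarrow> 0" by (intro poly_times_geometric_tendsto_0) auto
    then have "eventually (\<lambda>L. (real L * 3) ^ CARD('d) * (1/3) ^ L < \<theta> / 4) sequentially"
      using \<theta> by (intro order_tendstoD(2)) auto
    then obtain L3 where L3: "\<And>L. L3 \<le> L \<Longrightarrow> (real L * 3) ^ CARD('d) * (1/3) ^ L < \<theta> / 4"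
      unfolding eventually_sequentially by blast
    have "(\<lambda>L. exp (- (\<epsilon> / 4 * rho)) ^ L) \<longlonglongrightarrow> 0" using \<epsilon> rho by (intro LIMSEQ_power_zero) auto
    then have "eventually (\<lambda>L. exp (- (\<epsilon> / 4 * rho)) ^ L < \<theta> / 4) sequentially"
      using \<theta> by (intro order_tendstoD(2)) auto
    then obtain L4 where L4: "\<And>L. L4 \<le> L \<Longrightarrow> exp (- (\<epsilon> / 4 * rho)) ^ L < \<theta> / 4"
      unfolding eventually_sequentially by blast
    have "(\<lambda>N. (1/2 :: real) ^ N) \<longlonglongrightarrow> 0" by (intro LIMSEQ_power_zero) auto
    then have "eventually (\<lambda>N. (1/2 :: real) ^ N < \<theta> / 4) sequentially"
      using \<theta> by (intro order_tendstoD(2)) auto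
    then obtain N1 where N1: "\<And>N. N1 \<le> N \<Longrightarrow> (1/2 :: real) ^ N < \<theta> / 4"
      unfolding eventually_sequentially by blast
    \<comment> \<open>As \<open>L\<close> is at least \<open>N\<close>, this passes all four
      thresholds at once.\<close>
    define N where "N = Suc (N1 + L2 + L3 + L4)"
    define L where "L = k * (N * (2 * CARD('d) + 2) + CARD('d))"
    have "N * 1 \<le> N * (2 * CARD('d) + 2)" by (intro mult_left_mono) auto
    then have "1 * N \<le> L" unfolding L_def using k by (intro mult_mono) auto
    then have NL: "L2 \<le> L" "L3 \<le> L" "L4 \<le> L" "0 < L" "N1 \<le> N" "0 < N" by (auto simp: N_def)
    obtain A where A: "A \<in> events" "prob A \<le> (1/2) ^ N" and slowA: "\<And>\<omega> x xs. \<omega> \<notin> A \<Longrightarrow> l1 x = L \<Longrightarrow> xs \<in> lpaths 0 x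
      \<Longrightarrow> distinct xs \<Longrightarrow>
      unconverted \<omega> xs \<Longrightarrow> fpp (tau1 \<omega>) 0 x + \<epsilon> * real (l1 x) < path_sum (tau1 \<omega>) xs"
      using slow[OF NL(6)] unfolding L_def[symmetric] by blast
    define Q where "Q = A \<union> (B2 L \<union> (B3 L \<union> B4 L))"
    have Q: "Q \<in> events" unfolding Q_def by (intro sets.Un A B)
    have p3: "prob (B3 L) \<le> \<theta> / 4"
    proof -
      have "real (2 * L + 1) \<le> real L * 3" using NL(4) by simp
      then have "real ((2 * L + 1) ^ CARD('d)) \<le> (real L * 3) ^ CARD('d)" unfolding of_nat_power
        by (intro power_mono) auto
      then have "real ((2 * L + 1) ^ CARD('d)) * (1/3) ^ L \<le> (real L * 3) ^ CARD('d) * (1/3) ^ L"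
        by (intro mult_right_mono) auto
      then show ?thesis using prob_sphere_far[OF lam1, of L] L3[OF NL(2)] unfolding B3_def by linarith
    qed
    have p4: "prob (B4 L) \<le> \<theta> / 4"
    proof -
      have "prob (B4 L) = exp (- (\<epsilon> / 4 * real L) * rho)" unfolding B4_def
        using \<epsilon> prob_clock_gt[of "\<epsilon> / 4 * real L" "Conversion 0"] by simp
      also have "- (\<epsilon> / 4 * real L) * rho = real L * (- (\<epsilon> / 4 * rho))" by (simp add: algebra_simps)
      also have "exp \<dots> = exp (- (\<epsilon> / 4 * rho)) ^ L" by (rule exp_of_nat_mult)
      finally show ?thesis using L4[OF NL(3)] by simp
    qed
    have "prob Q \<le> prob A + (prob (B2 L) + (prob (B3 L) + prob (B4 L)))"
      unfolding Q_def by (intro order_trans[OF measure_Un_le] add_mono order_refl sets.Un A B)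
    also have "\<dots> \<le> \<theta>" using A(2) N1[OF NL(5)] L2[OF NL(1)] p3 p4 by linarith
    finally have pQ: "prob Q \<le> \<theta>" .
    have "\<omega> (Conversion 0) + fpp (tau2 \<omega>) 0 x / lam' < path_sum (tau1 \<omega>) xs"
      if w: "\<omega> \<notin> Q" and x: "l1 x = L" "xs \<in> lpaths 0 x" "distinct xs" "unconverted \<omega> xs" for \<omega> x xs
    proof -
      have 1: "fpp (tau1 \<omega>) 0 x + \<epsilon> * real L < path_sum (tau1 \<omega>) xs" using slowA[OF _ x] w x(1) by (auto simp: Q_def)
      have 2: "fpp (tau2 \<omega>) 0 x \<le> fpp (tau1 \<omega>) 0 x + \<epsilon> / 4 * real L" using w x(1)
        by (auto simp: Q_def B2_def not_less)
      have 3: "fpp (tau2 \<omega>) 0 x \<le> 4 * real L" using w x(1) by (auto simp: Q_def B3_def not_less)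
      have 4: "\<omega> (Conversion 0) \<le> \<epsilon> / 4 * real L" using w by (auto simp: Q_def B4_def not_less)
      have "fpp (tau2 \<omega>) 0 x / lam' = fpp (tau2 \<omega>) 0 x + \<epsilon> / 16 * fpp (tau2 \<omega>) 0 x"
        by (simp add: lam'_def algebra_simps)
      also have "\<dots> \<le> fpp (tau2 \<omega>) 0 x + \<epsilon> / 16 * (4 * real L)" using 3 \<epsilon> by (intro add_left_mono mult_left_mono) auto
      finally have 5: "fpp (tau2 \<omega>) 0 x / lam' \<le> fpp (tau2 \<omega>) 0 x + \<epsilon> / 4 * real L" by simp
      have "0 < \<epsilon> * real L" using \<epsilon> NL(4) by simp
      then show ?thesis using 1 2 4 5 by simp
    qed
    then show ?thesis using Q pQ by blast
  qed
  with lam' show ?thesis by blast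
qed

end

theorem theorem1p3:
  fixes rho :: real
  assumes "CARD('d::finite) \<ge> 2"
    and "rho > 0"
  shows "\<exists>lam'<1::real. \<forall>lam>0. lam > lam' \<longrightarrow>
           (AE \<omega> in (clock_space lam rho :: ((int ^ 'd) clock \<Rightarrow> real) measure).
              type1_dies_out lattice_adj 0 \<omega>)"
proof -
  interpret C1: clocks 1 rho "clock_space 1 rho :: ((int ^ 'd) clock \<Rightarrow> real) measure"
    using assms(2) by unfold_locales auto
  obtain lam' where lam': "0 < lam'" "lam' < 1" and barrier: "\<forall>\<theta>>0. \<exists>Q\<in>C1.events. C1.prob Q \<le> \<theta> \<and> (\<forall>\<omega>. \<omega> \<notin> Q \<longrightarrow>
    (\<exists>L. \<forall>x :: int ^ 'd. \<forall>xs. l1 x = L \<longrightarrow> xs \<in> lpaths 0 x \<longrightarrow> distinct xs \<longrightarrow> unconverted \<omega> xs \<longrightarrow>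
      \<omega> (Conversion 0) + fpp (tau2 \<omega>) 0 x / lam' < path_sum (tau1 \<omega>) xs))"
    using C1.barrier_likely by auto
  have "AE \<omega> in (clock_space lam rho :: ((int ^ 'd) clock \<Rightarrow> real) measure). type1_dies_out lattice_adj 0 \<omega>"
    if lam: "0 < lam" "lam' < lam" for lam
  proof -
    interpret C: clocks lam rho "clock_space lam rho :: ((int ^ 'd) clock \<Rightarrow> real) measure"
      using assms(2) lam by unfold_locales auto
    have "\<forall>i. \<exists>Q\<in>C1.events. C1.prob Q \<le> 1 / real (Suc i) \<and> (\<forall>\<omega>. \<omega> \<notin> Q \<longrightarrow>
      (\<exists>L. \<forall>x :: int ^ 'd. \<forall>xs. l1 x = L \<longrightarrow> xs \<in> lpaths 0 x \<longrightarrow> distinct xs \<longrightarrow> unconverted \<omega> xs \<longrightarrow>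
        \<omega> (Conversion 0) + fpp (tau2 \<omega>) 0 x / lam' < path_sum (tau1 \<omega>) xs))"
      using barrier by simp
    then obtain Q where Q: "\<And>i. Q i \<in> C1.events" "\<And>i. C1.prob (Q i) \<le> 1 / real (Suc i)"
      and QB: "\<And>i \<omega>. \<omega> \<notin> Q i \<Longrightarrow> \<exists>L. \<forall>x :: int ^ 'd. \<forall>xs. l1 x = L \<longrightarrow> xs \<in> lpaths 0 x \<longrightarrow> distinct xs \<longrightarrow> unconverted \<omega> xs \<longrightarrow>
        \<omega> (Conversion 0) + fpp (tau2 \<omega>) 0 x / lam' < path_sum (tau1 \<omega>) xs"
      by metis
    \<comment> \<open>Outside this null set the outcome avoids some \<open>Q i\<close> and so has a
      barrier sphere, with a radius that depends on the outcome.\<close>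
    define Z where "Z = (\<Inter>i. Q i)"
    have Z: "Z \<in> C1.events" unfolding Z_def using Q(1) by (intro sets.countable_INT') auto
    have "C1.prob Z \<le> 1 / real (Suc i)" for i
    proof -
      have "C1.prob Z \<le> C1.prob (Q i)" unfolding Z_def using Q(1) by (intro C1.finite_measure_mono) auto
      then show ?thesis using Q(2)[of i] by simp
    qed
    then have "C1.prob Z \<le> 0"
      by (intro LIMSEQ_le_const[OF LIMSEQ_inverse_real_of_nat]) (auto simp: inverse_eq_divide)
    then have "C1.prob Z = 0" by (simp add: measure_le_0_iff)
    \<comment> \<open>\<open>Z\<close> is null for the clocks of rate 1; it is pulled back along
      \<open>normalise lam\<close>, whose law they have.\<close>
    then have "AE \<omega> in distr (clock_space lam rho) (clock_space 1 rho) (normalise lam). \<omega> \<notin> Z"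
      unfolding C.distr_normalise using Z by (simp add: C1.prob_eq_0)
    then have "AE \<omega> in clock_space lam rho. normalise lam \<omega> \<notin> Z"
      by (rule AE_distrD[OF C.measurable_normalise])
    then show ?thesis using C.AE_locally_finite_clocks
    proof eventually_elim
      fix \<omega> :: "(int ^ 'd) clock \<Rightarrow> real"
      assume nz: "normalise lam \<omega> \<notin> Z" and lf: "locally_finite_clocks \<omega>"
      from nz obtain i where "normalise lam \<omega> \<notin> Q i" by (auto simp: Z_def)
      from QB[OF this] obtain L where L: "\<And>x xs. l1 x = L \<Longrightarrow> xs \<in> lpaths 0 x \<Longrightarrow> distinct xs \<Longrightarrow> unconverted \<omega> xs \<Longrightarrow>
        normalise lam \<omega> (Conversion 0) + fpp (tau2 (normalise lam \<omega>)) 0 x / lam' < path_sum (tau1 \<omega>) xs"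
        unfolding unconverted_normalise tau1_normalise by blast
      show "type1_dies_out lattice_adj 0 \<omega>"
      proof (rule dies_out_if_barrier[OF lf])
        fix x xs assume x: "l1 x = L" "xs \<in> lpaths 0 x" "distinct xs" "unconverted \<omega> xs"
        \<comment> \<open>The normalised passage time divided by \<open>lam\<close> bounds the
          original one, and \<open>lam'\<close> is smaller than \<open>lam\<close>; so the barrier
          for \<open>lam'\<close> is one for every larger rate.\<close>
        have "fpp (tau2 \<omega>) 0 x \<le> fpp (tau2 (normalise lam \<omega>)) 0 x / lam"
          using fpp_tau2_normalise_ge[OF lam(1), of \<omega> 0 x] lam(1) by (simp add: field_simps)
        also have "\<dots> \<le> fpp (tau2 (normalise lam \<omega>)) 0 x / lam'"
          using lam lam'(1) by (intro divide_left_mono fpp_nonneg) auto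
        finally show "\<omega> (Conversion 0) + fpp (tau2 \<omega>) 0 x < path_sum (tau1 \<omega>) xs"
          using L[OF x] by (simp add: normalise_def)
      qed
    qed
  qed
  with lam'(2) show ?thesis by blast
qed

end
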